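(* Let $U$ be a filtered algebra over $\Bbbk$ such that the associated graded algebra $\overline U=\operatorname{gr}U$ is a Cohen–Macaulay affine algebra. If $g_1,\dots,g_t$ are mutually commuting elements of $U$ such that the variety $\mathsf V(\overline g_1,\dots,\overline g_t)\subset\operatorname{Specm}\overline U$ is equidimensional of codimension $t$, then every $\mu\in\operatorname{Specm}\Bbbk[g_1,\dots,g_t]$ lifts to a simple $U$-module, i.e. there exists a simple left $U$-module $M$ generated by an element $v\in M$ such that $\gamma v=\mu(\gamma)v$ for all $\gamma\in\Bbbk[g_1,\dots,g_t]$.
   Context: $\Bbbk$ is an algebraically closed field of characteristic $0$. An affine algebra is a finitely generated commutative associative $\Bbbk$-algebra; $\operatorname{Specm}\Lambda$ is the variety of maximal ideals of an affine algebra $\Lambda$, and $\mathsf V(f_1,\dots,f_s)\subset\operatorname{Specm}\Lambda$ is the set of maximal ideals containing $f_1,\dots,f_s$. "Equidimensional of codimension $t$" means nonempty with all irreducible components of codimension $t$. A maximal ideal $\mu$ of a commutative affine algebra $\Gamma$ is identified with the character $\Gamma\to\Gamma/\mu=\Bbbk$, $\gamma\mapsto\mu(\gamma)$. A filtered algebra is an associative (unital, not necessarily commutative) $\Bbbk$-algebra $U$ with an increasing filtration $\{U_i\}_{i\ge 0}$, $U_0=\Bbbk$, $U_iU_j\subset U_{i+j}$, $U=\bigcup_i U_i$ ($U_{-1}=0$). Its associated graded algebra is $\overline U=\bigoplus_{i\ge0}U_i/U_{i-1}$. If $u\in U_i\setminus U_{i-1}$, then $\overline u\in U_i/U_{i-1}$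 is the class of $u$. An affine algebra $\Lambda$ is Cohen–Macaulay if for every (proper) ideal $I$ the depth of $I$ (length of a maximal regular sequence contained in $I$) equals $\operatorname{codim}I$ (the minimal codimension of the irreducible components of $\mathsf V(I)$ in $\operatorname{Specm}\Lambda$). *)

theory Defs
  imports "HOL-Algebra.Algebra" "HOL-Library.Extended_Nat"
begin

section \<open>Algebras and modules\<close>

text \<open>
  The locale \<^locale>\<open>algebra\<close> of the library covers commutative algebras only, and
  \<^locale>\<open>module\<close> covers modules over commutative rings only.
\<close>

locale assoc_algebra = module K U + U?: ring U
  for K (structure) and U (structure) +
  assumes smult_mult_left:
      "\<lbrakk> c \<in> carrier K; x \<in> carrier U; y \<in> carrier U \<rbrakk>
        \<Longrightarrow> (c \<odot>\<^bsub>U\<^esub> x) \<otimes>\<^bsub>U\<^esub> y = c \<odot>\<^bsub>U\<^esub> (x \<otimes>\<^bsub>U\<^esub> y)"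
    and smult_mult_right:
      "\<lbrakk> c \<in> carrier K; x \<in> carrier U; y \<in> carrier U \<rbrakk>
        \<Longrightarrow> x \<otimes>\<^bsub>U\<^esub> (c \<odot>\<^bsub>U\<^esub> y) = c \<odot>\<^bsub>U\<^esub> (x \<otimes>\<^bsub>U\<^esub> y)"

locale left_module = R?: ring R + M?: abelian_group M
  for R :: "('a, 'r) ring_scheme" (structure) and M :: "('a, 'b, 'm) module_scheme" (structure) +
  assumes act_closed:
      "\<lbrakk> a \<in> carrier R; x \<in> carrier M \<rbrakk> \<Longrightarrow> a \<odot>\<^bsub>M\<^esub> x \<in> carrier M"
    and act_l_distr:
      "\<lbrakk> a \<in> carrier R; b \<in> carrier R; x \<in> carrier M \<rbrakk>
        \<Longrightarrow> (a \<oplus>\<^bsub>R\<^esub> b) \<odot>\<^bsub>M\<^esub> x = a \<odot>\<^bsub>M\<^esub> x \<oplus>\<^bsub>M\<^esub> b \<odot>\<^bsub>M\<^esub> x"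
    and act_r_distr:
      "\<lbrakk> a \<in> carrier R; x \<in> carrier M; y \<in> carrier M \<rbrakk>
        \<Longrightarrow> a \<odot>\<^bsub>M\<^esub> (x \<oplus>\<^bsub>M\<^esub> y) = a \<odot>\<^bsub>M\<^esub> x \<oplus>\<^bsub>M\<^esub> a \<odot>\<^bsub>M\<^esub> y"
    and act_assoc:
      "\<lbrakk> a \<in> carrier R; b \<in> carrier R; x \<in> carrier M \<rbrakk>
        \<Longrightarrow> (a \<otimes>\<^bsub>R\<^esub> b) \<odot>\<^bsub>M\<^esub> x = a \<odot>\<^bsub>M\<^esub> (b \<odot>\<^bsub>M\<^esub> x)"
    and act_one:
      "x \<in> carrier M \<Longrightarrow> \<one>\<^bsub>R\<^esub> \<odot>\<^bsub>M\<^esub> x = x"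

definition simple_module :: "('a, 'r) ring_scheme \<Rightarrow> ('a, 'b, 'm) module_scheme \<Rightarrow> bool"
  where "simple_module R M \<longleftrightarrow>
    left_module R M \<and> carrier M \<noteq> {\<zero>\<^bsub>M\<^esub>} \<and>
    (\<forall>N. submodule N R M \<longrightarrow> N = {\<zero>\<^bsub>M\<^esub>} \<or> N = carrier M)"

definition scalars :: "('k, 'r) ring_scheme \<Rightarrow> ('k, 'a, 'm) module_scheme \<Rightarrow> 'a set"
  where "scalars K A = (\<lambda>c. c \<odot>\<^bsub>A\<^esub> \<one>\<^bsub>A\<^esub>) ` carrier K"

definition generated_algebra ::
    "('k, 'r) ring_scheme \<Rightarrow> ('k, 'a, 'm) module_scheme \<Rightarrow> 'a set \<Rightarrow> ('k, 'a, 'm) module_scheme"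
  where "generated_algebra K A S = A\<lparr>carrier := generate_ring A (scalars K A \<union> S)\<rparr>"

definition affine_algebra :: "('k, 'r) ring_scheme \<Rightarrow> ('k, 'a, 'm) module_scheme \<Rightarrow> bool"
  where "affine_algebra K A \<longleftrightarrow> algebra K A \<and>
    (\<exists>S. finite S \<and> S \<subseteq> carrier A \<and> carrier (generated_algebra K A S) = carrier A)"


section \<open>The maximal spectrum\<close>

definition Specm :: "('a, 'r) ring_scheme \<Rightarrow> 'a set set"
  where "Specm R = {m. maximalideal m R}"

definition zero_locus :: "('a, 'r) ring_scheme \<Rightarrow> 'a set \<Rightarrow> 'a set set"
  where "zero_locus R S = {m \<in> Specm R. S \<subseteq> m}"

definition zariski_closed :: "('a, 'r) ring_scheme \<Rightarrow> 'a set set \<Rightarrow> bool"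
  where "zariski_closed R Z \<longleftrightarrow> (\<exists>S \<subseteq> carrier R. Z = zero_locus R S)"

definition irreducible_closed :: "('a, 'r) ring_scheme \<Rightarrow> 'a set set \<Rightarrow> bool"
  where "irreducible_closed R Z \<longleftrightarrow> zariski_closed R Z \<and> Z \<noteq> {} \<and>
    (\<forall>A B. zariski_closed R A \<and> zariski_closed R B \<and> Z = A \<union> B \<longrightarrow> Z = A \<or> Z = B)"

definition irreducible_components :: "('a, 'r) ring_scheme \<Rightarrow> 'a set set \<Rightarrow> 'a set set set"
  where "irreducible_components R Z =
    {C. irreducible_closed R C \<and> C \<subseteq> Z \<and>
        (\<forall>D. irreducible_closed R D \<and> C \<subseteq> D \<and> D \<subseteq> Z \<longrightarrow> D = C)}"

text \<open>
  The codimension of an irreducible closed set is the supremum of the lengths of chains of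
  irreducible closed subsets of the whole spectrum that start at it.
\<close>

definition codim_irreducible :: "('a, 'r) ring_scheme \<Rightarrow> 'a set set \<Rightarrow> enat"
  where "codim_irreducible R Z =
    Sup {enat n | n. \<exists>C. C 0 = Z \<and> (\<forall>i\<le>n. irreducible_closed R (C i)) \<and>
                        (\<forall>i<n. C i \<subset> C (Suc i))}"

definition codim_ideal :: "('a, 'r) ring_scheme \<Rightarrow> 'a set \<Rightarrow> enat"
  where "codim_ideal R I =
    Inf (codim_irreducible R ` irreducible_components R (zero_locus R I))"

definition equidimensional_of_codim ::
    "('a, 'r) ring_scheme \<Rightarrow> 'a set set \<Rightarrow> nat \<Rightarrow> bool"
  where "equidimensional_of_codim R Z t \<longleftrightarrow> Z \<noteq> {} \<and>
    (\<forall>C \<in> irreducible_components R Z. codim_irreducible R C = enat t)"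

text \<open>
  For a maximal ideal \<open>m\<close> with residue field \<open>K\<close>, the value of the corresponding character
  at \<open>x\<close> is the unique scalar congruent to \<open>x\<close> modulo \<open>m\<close>.
\<close>

definition character_of ::
    "('k, 'r) ring_scheme \<Rightarrow> ('k, 'a, 'm) module_scheme \<Rightarrow> 'a set \<Rightarrow> 'a \<Rightarrow> 'k"
  where "character_of K A m x =
    (THE c. c \<in> carrier K \<and> x \<ominus>\<^bsub>A\<^esub> (c \<odot>\<^bsub>A\<^esub> \<one>\<^bsub>A\<^esub>) \<in> m)"


section \<open>Depth and Cohen--Macaulay algebras\<close>

definition regular_sequence :: "('a, 'r) ring_scheme \<Rightarrow> 'a list \<Rightarrow> bool"
  where "regular_sequence R xs \<longleftrightarrow>
    set xs \<subseteq> carrier R \<and> Idl\<^bsub>R\<^esub> (set xs) \<noteq> carrier R \<and>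
    (\<forall>i < length xs. \<forall>y \<in> carrier R.
       xs ! i \<otimes>\<^bsub>R\<^esub> y \<in> Idl\<^bsub>R\<^esub> (set (take i xs)) \<longrightarrow> y \<in> Idl\<^bsub>R\<^esub> (set (take i xs)))"

definition maximal_regular_sequence_in ::
    "('a, 'r) ring_scheme \<Rightarrow> 'a set \<Rightarrow> 'a list \<Rightarrow> bool"
  where "maximal_regular_sequence_in R I xs \<longleftrightarrow>
    set xs \<subseteq> I \<and> regular_sequence R xs \<and> (\<forall>x \<in> I. \<not> regular_sequence R (xs @ [x]))"

text \<open>
  Depth is a relation, since in a general ring the length of a maximal regular sequence in an
  ideal need not exist or be unique; for a proper ideal of a Noetherian ring it always does.
\<close>

definition has_depth :: "('a, 'r) ring_scheme \<Rightarrow> 'a set \<Rightarrow> enat \<Rightarrow> bool"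
  where "has_depth R I d \<longleftrightarrow>
    (\<exists>xs. maximal_regular_sequence_in R I xs) \<and>
    (\<forall>xs. maximal_regular_sequence_in R I xs \<longrightarrow> enat (length xs) = d)"

definition cohen_macaulay :: "('a, 'r) ring_scheme \<Rightarrow> bool"
  where "cohen_macaulay R \<longleftrightarrow>
    (\<forall>I. ideal I R \<and> I \<noteq> carrier R \<longrightarrow> has_depth R I (codim_ideal R I))"


section \<open>Filtered algebras and the associated graded algebra\<close>

text \<open>The condition \<open>F_zero\<close> expresses that \<open>F 0\<close> is a copy of the ground field.\<close>

locale filtered_algebra = assoc_algebra K U
  for K :: "('k, 'r) ring_scheme" (structure) and U :: "('k, 'a, 'm) module_scheme" (structure) +
  fixes F :: "nat \<Rightarrow> 'a set"
  assumes F_subspace: "submodule (F i) K U"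
    and F_mono: "F i \<subseteq> F (Suc i)"
    and F_zero: "bij_betw (\<lambda>c. c \<odot>\<^bsub>U\<^esub> \<one>\<^bsub>U\<^esub>) (carrier K) (F 0)"
    and F_mult: "\<lbrakk> x \<in> F i; y \<in> F j \<rbrakk> \<Longrightarrow> x \<otimes>\<^bsub>U\<^esub> y \<in> F (i + j)"
    and F_exhaustive: "carrier U = (\<Union>i. F i)"

definition filt_pred :: "('k, 'a, 'm) module_scheme \<Rightarrow> (nat \<Rightarrow> 'a set) \<Rightarrow> nat \<Rightarrow> 'a set"
  where "filt_pred U F n = (case n of 0 \<Rightarrow> {\<zero>\<^bsub>U\<^esub>} | Suc i \<Rightarrow> F i)"

text \<open>The quotient group \<open>F n / F (n - 1)\<close>, with \<open>F (-1) = 0\<close>; its operation is written multiplicatively.\<close>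

definition gr_piece :: "('k, 'a, 'm) module_scheme \<Rightarrow> (nat \<Rightarrow> 'a set) \<Rightarrow> nat \<Rightarrow> 'a set monoid"
  where "gr_piece U F n = (U\<lparr>carrier := F n\<rparr>) A_Mod (filt_pred U F n)"

text \<open>
  An element of the associated graded algebra is a finitely supported family of cosets, with
  \<open>n\<close>-th entry in \<open>F n / F (n - 1)\<close>. The product of the classes of \<open>a \<in> F i\<close> and \<open>b \<in> F j\<close>
  is the class of \<open>a \<otimes> b\<close> modulo \<open>F (i + j - 1)\<close>. As the pieces are multiplicative
  groups, the sum over \<open>i + j = n\<close> appears as a \<^const>\<open>finprod\<close>.
\<close>

definition gr :: "('k, 'a, 'm) module_scheme \<Rightarrow> (nat \<Rightarrow> 'a set) \<Rightarrow> ('k, nat \<Rightarrow> 'a set) module"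
  where "gr U F =
    \<lparr> carrier = carrier (sum_group UNIV (gr_piece U F)),
      monoid.mult = (\<lambda>x y n. finprod (gr_piece U F n)
        (\<lambda>i. rcoset_mult U (filt_pred U F n) (x i) (y (n - i))) {..n}),
      one = (\<lambda>n. if n = 0 then filt_pred U F 0 +>\<^bsub>U\<^esub> \<one>\<^bsub>U\<^esub> else filt_pred U F n),
      ring.zero = one (sum_group UNIV (gr_piece U F)),
      add = monoid.mult (sum_group UNIV (gr_piece U F)),
      smult = (\<lambda>c x n. \<Union>a \<in> x n. filt_pred U F n +>\<^bsub>U\<^esub> (c \<odot>\<^bsub>U\<^esub> a)) \<rparr>"

text \<open>The symbol of \<open>u\<close> in the associated graded algebra; the symbol of \<open>\<zero>\<close> is \<open>\<zero>\<close>.\<close>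

definition gr_symbol :: "('k, 'a, 'm) module_scheme \<Rightarrow> (nat \<Rightarrow> 'a set) \<Rightarrow> 'a \<Rightarrow> nat \<Rightarrow> 'a set"
  where "gr_symbol U F u = (\<lambda>n. if n = (LEAST i. u \<in> F i)
    then filt_pred U F n +>\<^bsub>U\<^esub> u else filt_pred U F n)"

end

theory Submission
  imports Defs
begin

text \<open>
  By the Nullstellensatz, \<open>\<mu>\<close> is generated by elements \<open>g\<^sub>i - c\<^sub>i\<close> with scalars \<open>c\<^sub>i\<close>, and
  their symbols are those of the \<open>g\<^sub>i\<close>. It suffices that \<open>1\<close> is not of the form
  \<open>\<Sum> u\<^sub>i (g\<^sub>i - c\<^sub>i)\<close>: then a maximal left ideal containing all \<open>g\<^sub>i - c\<^sub>i\<close> exists,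
  and the quotient by it is the desired simple module. As the associated graded algebra is Cohen--Macaulay,
  the ideal of the \<open>t\<close> symbols contains a regular sequence of length \<open>t\<close>, so the Koszul complex of
  the symbols is acyclic. Hence the top symbols of the \<open>u\<^sub>i\<close> in a representation of \<open>1\<close> form a Koszul
  boundary, which lifts to a Koszul boundary over \<open>U\<close> because the \<open>g\<^sub>i\<close> commute; subtracting it
  lowers the degree of the representation, which cannot go on forever.
\<close>

text \<open>The Cohen--Macaulay property yields some regular sequence in the ideal of the symbols;
  it says nothing directly about the symbols, which are the elements that can be lifted to
  \<open>U\<close>. The Koszul complex bridges this: elements of the ideal act on it as
  null-homotopic maps, so it is acyclic as soon as the ideal contains a regular sequence of length
  \<open>t\<close>. That sequence need not be homogeneous, and neither need the bounding chain.
  Giving the basis vector indexed by \<open>l\<close> the degree \<open>koszul_weight es l\<close>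
  makes the differential homogeneous, so the component of the right total degree can be selected
  before lifting. Chains are not split by exterior degree: vanishing in low degrees is all that is
  tracked, and the boundaries that are subtracted respect it. The descent only excludes
  \<open>1\<close> from the left ideal. That the whole subalgebra acts through the character is
  recovered at the end, from congruences modulo \<open>\<mu>\<close> and the maximal left ideal at
  the same time. The residue field of \<open>\<mu>\<close> is identified by extending homomorphisms
  into the ground field, one generator at a time.\<close>

section \<open>The Koszul complex\<close>

text \<open>
  The Koszul complex on \<open>gs\<close>: a basis of the exterior algebra is indexed by the Boolean lists of
  length \<open>length gs\<close>, a chain is its family of coordinates, and \<open>True\<close> marks the basis vectors
  that occur. Adding one element \<open>g\<close> forms the mapping cone of the multiplication by \<open>g\<close>,
  which produces the signs. Coefficients are multiplied from the right, so that \<open>koszul_d\<close> makes sense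
  for commuting elements of a noncommutative ring.
\<close>

fun koszul_d :: "('a, 'b) ring_scheme \<Rightarrow> 'a list \<Rightarrow> (bool list \<Rightarrow> 'a) \<Rightarrow> bool list \<Rightarrow> 'a" where
  "koszul_d R (g # gs) z (False # l) =
     koszul_d R gs (\<lambda>k. z (False # k)) l \<oplus>\<^bsub>R\<^esub> z (True # l) \<otimes>\<^bsub>R\<^esub> g"
| "koszul_d R (g # gs) z (True # l) = \<ominus>\<^bsub>R\<^esub> koszul_d R gs (\<lambda>k. z (True # k)) l"
| "koszul_d R _ z _ = \<zero>\<^bsub>R\<^esub>"

text \<open>Exterior multiplication by the vector \<open>as\<close>, the contracting homotopy.\<close>

fun koszul_h :: "('a, 'b) ring_scheme \<Rightarrow> 'a list \<Rightarrow> (bool list \<Rightarrow> 'a) \<Rightarrow> bool list \<Rightarrow> 'a" where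
  "koszul_h R (a # as) z (False # l) = koszul_h R as (\<lambda>k. z (False # k)) l"
| "koszul_h R (a # as) z (True # l) =
     z (False # l) \<otimes>\<^bsub>R\<^esub> a \<ominus>\<^bsub>R\<^esub> koszul_h R as (\<lambda>k. z (True # k)) l"
| "koszul_h R _ z _ = \<zero>\<^bsub>R\<^esub>"

fun lin_comb :: "('a, 'b) ring_scheme \<Rightarrow> 'a list \<Rightarrow> 'a list \<Rightarrow> 'a" where
  "lin_comb R (a # as) (g # gs) = a \<otimes>\<^bsub>R\<^esub> g \<oplus>\<^bsub>R\<^esub> lin_comb R as gs"
| "lin_comb R _ _ = \<zero>\<^bsub>R\<^esub>"

section \<open>Linearity, square zero and exterior degree over a possibly noncommutative
  ring\<close>

context ring
begin

lemma koszul_d_closed: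
  assumes "set gs \<subseteq> carrier R" "\<And>l. z l \<in> carrier R"
  shows "koszul_d R gs z l \<in> carrier R"
  using assms
proof (induction gs arbitrary: z l)
  case (Cons g gs)
  show ?case
  proof (cases l)
    case (Cons b k)
    then show ?thesis
      using Cons.IH[of "\<lambda>k. z (b # k)" k] Cons.prems by (cases b) simp_all
  qed simp
qed simp

lemma koszul_h_closed:
  assumes "set as \<subseteq> carrier R" "\<And>l. z l \<in> carrier R"
  shows "koszul_h R as z l \<in> carrier R"
  using assms
proof (induction as arbitrary: z l)
  case (Cons a as)
  show ?case
  proof (cases l)
    case (Cons b k)
    then show ?thesis
      using Cons.IH[of "\<lambda>k. z (b # k)" k] Cons.prems by (cases b) simp_all
  qed simp
qed simp

lemma lin_comb_closed:
  assumes "set as \<subseteq> carrier R" "set gs \<subseteq> carrier R"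
  shows "lin_comb R as gs \<in> carrier R"
  using assms
proof (induction as arbitrary: gs)
  case (Cons a as)
  then show ?case by (cases gs) simp_all
qed simp

lemma koszul_d_add:
  assumes "set gs \<subseteq> carrier R" "\<And>l. z l \<in> carrier R" "\<And>l. w l \<in> carrier R"
  shows "koszul_d R gs (\<lambda>l. z l \<oplus> w l) l = koszul_d R gs z l \<oplus> koszul_d R gs w l"
  using assms
proof (induction gs arbitrary: z w l)
  case (Cons g gs)
  show ?case
  proof (cases l)
    case (Cons b k)
    then show ?thesis
      using Cons.IH[of "\<lambda>k. z (b # k)" "\<lambda>k. w (b # k)" k] Cons.prems
        koszul_d_closed[of gs "\<lambda>k. z (b # k)" k] koszul_d_closed[of gs "\<lambda>k. w (b # k)" k]
      by (cases b) (simp_all add: l_distr a_ac minus_add)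
  qed simp
qed simp

lemma koszul_d_minus:
  assumes "set gs \<subseteq> carrier R" "\<And>l. z l \<in> carrier R"
  shows "koszul_d R gs (\<lambda>l. \<ominus> z l) l = \<ominus> koszul_d R gs z l"
  using assms
proof (induction gs arbitrary: z l)
  case (Cons g gs)
  show ?case
  proof (cases l)
    case (Cons b k)
    then show ?thesis
      using Cons.IH[of "\<lambda>k. z (b # k)" k] Cons.prems
        koszul_d_closed[of gs "\<lambda>k. z (b # k)" k]
      by (cases b) (simp_all add: l_minus minus_add)
  qed simp
qed simp

lemma koszul_d_diff:
  assumes "set gs \<subseteq> carrier R" "\<And>l. z l \<in> carrier R" "\<And>l. w l \<in> carrier R"
  shows "koszul_d R gs (\<lambda>l. z l \<ominus> w l) l = koszul_d R gs z l \<ominus> koszul_d R gs w l"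
  using assms koszul_d_add[of gs z "\<lambda>l. \<ominus> w l" l] koszul_d_minus[of gs w l]
  by (simp add: a_minus_def)

text \<open>The differential puts each \<open>g\<close> to the right of a coefficient, so pulling
  out a right factor \<open>x\<close> means moving it past \<open>g\<close>. With \<open>x\<close>
  one of the commuting elements this says that its action is a chain map.\<close>

lemma koszul_d_mult:
  assumes "set gs \<subseteq> carrier R" "\<And>l. z l \<in> carrier R" "x \<in> carrier R"
    and "\<And>g. g \<in> set gs \<Longrightarrow> x \<otimes> g = g \<otimes> x"
  shows "koszul_d R gs (\<lambda>l. z l \<otimes> x) l = koszul_d R gs z l \<otimes> x"
  using assms
proof (induction gs arbitrary: z l)
  case (Cons g gs)
  show ?case
  proof (cases l)
    case (Cons b k)
    then show ?thesis
      using Cons.IH[of "\<lambda>k. z (b # k)" k] Cons.prems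
        koszul_d_closed[of gs "\<lambda>k. z (b # k)" k]
      by (cases b) (simp_all add: l_minus l_distr m_assoc)
  qed (use Cons.prems in simp)
qed (use assms in simp)

text \<open>Chains are total functions on lists; only coordinates at lists of length
  \<open>length gs\<close> enter the differential there, and values elsewhere are arbitrary.\<close>

lemma koszul_d_zero:
  assumes "set gs \<subseteq> carrier R" "\<And>k. length k = length gs \<Longrightarrow> z k = \<zero>" "length l = length gs"
  shows "koszul_d R gs z l = \<zero>"
  using assms
proof (induction gs arbitrary: z l)
  case (Cons g gs)
  show ?case
  proof (cases l)
    case (Cons b k)
    then show ?thesis
      using Cons.IH[of "\<lambda>k. z (b # k)" k] Cons.prems
      by (cases b) simp_all
  qed simp
qed simp

text \<open>In the mapping cone the square consists of squares of the shorter differential, zero by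
  induction, and of the cross term with \<open>g\<close>. The latter occurs twice with opposite
  signs because multiplication by \<open>g\<close> is a chain map.\<close>

lemma koszul_d_squared:
  assumes "set gs \<subseteq> carrier R" "\<And>l. z l \<in> carrier R"
    and "\<And>g h. g \<in> set gs \<Longrightarrow> h \<in> set gs \<Longrightarrow> g \<otimes> h = h \<otimes> g"
  shows "koszul_d R gs (koszul_d R gs z) l = \<zero>"
  using assms
proof (induction gs arbitrary: z l)
  case (Cons g gs)
  note cl = koszul_d_closed[of gs]
  show ?case
  proof (cases l)
    case (Cons b k)
    have "koszul_d R gs (\<lambda>k. koszul_d R gs (\<lambda>k. z (False # k)) k \<oplus> z (True # k) \<otimes> g) k
        = koszul_d R gs (\<lambda>k. z (True # k) \<otimes> g) k"
      using Cons.IH[of "\<lambda>k. z (False # k)" k] Cons.prems cl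
      by (subst koszul_d_add) auto
    also have "\<dots> = koszul_d R gs (\<lambda>k. z (True # k)) k \<otimes> g"
      using Cons.prems by (intro koszul_d_mult) auto
    finally have F: "koszul_d R gs (\<lambda>k. koszul_d R gs (\<lambda>k. z (False # k)) k \<oplus> z (True # k) \<otimes> g) k
        = koszul_d R gs (\<lambda>k. z (True # k)) k \<otimes> g" .
    have T: "koszul_d R gs (\<lambda>k. \<ominus> koszul_d R gs (\<lambda>k. z (True # k)) k) k = \<zero>"
      using Cons.IH[of "\<lambda>k. z (True # k)" k] Cons.prems cl
      by (subst koszul_d_minus) auto
    show ?thesis
      using Cons F T Cons.prems cl[of "\<lambda>k. z (True # k)" k] by (cases b) (simp_all add: l_minus r_neg)
  qed simp
qed simp

text \<open>\<open>count_list l True\<close> is the exterior degree of a basis vector, and every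
  term of the differential at \<open>l\<close> involves a coordinate of degree one higher.\<close>

lemma koszul_d_supp:
  assumes "set gs \<subseteq> carrier R" "length l = length gs"
    and "\<And>k. length k = length gs \<Longrightarrow> count_list k True \<le> Suc m \<Longrightarrow> z k = \<zero>"
    and "count_list l True \<le> m"
  shows "koszul_d R gs z l = \<zero>"
  using assms
proof (induction gs arbitrary: z l m)
  case (Cons g gs)
  show ?case
  proof (cases l)
    case (Cons b k)
    show ?thesis
    proof (cases b)
      case True
      then obtain m' where m: "m = Suc m'"
        using Cons Cons.prems(4) by (cases m) auto
      show ?thesis
        using Cons.IH[of k m' "\<lambda>k. z (b # k)"] Cons.prems True Cons m by simp
    next
      case False
      then show ?thesis
        using Cons.IH[of k m "\<lambda>k. z (b # k)"] Cons.prems Cons by simp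
    qed
  qed (use Cons.prems in simp)
qed simp

text \<open>Exterior multiplication raises the exterior degree, so every term at \<open>l\<close>
  involves a coordinate of degree one lower.\<close>

lemma koszul_h_supp:
  assumes "set as \<subseteq> carrier R" "length l = length as"
    and "\<And>k. length k = length as \<Longrightarrow> count_list k True \<le> m \<Longrightarrow> z k = \<zero>"
    and "count_list l True \<le> Suc m"
  shows "koszul_h R as z l = \<zero>"
  using assms
proof (induction as arbitrary: z l m)
  case (Cons a as)
  show ?case
  proof (cases l)
    case (Cons b k)
    show ?thesis
    proof (cases b)
      case True
      have 1: "z (False # k) = \<zero>"
        using Cons Cons.prems True by simp
      have 2: "koszul_h R as (\<lambda>k. z (True # k)) k = \<zero>"
      proof (cases m)
        case 0
        \<comment> \<open>The induction hypothesis has no instance for a negative bound; here the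
          homotopy vanishes because it has no component in exterior degree 0.\<close>
        have *: "koszul_h R as y j = \<zero>" if "count_list j True = 0" for as j and y :: "bool list \<Rightarrow> 'a"
          using that
        proof (induction j arbitrary: y as)
          case (Cons b j)
          then show ?case by (cases b; cases as) simp_all
        qed simp
        show ?thesis using Cons.prems Cons True 0 by (intro *) auto
      next
        case (Suc m')
        then show ?thesis
          using Cons.IH[of k m' "\<lambda>k. z (b # k)"] Cons.prems True Cons by simp
      qed
      show ?thesis using 1 2 True Cons Cons.prems by (simp add: a_minus_def)
    next
      case False
      then show ?thesis
        using Cons.IH[of k m "\<lambda>k. z (b # k)"] Cons.prems Cons by simp
    qed
  qed (use Cons.prems in simp)
qed simp

end

section \<open>The contracting homotopy and acyclicity over a commutative ring\<close>

context cring
begin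

lemma koszul_h_add:
  assumes "set as \<subseteq> carrier R" "\<And>l. z l \<in> carrier R" "\<And>l. w l \<in> carrier R"
  shows "koszul_h R as (\<lambda>l. z l \<oplus> w l) l = koszul_h R as z l \<oplus> koszul_h R as w l"
  using assms
proof (induction as arbitrary: z w l)
  case (Cons a as)
  show ?case
  proof (cases l)
    case (Cons b k)
    then show ?thesis
      using Cons.IH[of "\<lambda>k. z (b # k)" "\<lambda>k. w (b # k)" k] Cons.prems
        koszul_h_closed[of as "\<lambda>k. z (b # k)" k] koszul_h_closed[of as "\<lambda>k. w (b # k)" k]
      by (cases b) (simp_all add: l_distr a_ac minus_add a_minus_def)
  qed simp
qed simp

text \<open>Here \<open>x\<close> has to be moved past the entries of \<open>as\<close>, which are
  arbitrary. This is why the homotopy is confined to commutative rings; it is applied to the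
  associated graded ring.\<close>

lemma koszul_h_mult:
  assumes "set as \<subseteq> carrier R" "\<And>l. z l \<in> carrier R" "x \<in> carrier R"
  shows "koszul_h R as (\<lambda>l. z l \<otimes> x) l = koszul_h R as z l \<otimes> x"
  using assms
proof (induction as arbitrary: z l)
  case (Cons a as)
  show ?case
  proof (cases l)
    case (Cons b k)
    then show ?thesis
      using Cons.IH[of "\<lambda>k. z (b # k)" k] Cons.prems
        koszul_h_closed[of as "\<lambda>k. z (b # k)" k]
      by (cases b) (simp_all add: l_minus l_distr r_distr r_minus m_ac a_minus_def)
  qed (use Cons.prems in simp)
qed (use assms in simp)

lemma koszul_h_minus:
  assumes "set as \<subseteq> carrier R" "\<And>l. z l \<in> carrier R"
  shows "koszul_h R as (\<lambda>l. \<ominus> z l) l = \<ominus> koszul_h R as z l"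
  using koszul_h_mult[of as z "\<ominus> \<one>" l] koszul_h_closed[of as z l] assms
  by (simp add: r_minus)

text \<open>The cross terms in \<open>q\<close> cancel, while \<open>p\<close> and \<open>r\<close>
  stand for the two composites over the shorter list, whose sum is known by induction. Replacing
  chain values by ring variables leaves a polynomial identity.\<close>

lemma koszul_homotopy_False:
  assumes "p \<in> carrier R" "q \<in> carrier R" "r \<in> carrier R" "z \<in> carrier R" "a \<in> carrier R" "g \<in> carrier R"
  shows "p \<oplus> (z \<otimes> a \<ominus> q) \<otimes> g \<oplus> (r \<oplus> q \<otimes> g) = (p \<oplus> r) \<oplus> z \<otimes> a \<otimes> g"
  using assms by algebra

lemma koszul_homotopy_True:
  assumes "p \<in> carrier R" "q \<in> carrier R" "r \<in> carrier R" "z \<in> carrier R" "a \<in> carrier R" "g \<in> carrier R"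
  shows "\<ominus> (q \<otimes> a \<ominus> p) \<oplus> ((q \<oplus> z \<otimes> g) \<otimes> a \<ominus> (\<ominus> r)) = (p \<oplus> r) \<oplus> z \<otimes> a \<otimes> g"
  using assms by algebra

text \<open>Contraction with \<open>gs\<close> and exterior multiplication by \<open>as\<close> have
  the pairing of the two vectors as anticommutator. Hence every element of the ideal generated by
  \<open>gs\<close> acts on the complex as a null-homotopic map.\<close>

lemma koszul_homotopy:
  assumes "set gs \<subseteq> carrier R" "set as \<subseteq> carrier R" "length as = length gs" "length l = length gs"
    and "\<And>l. z l \<in> carrier R"
  shows "koszul_d R gs (koszul_h R as z) l \<oplus> koszul_h R as (koszul_d R gs z) l
    = z l \<otimes> lin_comb R as gs"
  using assms
proof (induction gs arbitrary: as z l)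
  case (Cons g gs)
  obtain a as' where as: "as = a # as'" using Cons.prems(3) by (cases as) auto
  obtain b k where l: "l = b # k" using Cons.prems(4) by (cases l) auto
  let ?d = "koszul_d R gs" and ?h = "koszul_h R as'" and ?c = "lin_comb R as' gs"
  let ?z0 = "\<lambda>k. z (False # k)" and ?z1 = "\<lambda>k. z (True # k)"
  have gs: "set gs \<subseteq> carrier R" "g \<in> carrier R" and as': "set as' \<subseteq> carrier R" "a \<in> carrier R"
    using Cons.prems as by auto
  note cl = koszul_d_closed[OF gs(1)] koszul_h_closed[OF as'(1)]
  note zc = Cons.prems(5)
  have c: "?c \<in> carrier R" using as' gs by (intro lin_comb_closed) auto
  have IH: "?d (?h y) k \<oplus> ?h (?d y) k = y k \<otimes> ?c" if "\<And>l. y l \<in> carrier R" for y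
    using Cons.IH[of as' k y] Cons.prems as l that by simp
  show ?case
  proof (cases b)
    case False
    have "?h (\<lambda>k. ?d ?z0 k \<oplus> ?z1 k \<otimes> g) k = ?h (?d ?z0) k \<oplus> ?h ?z1 k \<otimes> g"
      using gs as' cl zc by (subst koszul_h_add) (auto simp: koszul_h_mult)
    then have "?thesis \<longleftrightarrow> ?d (?h ?z0) k \<oplus> (?z0 k \<otimes> a \<ominus> ?h ?z1 k) \<otimes> g \<oplus> (?h (?d ?z0) k \<oplus> ?h ?z1 k \<otimes> g)
      = ?z0 k \<otimes> (a \<otimes> g \<oplus> ?c)"
      using False as l by simp
    also have "?d (?h ?z0) k \<oplus> (?z0 k \<otimes> a \<ominus> ?h ?z1 k) \<otimes> g \<oplus> (?h (?d ?z0) k \<oplus> ?h ?z1 k \<otimes> g)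
      = (?d (?h ?z0) k \<oplus> ?h (?d ?z0) k) \<oplus> ?z0 k \<otimes> a \<otimes> g"
    proof -
      have "?d (?h ?z0) k \<in> carrier R" "?h (?d ?z0) k \<in> carrier R" "?h ?z1 k \<in> carrier R"
        using cl zc by auto
      then show ?thesis using zc as' gs by (intro koszul_homotopy_False) auto
    qed
    also have "\<dots> = ?z0 k \<otimes> (a \<otimes> g \<oplus> ?c)"
      using IH[of ?z0] zc as' gs c by (simp add: r_distr m_assoc a_ac)
    finally show ?thesis by simp
  next
    case True
    have 1: "?d (\<lambda>k. ?z0 k \<otimes> a \<ominus> ?h ?z1 k) k = ?d ?z0 k \<otimes> a \<ominus> ?d (?h ?z1) k"
    proof -
      have "?d (\<lambda>k. ?z0 k \<otimes> a) k = ?d ?z0 k \<otimes> a"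
        using gs as' zc by (intro koszul_d_mult) (auto intro: m_comm)
      then show ?thesis
        using koszul_d_diff[of gs "\<lambda>k. ?z0 k \<otimes> a" "?h ?z1" k] gs as' cl zc by simp
    qed
    have 2: "?h (\<lambda>k. \<ominus> ?d ?z1 k) k = \<ominus> ?h (?d ?z1) k"
      using gs as' cl zc by (subst koszul_h_minus) auto
    have "?thesis \<longleftrightarrow> \<ominus> (?d ?z0 k \<otimes> a \<ominus> ?d (?h ?z1) k) \<oplus> ((?d ?z0 k \<oplus> ?z1 k \<otimes> g) \<otimes> a \<ominus> (\<ominus> ?h (?d ?z1) k))
      = ?z1 k \<otimes> (a \<otimes> g \<oplus> ?c)"
      using True as l 1 2 by simp
    also have "\<ominus> (?d ?z0 k \<otimes> a \<ominus> ?d (?h ?z1) k) \<oplus> ((?d ?z0 k \<oplus> ?z1 k \<otimes> g) \<otimes> a \<ominus> (\<ominus> ?h (?d ?z1) k))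
      = (?d (?h ?z1) k \<oplus> ?h (?d ?z1) k) \<oplus> ?z1 k \<otimes> a \<otimes> g"
    proof -
      have "?d (?h ?z1) k \<in> carrier R" "?h (?d ?z1) k \<in> carrier R" "?d ?z0 k \<in> carrier R"
        using cl zc by auto
      then show ?thesis using zc as' gs by (intro koszul_homotopy_True) auto
    qed
    also have "\<dots> = ?z1 k \<otimes> (a \<otimes> g \<oplus> ?c)"
      using IH[of ?z1] zc as' gs c by (simp add: r_distr m_assoc a_ac)
    finally show ?thesis by simp
  qed
qed simp

lemma Idl_insert:
  assumes "S \<subseteq> carrier R" "x \<in> carrier R" "a \<in> Idl (insert x S)"
  obtains y where "y \<in> carrier R" "a \<ominus> y \<otimes> x \<in> Idl S"
proof -
  have "ideal (PIdl x <+> Idl S) R"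
    using assms by (intro add_ideals cgenideal_ideal genideal_ideal) auto
  moreover have "insert x S \<subseteq> PIdl x <+> Idl S"
  proof
    have 0: "\<zero> \<in> PIdl x" "\<zero> \<in> Idl S"
      using assms cgenideal_ideal[of x] genideal_ideal[of S]
      by (auto intro: additive_subgroup.zero_closed ideal.axioms(1))
    fix h assume h: "h \<in> insert x S"
    show "h \<in> PIdl x <+> Idl S"
    proof (cases "h = x")
      case True
      then have "h = x \<oplus> \<zero>" using assms by simp
      then show ?thesis
        using True 0 cgenideal_self[of x] assms unfolding set_add_def' by blast
    next
      case False
      then have "h = \<zero> \<oplus> h" "h \<in> S" using assms h by auto
      then show ?thesis
        using 0 genideal_self[of S] assms unfolding set_add_def' by blast
    qed
  qed
  ultimately have "Idl (insert x S) \<subseteq> PIdl x <+> Idl S"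
    by (intro genideal_minimal)
  then obtain y b where y: "y \<in> carrier R" "b \<in> Idl S" "a = y \<otimes> x \<oplus> b"
    using assms(3) unfolding set_add_def' cgenideal_def by auto
  moreover have b: "b \<in> carrier R"
    using y genideal_ideal[OF assms(1)] by (meson additive_subgroup.a_Hcarr ideal.axioms(1))
  have "a \<ominus> y \<otimes> x = b"
    using y b assms by algebra
  ultimately show ?thesis using that by metis
qed

lemma lin_comb_ideal:
  assumes "set gs \<subseteq> carrier R" "x \<in> Idl (set gs)"
  obtains as where "set as \<subseteq> carrier R" "length as = length gs" "x = lin_comb R as gs"
proof -
  have "\<exists>as. set as \<subseteq> carrier R \<and> length as = length gs \<and> x = lin_comb R as gs"
    using assms
  proof (induction gs arbitrary: x)
    case Nil
    have "Idl {} \<subseteq> {\<zero>}" by (intro genideal_minimal zeroideal) simp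
    then show ?case using Nil by auto
  next
    case (Cons g gs)
    obtain a where a: "a \<in> carrier R" "x \<ominus> a \<otimes> g \<in> Idl (set gs)"
      using Idl_insert[of "set gs" g x] Cons.prems by auto
    obtain as where as: "set as \<subseteq> carrier R" "length as = length gs" "x \<ominus> a \<otimes> g = lin_comb R as gs"
      using Cons.IH[OF _ a(2)] Cons.prems by auto
    have x: "x \<in> carrier R"
      using Cons.prems genideal_ideal[of "set (g # gs)"] by (meson additive_subgroup.a_Hcarr ideal.axioms(1))
    have "x = a \<otimes> g \<oplus> (x \<ominus> a \<otimes> g)"
    proof -
      have "g \<in> carrier R" using Cons.prems by simp
      then show ?thesis using x a(1) by algebra
    qed
    then show ?case using a as by (intro exI[of _ "a # as"]) auto
  qed
  then show ?thesis using that by blast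
qed

lemma koszul_d_ideal:
  assumes "ideal I R" "set gs \<subseteq> carrier R" "length l = length gs"
    and "\<And>l. length l = length gs \<Longrightarrow> z l \<in> I"
  shows "koszul_d R gs z l \<in> I"
  using assms
proof (induction gs arbitrary: z l)
  case Nil
  then show ?case by (simp add: additive_subgroup.zero_closed ideal.axioms(1))
next
  case (Cons g gs)
  interpret I: ideal I R by fact
  obtain b k where l: "l = b # k" using Cons.prems(3) by (cases l) auto
  show ?case
    using Cons.IH[of k "\<lambda>k. z (b # k)"] Cons.prems l by (cases b) (auto simp: I.I_r_closed)
qed

lemma koszul_h_ideal:
  assumes "ideal I R" "set as \<subseteq> carrier R" "length l = length as"
    and "\<And>l. length l = length as \<Longrightarrow> z l \<in> I"
  shows "koszul_h R as z l \<in> I"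
  using assms
proof (induction as arbitrary: z l)
  case Nil
  then show ?case by (simp add: additive_subgroup.zero_closed ideal.axioms(1))
next
  case (Cons g gs)
  interpret I: ideal I R by fact
  obtain b k where l: "l = b # k" using Cons.prems(3) by (cases l) auto
  show ?case
    using Cons.IH[of k "\<lambda>k. z (b # k)"] Cons.prems l by (cases b) (auto simp: I.I_r_closed a_minus_def)
qed

text \<open>Here the factors \<open>g\<close>, not the coefficients, lie in the ideal. This gives
  the contradiction in filtration degree 0, where the differential of a chain takes the value
  1.\<close>

lemma koszul_d_gen_ideal:
  assumes "ideal I R" "set gs \<subseteq> I" "\<And>l. z l \<in> carrier R"
  shows "koszul_d R gs z l \<in> I"
  using assms
proof (induction gs arbitrary: z l)
  case Nil
  then show ?case by (simp add: additive_subgroup.zero_closed ideal.axioms(1))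
next
  case (Cons g gs)
  interpret I: ideal I R by fact
  show ?case
  proof (cases l)
    case (Cons b k)
    then show ?thesis
      using Cons.IH[of "\<lambda>k. z (b # k)" k] Cons.prems by (cases b) (auto simp: I.I_l_closed)
  qed simp
qed

text \<open>
  Depth sensitivity, by descending induction on \<open>i\<close>: if \<open>z\<close> is a cycle modulo the ideal \<open>J\<close> of the first
  \<open>i\<close> elements and \<open>x\<close> is the next one, the homotopy turns \<open>z\<close> into a cycle \<open>h z\<close> modulo \<open>J + (x)\<close>
  of higher degree, so \<open>h z = d w + y x\<close>; applying \<open>d\<close> gives \<open>x (z - d y) \<in> J\<close>.
\<close>

lemma koszul_acyclic_mod:
  fixes gs xs :: "'a list"
  defines "t \<equiv> length gs"
  assumes gs: "set gs \<subseteq> carrier R" and xs: "set xs \<subseteq> Idl (set gs)" "length xs = t" "regular_sequence R xs"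
    and i: "i \<le> t"
    and z: "\<And>l. z l \<in> carrier R"
    and supp: "\<And>l. length l = t \<Longrightarrow> count_list l True \<le> i \<Longrightarrow> z l = \<zero>"
    and cycle: "\<And>l. length l = t \<Longrightarrow> koszul_d R gs z l \<in> Idl (set (take i xs))"
  shows "\<exists>w. (\<forall>l. w l \<in> carrier R) \<and> (\<forall>l. length l = t \<longrightarrow> count_list l True \<le> Suc i \<longrightarrow> w l = \<zero>) \<and>
    (\<forall>l. length l = t \<longrightarrow> z l \<ominus> koszul_d R gs w l \<in> Idl (set (take i xs)))"
  using i z supp cycle
proof (induction i arbitrary: z rule: inc_induct)
  case base
  have xc: "set xs \<subseteq> carrier R" using xs by (auto simp: regular_sequence_def)
  interpret J: ideal "Idl (set xs)" R using xc by (rule genideal_ideal)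
  \<comment> \<open>For \<open>i = t\<close> the support condition covers every exterior degree, so
    \<open>z\<close> vanishes and the zero chain bounds it.\<close>
  have "count_list l True \<le> t" if "length l = t" for l
    using that count_le_length[of l True] by simp
  then have "z l \<ominus> koszul_d R gs (\<lambda>_. \<zero>) l \<in> Idl (set xs)" if "length l = t" for l
    using that base koszul_d_zero[of gs "\<lambda>_. \<zero>" l] gs by (simp add: t_def a_minus_def)
  then show ?case using xs by (intro exI[of _ "\<lambda>_. \<zero>"]) auto
next
  case (step i)
  define x where "x = xs ! i"
  have xc: "set xs \<subseteq> carrier R" using xs by (auto simp: regular_sequence_def)
  have x: "x \<in> carrier R" "x \<in> Idl (set gs)"
    using xs xc step.hyps by (auto simp: x_def)
  let ?J = "Idl (set (take i xs))" and ?J' = "Idl (set (take (Suc i) xs))"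
  have tk: "set (take i xs) \<subseteq> carrier R" using xc set_take_subset by fastforce
  have tk': "set (take (Suc i) xs) = insert x (set (take i xs))"
    using step.hyps xs by (simp add: take_Suc_conv_app_nth x_def)
  have reg: "y \<in> ?J" if "y \<in> carrier R" "x \<otimes> y \<in> ?J" for y
    using that xs(2,3) step.hyps unfolding regular_sequence_def x_def by simp
  interpret J: ideal ?J R using tk by (rule genideal_ideal)
  interpret J': ideal ?J' R using tk x unfolding tk' by (intro genideal_ideal) auto
  have "?J \<subseteq> ?J'"
    using tk x by (intro subset_Idl_subset) (auto simp: tk')
  have "x \<in> ?J'" using genideal_self[of "set (take (Suc i) xs)"] tk x by (auto simp: tk')
  obtain as where as: "set as \<subseteq> carrier R" "length as = length gs" "x = lin_comb R as gs"
    using lin_comb_ideal[OF gs x(2)] by blast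
  note zc = step.prems(1)
  let ?d = "koszul_d R gs" and ?h = "koszul_h R as"
  have cl: "\<And>z l. (\<And>l. z l \<in> carrier R) \<Longrightarrow> ?d z l \<in> carrier R" "\<And>z l. (\<And>l. z l \<in> carrier R) \<Longrightarrow> ?h z l \<in> carrier R"
    using koszul_d_closed[OF gs] koszul_h_closed[OF as(1)] by auto
  have hdz: "?h (?d z) l \<in> ?J" if "length l = t" for l
    using that as step.prems(3) by (intro koszul_h_ideal) (auto simp: t_def J.is_ideal)
  have dhz: "?d (?h z) l = z l \<otimes> x \<ominus> ?h (?d z) l" if "length l = t" for l
  proof -
    have "?d (?h z) l \<oplus> ?h (?d z) l = z l \<otimes> x"
      using koszul_homotopy[OF gs as(1,2), of l z] that zc as(3) by (simp add: t_def)
    moreover have "?d (?h z) l \<in> carrier R" "?h (?d z) l \<in> carrier R" using cl zc by auto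
    ultimately show ?thesis by (metis a_minus_def a_assoc r_neg r_zero a_inv_closed)
  qed
  have "\<exists>w. (\<forall>l. w l \<in> carrier R) \<and> (\<forall>l. length l = t \<longrightarrow> count_list l True \<le> Suc (Suc i) \<longrightarrow> w l = \<zero>) \<and>
    (\<forall>l. length l = t \<longrightarrow> ?h z l \<ominus> ?d w l \<in> ?J')"
  proof (rule step.IH)
    show "?h z l \<in> carrier R" for l using cl zc by auto
    show "?h z l = \<zero>" if "length l = t" "count_list l True \<le> Suc i" for l
      using koszul_h_supp[OF as(1), of l i z] that as step.prems(2) by (simp add: t_def)
    show "?d (?h z) l \<in> ?J'" if "length l = t" for l
      using dhz[OF that] hdz[OF that] \<open>?J \<subseteq> ?J'\<close> \<open>x \<in> ?J'\<close> zc
      by (auto simp: a_minus_def J'.I_l_closed)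
  qed
  then obtain w where w: "\<And>l. w l \<in> carrier R"
      "\<And>l. length l = t \<Longrightarrow> count_list l True \<le> Suc (Suc i) \<Longrightarrow> w l = \<zero>"
      "\<And>l. length l = t \<Longrightarrow> ?h z l \<ominus> ?d w l \<in> ?J'"
    by blast
  \<comment> \<open>The choice of \<open>y\<close> is forced to be zero in low exterior degree,
    since \<open>y\<close> becomes the bounding chain and must satisfy the support condition; this
    is possible because \<open>?h z\<close> and \<open>?d w\<close> both vanish there.\<close>
  have "\<exists>y. y \<in> carrier R \<and> (length l = t \<longrightarrow> ?h z l \<ominus> ?d w l \<ominus> y \<otimes> x \<in> ?J) \<and>
      (length l = t \<longrightarrow> count_list l True \<le> Suc i \<longrightarrow> y = \<zero>)" for l
  proof (cases "length l = t \<and> \<not> count_list l True \<le> Suc i")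
    case True
    then show ?thesis
      using Idl_insert[OF tk x(1), of "?h z l \<ominus> ?d w l"] w(3)[of l] by (metis tk')
  next
    case False
    have "?h z l \<ominus> ?d w l \<ominus> \<zero> \<otimes> x \<in> ?J" if "length l = t"
      using that False koszul_h_supp[OF as(1), of l i z] koszul_d_supp[OF gs, of l "Suc i" w] step.prems(2) w(2) x as
      by (simp add: t_def a_minus_def)
    then show ?thesis by (intro exI[of _ "\<zero>"]) simp
  qed
  then obtain y where y: "\<And>l. y l \<in> carrier R"
      "\<And>l. length l = t \<Longrightarrow> ?h z l \<ominus> ?d w l \<ominus> y l \<otimes> x \<in> ?J"
      "\<And>l. length l = t \<Longrightarrow> count_list l True \<le> Suc i \<Longrightarrow> y l = \<zero>"
    by metis
  have "z l \<ominus> ?d y l \<in> ?J" if l: "length l = t" for l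
  proof -
    have "?d (\<lambda>l. ?h z l \<ominus> ?d w l \<ominus> y l \<otimes> x) l \<in> ?J"
      using y(2) l gs by (intro koszul_d_ideal) (auto simp: t_def J.is_ideal)
    also have "?d (\<lambda>l. ?h z l \<ominus> ?d w l \<ominus> y l \<otimes> x) l = ?d (?h z) l \<ominus> ?d (?d w) l \<ominus> ?d y l \<otimes> x"
    proof -
      have "?d (\<lambda>l. y l \<otimes> x) l = ?d y l \<otimes> x"
        using gs y x by (intro koszul_d_mult) (auto intro: m_comm)
      then show ?thesis
        using cl zc w y x gs koszul_d_diff[of gs "\<lambda>l. ?h z l \<ominus> ?d w l" "\<lambda>l. y l \<otimes> x" l]
          koszul_d_diff[of gs "?h z" "?d w" l] by simp
    qed
    also have "?d (?d w) l = \<zero>"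
      using gs w by (intro koszul_d_squared) (auto intro: m_comm)
    finally have "?d (?h z) l \<ominus> \<zero> \<ominus> ?d y l \<otimes> x \<in> ?J" .
    then have "(?d (?h z) l \<ominus> \<zero> \<ominus> ?d y l \<otimes> x) \<oplus> ?h (?d z) l \<in> ?J"
      using hdz[OF l] by auto
    also have "(?d (?h z) l \<ominus> \<zero> \<ominus> ?d y l \<otimes> x) \<oplus> ?h (?d z) l = x \<otimes> (z l \<ominus> ?d y l)"
    proof -
      have *: "(p \<otimes> x \<ominus> q \<ominus> \<zero> \<ominus> r \<otimes> x) \<oplus> q = x \<otimes> (p \<ominus> r)"
        if "p \<in> carrier R" "q \<in> carrier R" "r \<in> carrier R" for p q r
        using that x by algebra
      show ?thesis
        unfolding dhz[OF l] by (intro * zc cl y(1))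
    qed
    finally have "x \<otimes> (z l \<ominus> ?d y l) \<in> ?J" .
    moreover have "z l \<ominus> ?d y l \<in> carrier R" using cl(1)[OF y(1)] zc by simp
    ultimately show ?thesis using reg by blast
  qed
  then show ?case using y by blast
qed

text \<open>The case \<open>i = 0\<close> of \<open>koszul_acyclic_mod\<close>: the ideal of the
  empty sequence is zero, and the congruences become equations.\<close>

lemma koszul_acyclic:
  fixes gs xs :: "'a list"
  defines "t \<equiv> length gs"
  assumes gs: "set gs \<subseteq> carrier R" and xs: "set xs \<subseteq> Idl (set gs)" "length xs = t" "regular_sequence R xs"
    and z: "\<And>l. z l \<in> carrier R"
    and supp: "\<And>l. length l = t \<Longrightarrow> count_list l True = 0 \<Longrightarrow> z l = \<zero>"
    and cycle: "\<And>l. length l = t \<Longrightarrow> koszul_d R gs z l = \<zero>"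
  obtains w where "\<And>l. w l \<in> carrier R"
    "\<And>l. length l = t \<Longrightarrow> count_list l True \<le> 1 \<Longrightarrow> w l = \<zero>"
    "\<And>l. length l = t \<Longrightarrow> z l = koszul_d R gs w l"
proof -
  have "Idl {} \<subseteq> {\<zero>}" by (intro genideal_minimal zeroideal) simp
  moreover have "\<zero> \<in> Idl {}"
    using genideal_ideal[of "{}"] by (simp add: additive_subgroup.zero_closed ideal.axioms(1))
  ultimately have 0: "Idl {} = {\<zero>}" by auto
  obtain w where w: "\<And>l. w l \<in> carrier R"
    "\<And>l. length l = t \<Longrightarrow> count_list l True \<le> 1 \<Longrightarrow> w l = \<zero>"
    "\<And>l. length l = t \<Longrightarrow> z l \<ominus> koszul_d R gs w l = \<zero>"
    using koszul_acyclic_mod[OF gs xs[unfolded t_def], of 0 z] z supp cycle 0 by (auto simp: t_def)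
  moreover have "z l = koszul_d R gs w l" if "length l = t" for l
    using w(1,3) that z koszul_d_closed[OF gs] by simp
  ultimately show ?thesis using that by blast
qed

end

text \<open>The vector \<open>us\<close> as a chain of exterior degree 1: an index with exactly one
  \<open>True\<close> picks the entry of \<open>us\<close> at that position.\<close>

fun unit_chain :: "('a, 'b) ring_scheme \<Rightarrow> 'a list \<Rightarrow> bool list \<Rightarrow> 'a" where
  "unit_chain R (u # us) (True # l) = (if True \<in> set l then \<zero>\<^bsub>R\<^esub> else u)"
| "unit_chain R (u # us) (False # l) = unit_chain R us l"
| "unit_chain R _ _ = \<zero>\<^bsub>R\<^esub>"

lemma (in ring) unit_chain:
  assumes "set us \<subseteq> carrier R"
  shows "unit_chain R us l \<in> carrier R" "True \<notin> set l \<Longrightarrow> unit_chain R us l = \<zero>"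
  using assms
proof (induction us arbitrary: l)
  case (Cons u us)
  {
    case 1
    then show ?case using Cons.IH(1) by (cases l; cases "hd l") auto
  next
    case 2
    then show ?case using Cons.IH(2) by (cases l; cases "hd l") auto
  }
qed auto

text \<open>This chain is what \<open>unit_chain\<close> becomes on indices starting with
  \<open>True\<close>; it has exterior degree 0, hence is a cycle.\<close>

lemma (in ring) koszul_d_const:
  assumes "set gs \<subseteq> carrier R" "length l = length gs" "a \<in> carrier R"
  shows "koszul_d R gs (\<lambda>l. if True \<in> set l then \<zero> else a) l = \<zero>"
  using assms
proof (induction gs arbitrary: l)
  case (Cons g gs)
  then obtain b k where "l = b # k" by (cases l) auto
  then show ?case
    using Cons koszul_d_zero[of gs "\<lambda>k. \<zero>" k] by (cases b) auto
qed auto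

text \<open>The first Koszul differential evaluates a vector on the generators. In this form a
  representation of 1 is an equation between chains, stable under subtraction of boundaries.\<close>

lemma (in ring) koszul_d_unit_chain:
  assumes "set gs \<subseteq> carrier R" "set us \<subseteq> carrier R" "length us = length gs" "length l = length gs"
  shows "koszul_d R gs (unit_chain R us) l = (if True \<in> set l then \<zero> else lin_comb R us gs)"
  using assms
proof (induction gs arbitrary: l us)
  case (Cons g gs)
  then obtain b k u us' where l: "l = b # k" "us = u # us'" by (cases l; cases us) auto
  then show ?case
    using Cons koszul_d_const[of gs k u] lin_comb_closed[of us' gs]
    by (cases b) (auto simp: a_comm)
qed simp

section \<open>Zariski's lemma\<close>

text \<open>Algebraic closedness speaks of polynomials as coefficient lists, leading coefficient
  first, while the extension argument evaluates elements of \<open>UP\<close>. Finite sums of powers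
  are the common ground.\<close>

lemma (in algebraically_closed) exists_root_finsum:
  fixes n :: nat
  assumes "\<And>i. f i \<in> carrier L" "f n \<noteq> \<zero>" "n > 0"
  obtains x where "x \<in> carrier L" "(\<Oplus>i\<in>{..n}. f i \<otimes> x [^] i) = \<zero>"
proof -
  define P where "P = map f (rev [0..<Suc n])"
  have P: "P \<in> carrier (poly_ring L)"
    using assms by (auto simp: P_def univ_poly_def polynomial_def)
  have deg: "degree P = n" by (simp add: P_def)
  have "size (roots P) = n"
    using roots_over_carrier[OF P] deg by (simp add: splitted_def)
  then obtain x where "x \<in># roots P"
    using \<open>n > 0\<close> by (metis multiset_nonemptyE size_empty less_irrefl)
  then have x: "x \<in> carrier L" "eval P x = \<zero>"
    using roots_mem_iff_is_root[OF P] by (auto simp: is_root_def)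
  have "eval (map f (rev [0..<m])) x = (\<Oplus>i\<in>{..<m}. f i \<otimes> x [^] i)" for m
    by (induction m) (use assms x in \<open>simp_all add: lessThan_Suc\<close>)
  then show ?thesis
    using x that unfolding P_def lessThan_Suc_atMost[symmetric] by metis
qed

text \<open>As the leading coefficient survives under \<open>h\<close>, the image polynomial still
  has positive degree.\<close>

lemma (in UP_pre_univ_prop) exists_root_eval:
  assumes "algebraically_closed S" "p \<in> carrier P" "deg R p > 0" "h (lcoeff p) \<noteq> \<zero>\<^bsub>S\<^esub>"
  obtains x where "x \<in> carrier S" "UnivPoly.eval R S h x p = \<zero>\<^bsub>S\<^esub>"
proof -
  obtain x where "x \<in> carrier S" "(\<Oplus>\<^bsub>S\<^esub>i\<in>{..deg R p}. h (up_ring.coeff P p i) \<otimes>\<^bsub>S\<^esub> x [^]\<^bsub>S\<^esub> i) = \<zero>\<^bsub>S\<^esub>"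
    by (rule algebraically_closed.exists_root_finsum[OF assms(1), of "\<lambda>i. h (up_ring.coeff P p i)" "deg R p"])
      (use assms in auto)
  then show ?thesis using that eval_on_carrier[OF assms(2), of S h x] by simp
qed

text \<open>A root of \<open>X p + 1\<close> is not a root of \<open>p\<close>, so no cardinality argument is needed.\<close>

lemma (in UP_pre_univ_prop) exists_nonroot_eval:
  assumes "algebraically_closed S" "p \<in> carrier P" "h (lcoeff p) \<noteq> \<zero>\<^bsub>S\<^esub>"
  obtains x where "x \<in> carrier S" "UnivPoly.eval R S h x p \<noteq> \<zero>\<^bsub>S\<^esub>"
proof -
  define q where "q = up_ring.monom P \<one> 1 \<otimes>\<^bsub>P\<^esub> p \<oplus>\<^bsub>P\<^esub> \<one>\<^bsub>P\<^esub>"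
  have q: "q \<in> carrier P" using assms by (simp add: q_def)
  have lp: "lcoeff p \<noteq> \<zero>" using assms(3) by auto
  have co: "up_ring.coeff P q (Suc k) = up_ring.coeff P p k" for k
    using assms(2) coeff_monom_mult[of \<one> p 1 k] by (simp add: q_def)
  have "deg R q = Suc (deg R p)"
  proof (rule antisym)
    show "deg R q \<le> Suc (deg R p)"
    proof (rule deg_aboveI)
      fix m assume "Suc (deg R p) < m"
      then show "up_ring.coeff P q m = \<zero>" using assms(2) co by (cases m) (auto intro: deg_aboveD)
    qed fact
    show "Suc (deg R p) \<le> deg R q"
      using lp co[of "deg R p"] q by (intro deg_belowI) auto
  qed
  then obtain x where x: "x \<in> carrier S" "UnivPoly.eval R S h x q = \<zero>\<^bsub>S\<^esub>"
    using exists_root_eval[OF assms(1) q] assms(3) co by auto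
  interpret E: ring_hom_cring P S "UnivPoly.eval R S h x"
    using x eval_ring_hom by (intro ring_hom_cringI UP_cring S.is_cring) auto
  have "UnivPoly.eval R S h x q = x \<otimes>\<^bsub>S\<^esub> UnivPoly.eval R S h x p \<oplus>\<^bsub>S\<^esub> \<one>\<^bsub>S\<^esub>"
    using assms(2) x eval_monom1[OF x(1)] by (simp add: q_def)
  moreover have "\<one>\<^bsub>S\<^esub> \<noteq> \<zero>\<^bsub>S\<^esub>"
    using assms(1) by (simp add: algebraically_closed_def field_def domain.one_not_zero)
  ultimately have "UnivPoly.eval R S h x p \<noteq> \<zero>\<^bsub>S\<^esub>"
    using x by (metis S.l_zero S.one_closed S.r_null)
  then show ?thesis using that x by blast
qed

text \<open>The homomorphism theorem for the image of \<open>f\<close>: \<open>\<psi>\<close> is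
  defined through chosen preimages, and the kernel condition makes the choice immaterial.\<close>

lemma ring_hom_lift_along_surj:
  assumes "ring P" "ring S" and f: "f \<in> ring_hom P S" and h: "h \<in> ring_hom P T" and "ring T"
    and ker: "\<And>p. p \<in> carrier P \<Longrightarrow> f p = \<zero>\<^bsub>S\<^esub> \<Longrightarrow> h p = \<zero>\<^bsub>T\<^esub>"
  obtains \<psi> where "\<psi> \<in> ring_hom (S\<lparr>carrier := f ` carrier P\<rparr>) T" "\<And>p. p \<in> carrier P \<Longrightarrow> \<psi> (f p) = h p"
proof -
  interpret P: ring P by fact
  interpret f: ring_hom_ring P S f
    using assms by (intro ring_hom_ringI2)
  interpret h: ring_hom_ring P T h
    using assms by (intro ring_hom_ringI2)
  have eq: "h p = h q" if "p \<in> carrier P" "q \<in> carrier P" "f p = f q" for p q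
  proof -
    have "f (p \<ominus>\<^bsub>P\<^esub> q) = \<zero>\<^bsub>S\<^esub>" using that by (simp add: a_minus_def f.S.r_neg)
    then have "h (p \<ominus>\<^bsub>P\<^esub> q) = \<zero>\<^bsub>T\<^esub>" using that ker by auto
    then show ?thesis using that by (simp add: a_minus_def h.S.minus_equality h.S.minus_minus)
      (metis h.S.add.inv_equality h.S.minus_minus h.S.a_inv_closed h.hom_closed)
  qed
  define \<psi> where "\<psi> y = h (SOME p. p \<in> carrier P \<and> f p = y)" for y
  have \<psi>: "\<psi> (f p) = h p" if "p \<in> carrier P" for p
  proof -
    have "(SOME q. q \<in> carrier P \<and> f q = f p) \<in> carrier P \<and> f (SOME q. q \<in> carrier P \<and> f q = f p) = f p"
      using that by (intro someI[of "\<lambda>q. q \<in> carrier P \<and> f q = f p"]) auto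
    then show ?thesis unfolding \<psi>_def using eq that by blast
  qed
  have "\<psi> \<in> ring_hom (S\<lparr>carrier := f ` carrier P\<rparr>) T"
  proof (rule ring_hom_memI)
    fix x assume "x \<in> carrier (S\<lparr>carrier := f ` carrier P\<rparr>)"
    then obtain p where "p \<in> carrier P" "x = f p" by auto
    then show "\<psi> x \<in> carrier T" using \<psi> by simp
  next
    fix x y assume "x \<in> carrier (S\<lparr>carrier := f ` carrier P\<rparr>)" "y \<in> carrier (S\<lparr>carrier := f ` carrier P\<rparr>)"
    then obtain p q where p: "p \<in> carrier P" "x = f p" "q \<in> carrier P" "y = f q" by auto
    show "\<psi> (x \<otimes>\<^bsub>S\<lparr>carrier := f ` carrier P\<rparr>\<^esub> y) = \<psi> x \<otimes>\<^bsub>T\<^esub> \<psi> y"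
      using p \<psi>[of "p \<otimes>\<^bsub>P\<^esub> q"] \<psi> by simp
    show "\<psi> (x \<oplus>\<^bsub>S\<lparr>carrier := f ` carrier P\<rparr>\<^esub> y) = \<psi> x \<oplus>\<^bsub>T\<^esub> \<psi> y"
      using p \<psi>[of "p \<oplus>\<^bsub>P\<^esub> q"] \<psi> by simp
  next
    show "\<psi> \<one>\<^bsub>S\<lparr>carrier := f ` carrier P\<rparr>\<^esub> = \<one>\<^bsub>T\<^esub>"
      using \<psi>[of "\<one>\<^bsub>P\<^esub>"] by simp
  qed
  then show ?thesis using that \<psi> by blast
qed

section \<open>Adjoining elements to a subring of a domain, and extending homomorphisms\<close>

definition adjoin :: "('a, 'b) ring_scheme \<Rightarrow> 'a set \<Rightarrow> 'a \<Rightarrow> 'a set"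
  where "adjoin L A x = UnivPoly.eval (L\<lparr>carrier := A\<rparr>) L id x ` carrier (UP (L\<lparr>carrier := A\<rparr>))"

lemma (in domain) nat_pow_nonzero:
  assumes "a \<in> carrier R" "a \<noteq> \<zero>"
  shows "a [^] (n::nat) \<noteq> \<zero>"
  by (induction n) (use assms integral in auto)

lemma (in domain) UP_subring:
  assumes "subring A R"
  shows "UP_domain (R\<lparr>carrier := A\<rparr>)" "UP_pre_univ_prop (R\<lparr>carrier := A\<rparr>) R id"
proof -
  have d: "domain (R\<lparr>carrier := A\<rparr>)" using subring_is_domain[OF assms] .
  then show "UP_domain (R\<lparr>carrier := A\<rparr>)" by (simp add: UP_domain_def)
  have "id \<in> ring_hom (R\<lparr>carrier := A\<rparr>) R"
    using subringE(1)[OF assms] by (intro ring_hom_memI) auto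
  then show "UP_pre_univ_prop (R\<lparr>carrier := A\<rparr>) R id"
    using d is_cring by (intro UP_pre_univ_propI) (auto simp: domain_def)
qed

text \<open>As \<open>adjoin\<close> is the image of an evaluation map, each element comes with a
  representing polynomial, and homomorphisms out of it can be obtained from polynomials by factoring
  through that map.\<close>

lemma (in domain) adjoin:
  assumes "subring A R" "x \<in> carrier R"
  shows "subring (adjoin R A x) R" "A \<subseteq> adjoin R A x" "x \<in> adjoin R A x"
proof -
  interpret Q: UP_pre_univ_prop "R\<lparr>carrier := A\<rparr>" R id "UP (R\<lparr>carrier := A\<rparr>)"
    using UP_subring[OF assms(1)] by simp
  interpret E: ring_hom_cring "UP (R\<lparr>carrier := A\<rparr>)" R "UnivPoly.eval (R\<lparr>carrier := A\<rparr>) R id x"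
    using assms Q.eval_ring_hom by (intro ring_hom_cringI Q.UP_cring is_cring) auto
  show "subring (adjoin R A x) R"
    unfolding adjoin_def using ring_hom_ring.img_is_subring[OF ring_hom_ringI2[OF Q.UP_ring local.ring_axioms Q.eval_ring_hom[OF assms(2)]] Q.P.carrier_is_subring] .
  show "A \<subseteq> adjoin R A x"
  proof
    fix a assume "a \<in> A"
    then have "a = UnivPoly.eval (R\<lparr>carrier := A\<rparr>) R id x (up_ring.monom (UP (R\<lparr>carrier := A\<rparr>)) a 0)"
      using Q.eval_const[OF assms(2), of a] by simp
    moreover have "up_ring.monom (UP (R\<lparr>carrier := A\<rparr>)) a 0 \<in> carrier (UP (R\<lparr>carrier := A\<rparr>))"
      using \<open>a \<in> A\<close> by (intro Q.monom_closed) simp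
    ultimately show "a \<in> adjoin R A x" unfolding adjoin_def by blast
  qed
  have "up_ring.monom (UP (R\<lparr>carrier := A\<rparr>)) \<one> 1 \<in> carrier (UP (R\<lparr>carrier := A\<rparr>))"
    using subringE(3)[OF assms(1)] by (intro Q.monom_closed) simp
  then show "x \<in> adjoin R A x"
    using Q.eval_monom1[OF assms(2)] unfolding adjoin_def by force
qed

text \<open>
  If \<open>x\<close> is transcendental over \<open>A\<close>, send it to a non-root of the image of a polynomial representing \<open>b\<close>.
  Otherwise send it to a root of the image of a polynomial \<open>f\<close> of minimal degree that annihilates \<open>x\<close>;
  by pseudo-division this is well defined once the leading coefficient of \<open>f\<close> is not killed, and
  some nonzero \<open>c \<in> A\<close> is a multiple of \<open>b\<close>.
\<close>

lemma (in domain) hom_extends_adjoin: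
  assumes K: "algebraically_closed K" and A: "subring A R" and x: "x \<in> carrier R"
    and b: "b \<in> adjoin R A x" "b \<noteq> \<zero>"
  obtains a where "a \<in> A" "a \<noteq> \<zero>"
    "\<And>\<phi>. \<phi> \<in> ring_hom (R\<lparr>carrier := A\<rparr>) K \<Longrightarrow> \<phi> a \<noteq> \<zero>\<^bsub>K\<^esub> \<Longrightarrow>
      \<exists>\<psi> \<in> ring_hom (R\<lparr>carrier := adjoin R A x\<rparr>) K. (\<forall>y\<in>A. \<psi> y = \<phi> y) \<and> \<psi> b \<noteq> \<zero>\<^bsub>K\<^esub>"
proof -
  define S where "S = R\<lparr>carrier := A\<rparr>"
  define P where "P = UP S"
  define \<Theta> where "\<Theta> = UnivPoly.eval S R id x"
  interpret K: algebraically_closed K by fact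
  interpret D: UP_domain S P
    using UP_subring(1)[OF A] by (simp_all add: S_def P_def)
  interpret Q: UP_pre_univ_prop S R id P
    using UP_subring(2)[OF A] by (simp_all add: S_def P_def)
  interpret E: ring_hom_cring P R \<Theta>
    using x Q.eval_ring_hom unfolding \<Theta>_def by (intro ring_hom_cringI D.UP_cring is_cring) auto
  have S: "carrier S = A" "\<zero>\<^bsub>S\<^esub> = \<zero>" "\<one>\<^bsub>S\<^esub> = \<one>" "\<And>a b. a \<otimes>\<^bsub>S\<^esub> b = a \<otimes> b" by (simp_all add: S_def)
  have AR: "A \<subseteq> carrier R" by (rule subringE(1)[OF A])
  obtain q where q: "q \<in> carrier P" "b = \<Theta> q"
    using b(1) unfolding adjoin_def \<Theta>_def P_def S_def by blast
  have q0: "q \<noteq> \<zero>\<^bsub>P\<^esub>" using q b(2) by auto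
  have const: "\<Theta> (up_ring.monom P a 0) = a" if "a \<in> A" for a
    using Q.eval_const[OF x, of a] that by (simp add: \<Theta>_def S)
  \<comment> \<open>The homomorphisms sought are evaluations at some \<open>\<xi>\<close>; the only
    condition is that polynomials annihilating \<open>x\<close> also vanish at
    \<open>\<xi>\<close>.\<close>
  have extend: "\<exists>\<psi> \<in> ring_hom (R\<lparr>carrier := adjoin R A x\<rparr>) K. (\<forall>y\<in>A. \<psi> y = \<phi> y) \<and> (\<forall>p\<in>carrier P. \<psi> (\<Theta> p) = UnivPoly.eval S K \<phi> \<xi> p)"
    if phi: "\<phi> \<in> ring_hom S K" and xi: "\<xi> \<in> carrier K"
      and ker: "\<And>p. p \<in> carrier P \<Longrightarrow> \<Theta> p = \<zero> \<Longrightarrow> UnivPoly.eval S K \<phi> \<xi> p = \<zero>\<^bsub>K\<^esub>" for \<phi> \<xi>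
  proof -
    interpret Q': UP_pre_univ_prop S K \<phi> P
      using phi by (intro UP_pre_univ_propI D.R.is_cring K.is_cring) (auto simp: P_def)
    obtain \<psi> where \<psi>: "\<psi> \<in> ring_hom (R\<lparr>carrier := \<Theta> ` carrier P\<rparr>) K" "\<And>p. p \<in> carrier P \<Longrightarrow> \<psi> (\<Theta> p) = UnivPoly.eval S K \<phi> \<xi> p"
      by (rule ring_hom_lift_along_surj[OF D.UP_ring local.ring_axioms E.homh Q'.eval_ring_hom[OF xi] K.ring_axioms ker];
          (assumption | (erule that; blast)))
    moreover have "\<psi> y = \<phi> y" if "y \<in> A" for y
      using \<psi>(2)[of "up_ring.monom P y 0"] const that Q'.eval_const[OF xi, of y] by (simp add: S)
    ultimately show ?thesis unfolding adjoin_def \<Theta>_def P_def S_def by blast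
  qed
  show ?thesis
  proof (cases "\<exists>p \<in> carrier P. p \<noteq> \<zero>\<^bsub>P\<^esub> \<and> \<Theta> p = \<zero>")
    case False
    define a where "a = D.lcoeff q"
    have "a \<noteq> \<zero>" "a \<in> A" using D.lcoeff_nonzero[OF q0 q(1)] D.lcoeff_closed[OF q(1)] by (simp_all add: a_def S)
    moreover have "\<exists>\<psi> \<in> ring_hom (R\<lparr>carrier := adjoin R A x\<rparr>) K. (\<forall>y\<in>A. \<psi> y = \<phi> y) \<and> \<psi> b \<noteq> \<zero>\<^bsub>K\<^esub>"
      if \<phi>: "\<phi> \<in> ring_hom (R\<lparr>carrier := A\<rparr>) K" "\<phi> a \<noteq> \<zero>\<^bsub>K\<^esub>" for \<phi>
    proof -
      interpret Q': UP_pre_univ_prop S K \<phi> P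
        using that by (intro UP_pre_univ_propI D.R.is_cring K.is_cring) (auto simp: P_def S_def)
      obtain \<xi> where \<xi>: "\<xi> \<in> carrier K" "UnivPoly.eval S K \<phi> \<xi> q \<noteq> \<zero>\<^bsub>K\<^esub>"
        using Q'.exists_nonroot_eval[OF K q(1)] \<phi>(2) unfolding a_def by blast
      interpret E': ring_hom_cring P K "UnivPoly.eval S K \<phi> \<xi>"
        using \<xi> Q'.eval_ring_hom by (intro ring_hom_cringI D.UP_cring K.is_cring) auto
      have "UnivPoly.eval S K \<phi> \<xi> p = \<zero>\<^bsub>K\<^esub>" if "p \<in> carrier P" "\<Theta> p = \<zero>" for p
        using that False by (cases "p = \<zero>\<^bsub>P\<^esub>") auto
      from extend[OF \<phi>(1)[folded S_def] \<xi>(1) this] obtain \<psi> where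
        "\<psi> \<in> ring_hom (R\<lparr>carrier := adjoin R A x\<rparr>) K" "\<forall>y\<in>A. \<psi> y = \<phi> y" "\<forall>p\<in>carrier P. \<psi> (\<Theta> p) = UnivPoly.eval S K \<phi> \<xi> p"
        by blast
      then show ?thesis using \<xi>(2) q by (intro bexI[of _ \<psi>]) auto
    qed
    ultimately show ?thesis using that by blast
  next
    case True
    define f where "f = arg_min (deg S) (\<lambda>p. p \<in> carrier P \<and> p \<noteq> \<zero>\<^bsub>P\<^esub> \<and> \<Theta> p = \<zero>)"
    have f: "f \<in> carrier P" "f \<noteq> \<zero>\<^bsub>P\<^esub>" "\<Theta> f = \<zero>"
      using arg_min_natI[of "\<lambda>p. p \<in> carrier P \<and> p \<noteq> \<zero>\<^bsub>P\<^esub> \<and> \<Theta> p = \<zero>" _ "deg S"] True unfolding f_def by blast+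
    have fmin: "p = \<zero>\<^bsub>P\<^esub>" if "p \<in> carrier P" "\<Theta> p = \<zero>" "deg S p < deg S f" for p
      using arg_min_nat_le[of "\<lambda>p. p \<in> carrier P \<and> p \<noteq> \<zero>\<^bsub>P\<^esub> \<and> \<Theta> p = \<zero>" p "deg S"] that unfolding f_def by fastforce
    have fdeg: "deg S f > 0"
    proof (rule ccontr)
      assume "\<not> deg S f > 0"
      then have "f = up_ring.monom P (D.lcoeff f) 0" using D.deg_zero_impl_monom[OF f(1)] by simp
      then have "\<Theta> f = D.lcoeff f" using const D.lcoeff_closed[OF f(1)] S by metis
      then show False using f D.lcoeff_nonzero[OF f(2,1)] S by simp
    qed
    have smult: "\<Theta> (a \<odot>\<^bsub>P\<^esub> p) = a \<otimes> \<Theta> p" if "a \<in> A" "p \<in> carrier P" for a p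
      using D.monom_mult_is_smult[of a p] const that E.hom_mult[of "up_ring.monom P a 0" p] by (simp add: S)
    \<comment> \<open>\<open>B\<close> singles out the polynomials whose value at \<open>x\<close>
      is a nonzero multiple of \<open>b\<close>. A member \<open>c\<close> of least degree will turn
      out to be constant, which gives a nonzero multiple of \<open>b\<close> inside
      \<open>A\<close>.\<close>
    define B where "B p \<longleftrightarrow> p \<in> carrier P \<and> \<Theta> p \<noteq> \<zero> \<and> (\<exists>r\<in>carrier P. \<Theta> p = \<Theta> r \<otimes> b)" for p
    have bR: "b \<in> carrier R" using q by simp
    have "\<Theta> q = \<Theta> \<one>\<^bsub>P\<^esub> \<otimes> b" using q(2) bR by simp
    then have "B q" using q b(2) D.UP_one_closed unfolding B_def by blast
    define c where "c = arg_min (deg S) B"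
    have c: "B c" using arg_min_natI[of B _ "deg S"] \<open>B q\<close> unfolding c_def by blast
    have cmin: "\<not> B p" if "deg S p < deg S c" for p
      using arg_min_nat_le[of B p "deg S"] that unfolding c_def by fastforce
    obtain r where r: "r \<in> carrier P" "\<Theta> c = \<Theta> r \<otimes> b" using c unfolding B_def by blast
    have cP: "c \<in> carrier P" "\<Theta> c \<noteq> \<zero>" using c by (auto simp: B_def)
    have c0: "c \<noteq> \<zero>\<^bsub>P\<^esub>" using cP by auto
    have lf: "D.lcoeff f \<in> A" "D.lcoeff f \<noteq> \<zero>"
      using D.lcoeff_closed[OF f(1)] D.lcoeff_nonzero[OF f(2,1)] by (simp_all add: S)
    have lfk: "D.lcoeff f [^]\<^bsub>S\<^esub> k \<in> A" "D.lcoeff f [^]\<^bsub>S\<^esub> k \<noteq> \<zero>" for k :: nat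
      using lf D.R.nat_pow_closed[of "D.lcoeff f" k] D.R.nat_pow_nonzero[of "D.lcoeff f" k] by (auto simp: S)
    \<comment> \<open>Otherwise pseudo-division by \<open>f\<close> gives a remainder of smaller
      degree whose value is a power of the leading coefficient of \<open>f\<close> times
      \<open>\<Theta> c\<close>, again a nonzero multiple of \<open>b\<close>.\<close>
    have cf: "deg S c < deg S f"
    proof (rule ccontr)
      assume le: "\<not> deg S c < deg S f"
      obtain s e k where s: "s \<in> carrier P" "e \<in> carrier P"
        "D.lcoeff f [^]\<^bsub>S\<^esub> (k::nat) \<odot>\<^bsub>P\<^esub> c = f \<otimes>\<^bsub>P\<^esub> s \<oplus>\<^bsub>P\<^esub> e" "e = \<zero>\<^bsub>P\<^esub> \<or> deg S e < deg S f"
        using D.long_div_theorem[OF f(1) cP(1) f(2)] by blast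
      let ?u = "D.lcoeff f [^]\<^bsub>S\<^esub> k"
      have te: "\<Theta> e = ?u \<otimes> \<Theta> c"
        using arg_cong[OF s(3), of \<Theta>] smult[of ?u c] lfk[of k] cP f(1,3) s(1,2) AR by auto
      have "\<Theta> e \<noteq> \<zero>" using te integral[of ?u "\<Theta> c"] lfk[of k] cP AR by auto
      moreover have "\<Theta> e = \<Theta> (up_ring.monom P ?u 0 \<otimes>\<^bsub>P\<^esub> r) \<otimes> b"
        using te r bR lfk[of k] AR const[of ?u] E.hom_mult[of "up_ring.monom P ?u 0" r] E.hom_closed[OF r(1)]
        by (simp add: S m_assoc subset_iff)
      moreover have "up_ring.monom P ?u 0 \<otimes>\<^bsub>P\<^esub> r \<in> carrier P" using r lfk[of k] by (simp add: S)
      ultimately have "B e" using s(2) unfolding B_def by blast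
      moreover have "e \<noteq> \<zero>\<^bsub>P\<^esub>" using \<open>\<Theta> e \<noteq> \<zero>\<close> by auto
      ultimately show False using cmin[of e] s(4) le by auto
    qed
    \<comment> \<open>Pseudo-division of \<open>f\<close> by \<open>c\<close>: the remainder
      represents a multiple of \<open>b\<close> in smaller degree than \<open>c\<close>, so its
      value is zero, and minimality of \<open>f\<close> makes it the zero polynomial. Then the
      quotient \<open>s\<close> annihilates \<open>x\<close>, in degree below that of
      \<open>f\<close>.\<close>
    have "deg S c = 0"
    proof (rule ccontr)
      assume nz: "deg S c \<noteq> 0"
      have lc: "D.lcoeff c \<in> A" "D.lcoeff c \<noteq> \<zero>"
        using D.lcoeff_closed[OF cP(1)] D.lcoeff_nonzero[OF c0 cP(1)] by (simp_all add: S)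
      obtain s e k where s: "s \<in> carrier P" "e \<in> carrier P"
        "D.lcoeff c [^]\<^bsub>S\<^esub> (k::nat) \<odot>\<^bsub>P\<^esub> f = c \<otimes>\<^bsub>P\<^esub> s \<oplus>\<^bsub>P\<^esub> e" "e = \<zero>\<^bsub>P\<^esub> \<or> deg S e < deg S c"
        using D.long_div_theorem[OF cP(1) f(1) c0] by blast
      have lck: "D.lcoeff c [^]\<^bsub>S\<^esub> k \<in> A" "D.lcoeff c [^]\<^bsub>S\<^esub> k \<noteq> \<zero>"
        using lc D.R.nat_pow_closed[of "D.lcoeff c" k] D.R.nat_pow_nonzero[of "D.lcoeff c" k] by (auto simp: S)
      have "e = \<zero>\<^bsub>P\<^esub>"
      proof (rule ccontr)
        assume e: "e \<noteq> \<zero>\<^bsub>P\<^esub>"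
        have "\<zero> = \<Theta> c \<otimes> \<Theta> s \<oplus> \<Theta> e"
          using arg_cong[OF s(3), of \<Theta>] smult[OF lck(1) f(1)] f(3) lck(1) AR cP(1) s(1,2) by auto
        then have te: "\<Theta> e = \<ominus> \<Theta> s \<otimes> \<Theta> r \<otimes> b"
        proof -
          have *: "v = \<ominus> u \<otimes> w \<otimes> b" if "\<zero> = w \<otimes> b \<otimes> u \<oplus> v" "u \<in> carrier R" "v \<in> carrier R" "w \<in> carrier R" for u v w
          proof -
            have "\<ominus> v = w \<otimes> b \<otimes> u" using that bR by (intro minus_equality) auto
            then have "v = \<ominus> (w \<otimes> b \<otimes> u)" using that(3) minus_minus[of v] by simp
            then show ?thesis using that bR by (simp add: l_minus r_minus m_ac)
          qed
          show ?thesis using \<open>\<zero> = _\<close> s r E.hom_closed unfolding r(2) by (intro *) auto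
        qed
        also have "\<dots> = \<Theta> (\<ominus>\<^bsub>P\<^esub> s \<otimes>\<^bsub>P\<^esub> r) \<otimes> b" using s r bR by simp
        finally have "\<exists>r\<in>carrier P. \<Theta> e = \<Theta> r \<otimes> b" using s r by blast
        then have "\<Theta> e = \<zero>" using cmin[of e] e s(2,4) by (auto simp: B_def)
        then show False using fmin[of e] e s(2,4) cf by auto
      qed
      then have eq: "D.lcoeff c [^]\<^bsub>S\<^esub> k \<odot>\<^bsub>P\<^esub> f = c \<otimes>\<^bsub>P\<^esub> s" using s cP by simp
      have "\<zero> = \<Theta> c \<otimes> \<Theta> s"
        using arg_cong[OF eq, of \<Theta>] smult[OF lck(1) f(1)] f(3) lck(1) AR cP(1) s(1) by auto
      then have "\<Theta> s = \<zero>" using integral[of "\<Theta> c" "\<Theta> s"] cP s by simp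
      have lcf: "deg S (D.lcoeff c [^]\<^bsub>S\<^esub> k \<odot>\<^bsub>P\<^esub> f) = deg S f"
        using lck f(1) by (simp add: S)
      then have "s \<noteq> \<zero>\<^bsub>P\<^esub>" using eq cP fdeg by fastforce
      moreover have "deg S f = deg S c + deg S s"
        using lcf eq D.deg_mult[OF c0 \<open>s \<noteq> _\<close> cP(1) s(1)] by simp
      ultimately show False using fmin[OF s(1) \<open>\<Theta> s = \<zero>\<close>] nz by simp
    qed
    then have "c = up_ring.monom P (D.lcoeff c) 0" using D.deg_zero_impl_monom[OF cP(1)] by simp
    then have \<Theta>c: "\<Theta> c = D.lcoeff c" "\<Theta> c \<in> A" using const D.lcoeff_closed[OF cP(1)] S by metis+
    \<comment> \<open>One nonvanishing condition serves two purposes: the factor from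
      \<open>f\<close> provides a root of its image and can be cancelled after pseudo-division, and
      the factor \<open>\<Theta> c\<close> is a multiple of \<open>b\<close>, so \<open>b\<close>
      cannot be sent to zero.\<close>
    define a where "a = D.lcoeff f \<otimes> \<Theta> c"
    have "a \<in> A" "a \<noteq> \<zero>"
      using lf \<Theta>c cP AR integral[of "D.lcoeff f" "\<Theta> c"] subringE(6)[OF A] by (auto simp: a_def)
    moreover have "\<exists>\<psi> \<in> ring_hom (R\<lparr>carrier := adjoin R A x\<rparr>) K. (\<forall>y\<in>A. \<psi> y = \<phi> y) \<and> \<psi> b \<noteq> \<zero>\<^bsub>K\<^esub>"
      if \<phi>: "\<phi> \<in> ring_hom (R\<lparr>carrier := A\<rparr>) K" "\<phi> a \<noteq> \<zero>\<^bsub>K\<^esub>" for \<phi>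
    proof -
      interpret Q': UP_pre_univ_prop S K \<phi> P
        using that by (intro UP_pre_univ_propI D.R.is_cring K.is_cring) (auto simp: P_def S_def)
      have \<phi>a: "\<phi> a = \<phi> (D.lcoeff f) \<otimes>\<^bsub>K\<^esub> \<phi> (\<Theta> c)"
        using Q'.hom_mult[of "D.lcoeff f" "\<Theta> c"] lf \<Theta>c by (simp add: a_def S)
      have nz: "\<phi> (D.lcoeff f) \<noteq> \<zero>\<^bsub>K\<^esub>" "\<phi> (\<Theta> c) \<noteq> \<zero>\<^bsub>K\<^esub>"
        using \<phi>(2) \<phi>a Q'.hom_closed lf \<Theta>c S by auto
      obtain \<xi> where \<xi>: "\<xi> \<in> carrier K" "UnivPoly.eval S K \<phi> \<xi> f = \<zero>\<^bsub>K\<^esub>"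
        using Q'.exists_root_eval[OF K f(1) fdeg nz(1)] by blast
      interpret E': ring_hom_cring P K "UnivPoly.eval S K \<phi> \<xi>"
        using \<xi> Q'.eval_ring_hom by (intro ring_hom_cringI D.UP_cring K.is_cring) auto
      \<comment> \<open>The pseudo-remainder of \<open>p\<close> modulo \<open>f\<close> annihilates
        \<open>x\<close> in degree below that of \<open>f\<close>, hence is zero; the power of the
        leading coefficient is nonzero in \<open>K\<close> and cancels.\<close>
      have "UnivPoly.eval S K \<phi> \<xi> p = \<zero>\<^bsub>K\<^esub>" if p: "p \<in> carrier P" "\<Theta> p = \<zero>" for p
      proof -
        obtain s e k where s: "s \<in> carrier P" "e \<in> carrier P"
          "D.lcoeff f [^]\<^bsub>S\<^esub> (k::nat) \<odot>\<^bsub>P\<^esub> p = f \<otimes>\<^bsub>P\<^esub> s \<oplus>\<^bsub>P\<^esub> e" "e = \<zero>\<^bsub>P\<^esub> \<or> deg S e < deg S f"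
          using D.long_div_theorem[OF f(1) p(1) f(2)] by blast
        have lfk: "D.lcoeff f [^]\<^bsub>S\<^esub> k \<in> carrier S" using lfk(1)[of k] by (simp add: S)
        have "\<Theta> e = \<zero>"
          using arg_cong[OF s(3), of \<Theta>] smult[of "D.lcoeff f [^]\<^bsub>S\<^esub> k" p] lfk p f(1,3) s(1,2) AR S(1) by auto
        then have "e = \<zero>\<^bsub>P\<^esub>" using fmin s by blast
        then have eq: "up_ring.monom P (D.lcoeff f [^]\<^bsub>S\<^esub> k) 0 \<otimes>\<^bsub>P\<^esub> p = f \<otimes>\<^bsub>P\<^esub> s"
          using s f p lfk by (simp add: D.monom_mult_is_smult)
        have "\<phi> (D.lcoeff f [^]\<^bsub>S\<^esub> k) \<otimes>\<^bsub>K\<^esub> UnivPoly.eval S K \<phi> \<xi> p = \<zero>\<^bsub>K\<^esub>"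
          using arg_cong[OF eq, of "UnivPoly.eval S K \<phi> \<xi>"] Q'.eval_const[OF \<xi>(1) lfk] \<xi>(2) f(1) p(1) s(1) lfk by simp
        moreover have "\<phi> (D.lcoeff f [^]\<^bsub>S\<^esub> k) \<noteq> \<zero>\<^bsub>K\<^esub>"
          using Q'.hom_pow[of "D.lcoeff f" k] nz(1) lf K.nat_pow_nonzero[of "\<phi> (D.lcoeff f)" k] Q'.hom_closed[of "D.lcoeff f"] by (auto simp: S)
        ultimately show ?thesis
          using K.integral[of "\<phi> (D.lcoeff f [^]\<^bsub>S\<^esub> k)" "UnivPoly.eval S K \<phi> \<xi> p"] Q'.hom_closed[OF lfk] E'.hom_closed[OF p(1)] by auto
      qed
      from extend[OF \<phi>(1)[folded S_def] \<xi>(1) this] obtain \<psi> where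
        \<psi>: "\<psi> \<in> ring_hom (R\<lparr>carrier := adjoin R A x\<rparr>) K" "\<forall>y\<in>A. \<psi> y = \<phi> y"
        by blast
      have "\<psi> (\<Theta> c) = \<psi> (\<Theta> r) \<otimes>\<^bsub>K\<^esub> \<psi> b"
        using ring_hom_mult[OF \<psi>(1), of "\<Theta> r" b] r b(1) unfolding adjoin_def \<Theta>_def P_def S_def by simp
      moreover have "\<psi> (\<Theta> r) \<in> carrier K"
        using ring_hom_closed[OF \<psi>(1), of "\<Theta> r"] r(1) unfolding adjoin_def \<Theta>_def P_def S_def by simp
      ultimately have "\<psi> b \<noteq> \<zero>\<^bsub>K\<^esub>" using nz(2) \<psi>(2) \<Theta>c by auto
      then show ?thesis using \<psi> by blast
    qed
    ultimately show ?thesis using that by blast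
  qed
qed

primrec adjoin_list :: "('a, 'b) ring_scheme \<Rightarrow> 'a set \<Rightarrow> 'a list \<Rightarrow> 'a set" where
  "adjoin_list L A [] = A"
| "adjoin_list L A (x # xs) = adjoin_list L (adjoin L A x) xs"

lemma (in domain) adjoin_list:
  assumes "subring A R" "set xs \<subseteq> carrier R"
  shows "subring (adjoin_list R A xs) R" "A \<subseteq> adjoin_list R A xs" "set xs \<subseteq> adjoin_list R A xs"
  using assms
proof (induction xs arbitrary: A)
  case (Cons x xs)
  {
    case 1
    then show ?case using Cons.IH(1) adjoin(1)[of A x] by simp
  next
    case 2
    then show ?case using Cons.IH(2)[of "adjoin R A x"] adjoin[of A x] by auto
  next
    case 3
    then show ?case using Cons.IH(2,3)[of "adjoin R A x"] adjoin[of A x] by auto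
  }
qed simp_all

text \<open>The nonvanishing condition travels backwards through the list: the element
  \<open>b'\<close> that must survive for the remaining generators is the one kept nonzero while
  \<open>x\<close> is adjoined.\<close>

lemma (in domain) hom_extends_adjoin_list:
  assumes "algebraically_closed K" "subring A R" "set xs \<subseteq> carrier R"
    and "b \<in> adjoin_list R A xs" "b \<noteq> \<zero>"
  shows "\<exists>a\<in>A. a \<noteq> \<zero> \<and> (\<forall>\<phi> \<in> ring_hom (R\<lparr>carrier := A\<rparr>) K. \<phi> a \<noteq> \<zero>\<^bsub>K\<^esub> \<longrightarrow>
    (\<exists>\<psi> \<in> ring_hom (R\<lparr>carrier := adjoin_list R A xs\<rparr>) K. (\<forall>y\<in>A. \<psi> y = \<phi> y) \<and> \<psi> b \<noteq> \<zero>\<^bsub>K\<^esub>))"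
  using assms(2-)
proof (induction xs arbitrary: A)
  case Nil
  then show ?case by (intro bexI[of _ b]) auto
next
  case (Cons x xs)
  note B = adjoin[of A x]
  obtain b' where b': "b' \<in> adjoin R A x" "b' \<noteq> \<zero>"
    "\<And>\<phi>. \<phi> \<in> ring_hom (R\<lparr>carrier := adjoin R A x\<rparr>) K \<Longrightarrow> \<phi> b' \<noteq> \<zero>\<^bsub>K\<^esub> \<Longrightarrow>
      (\<exists>\<psi> \<in> ring_hom (R\<lparr>carrier := adjoin_list R (adjoin R A x) xs\<rparr>) K. (\<forall>y\<in>adjoin R A x. \<psi> y = \<phi> y) \<and> \<psi> b \<noteq> \<zero>\<^bsub>K\<^esub>)"
    using Cons.IH[of "adjoin R A x"] Cons.prems B(1) by auto
  have "x \<in> carrier R" using Cons.prems by simp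
  obtain a where a: "a \<in> A" "a \<noteq> \<zero>"
    "\<And>\<phi>. \<phi> \<in> ring_hom (R\<lparr>carrier := A\<rparr>) K \<Longrightarrow> \<phi> a \<noteq> \<zero>\<^bsub>K\<^esub> \<Longrightarrow>
      \<exists>\<psi> \<in> ring_hom (R\<lparr>carrier := adjoin R A x\<rparr>) K. (\<forall>y\<in>A. \<psi> y = \<phi> y) \<and> \<psi> b' \<noteq> \<zero>\<^bsub>K\<^esub>"
    by (rule hom_extends_adjoin[OF assms(1) Cons.prems(1) \<open>x \<in> carrier R\<close> b'(1,2)]) (assumption | (erule that; blast))
  have "\<exists>\<psi> \<in> ring_hom (R\<lparr>carrier := adjoin_list R A (x # xs)\<rparr>) K. (\<forall>y\<in>A. \<psi> y = \<phi> y) \<and> \<psi> b \<noteq> \<zero>\<^bsub>K\<^esub>"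
    if \<phi>: "\<phi> \<in> ring_hom (R\<lparr>carrier := A\<rparr>) K" "\<phi> a \<noteq> \<zero>\<^bsub>K\<^esub>" for \<phi>
  proof -
    obtain \<psi> where \<psi>: "\<psi> \<in> ring_hom (R\<lparr>carrier := adjoin R A x\<rparr>) K" "\<forall>y\<in>A. \<psi> y = \<phi> y" "\<psi> b' \<noteq> \<zero>\<^bsub>K\<^esub>"
      using a(3)[OF \<phi>] by blast
    obtain \<chi> where "\<chi> \<in> ring_hom (R\<lparr>carrier := adjoin_list R (adjoin R A x) xs\<rparr>) K"
        "\<forall>y\<in>adjoin R A x. \<chi> y = \<psi> y" "\<chi> b \<noteq> \<zero>\<^bsub>K\<^esub>"
      using b'(3)[OF \<psi>(1,3)] by blast
    then show ?thesis using \<psi>(2) B(2) Cons.prems by (intro bexI[of _ \<chi>]) auto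
  qed
  then show ?case using a by blast
qed

text \<open>With \<open>b = 1\<close> the extension result gives a homomorphism
  \<open>\<psi>\<close> from \<open>L\<close> to \<open>K\<close> that extends the inverse of
  \<open>h\<close> on its image. It takes the same value at \<open>x\<close> and at
  \<open>h (\<psi> x)\<close>; as it cannot kill a unit, the two are equal, and \<open>x\<close> is
  in the image of \<open>h\<close>.\<close>

theorem zariski_lemma:
  assumes K: "algebraically_closed K" and "field L"
    and h: "h \<in> ring_hom K L" and xs: "finite Y" "Y \<subseteq> carrier L"
    and gen: "generate_ring L (h ` carrier K \<union> Y) = carrier L"
  shows "h ` carrier K = carrier L"
proof -
  interpret K: algebraically_closed K by fact
  interpret L: field L by fact
  interpret h: ring_hom_ring K L h
    using h by (intro ring_hom_ringI2 K.ring_axioms L.ring_axioms)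
  interpret hc: ring_hom_cring K L h
    using h by (intro ring_hom_cringI K.is_cring L.is_cring)
  define A where "A = h ` carrier K"
  have A: "subring A L" unfolding A_def by (rule h.img_is_subring[OF K.carrier_is_subring])
  have AL: "A \<subseteq> carrier L" using subringE(1)[OF A] .
  obtain xs where xs': "set xs = Y" using finite_list[OF xs(1)] by blast
  have "generate_ring L (A \<union> Y) \<subseteq> adjoin_list L A xs"
    using L.adjoin_list[OF A, of xs] xs xs' AL by (intro L.generate_ring_min_subring1) auto
  then have eq: "adjoin_list L A xs = carrier L"
    using gen subringE(1)[OF L.adjoin_list(1)[OF A, of xs]] xs xs' unfolding A_def by auto
  have inj: "inj_on h (carrier K)"
    using non_trivial_field_hom_is_inj[OF h K.field_axioms L.field_axioms] .
  obtain a where a: "a \<in> A" "a \<noteq> \<zero>\<^bsub>L\<^esub>" and ext: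
    "\<forall>\<phi> \<in> ring_hom (L\<lparr>carrier := A\<rparr>) K. \<phi> a \<noteq> \<zero>\<^bsub>K\<^esub> \<longrightarrow>
      (\<exists>\<psi> \<in> ring_hom (L\<lparr>carrier := adjoin_list L A xs\<rparr>) K. (\<forall>y\<in>A. \<psi> y = \<phi> y) \<and> \<psi> \<one>\<^bsub>L\<^esub> \<noteq> \<zero>\<^bsub>K\<^esub>)"
    using L.hom_extends_adjoin_list[OF K A, of xs "\<one>\<^bsub>L\<^esub>"] xs xs' eq by auto
  define \<phi> where "\<phi> = inv_into (carrier K) h"
  have \<phi>h: "\<phi> (h c) = c" if "c \<in> carrier K" for c
    using that inj by (simp add: \<phi>_def)
  have \<phi>: "\<phi> \<in> ring_hom (L\<lparr>carrier := A\<rparr>) K"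
  proof (rule ring_hom_memI)
    fix x y assume "x \<in> carrier (L\<lparr>carrier := A\<rparr>)" "y \<in> carrier (L\<lparr>carrier := A\<rparr>)"
    then obtain c d where c: "c \<in> carrier K" "x = h c" "d \<in> carrier K" "y = h d" unfolding A_def by auto
    show "\<phi> (x \<otimes>\<^bsub>L\<lparr>carrier := A\<rparr>\<^esub> y) = \<phi> x \<otimes>\<^bsub>K\<^esub> \<phi> y"
      using c \<phi>h[of "c \<otimes>\<^bsub>K\<^esub> d"] \<phi>h by simp
    show "\<phi> (x \<oplus>\<^bsub>L\<lparr>carrier := A\<rparr>\<^esub> y) = \<phi> x \<oplus>\<^bsub>K\<^esub> \<phi> y"
      using c \<phi>h[of "c \<oplus>\<^bsub>K\<^esub> d"] \<phi>h by simp
  next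
    fix x assume "x \<in> carrier (L\<lparr>carrier := A\<rparr>)"
    then show "\<phi> x \<in> carrier K" using \<phi>h by (auto simp: A_def)
  next
    show "\<phi> \<one>\<^bsub>L\<lparr>carrier := A\<rparr>\<^esub> = \<one>\<^bsub>K\<^esub>" using \<phi>h[of "\<one>\<^bsub>K\<^esub>"] by simp
  qed
  have "\<phi> a \<noteq> \<zero>\<^bsub>K\<^esub>"
    using a \<phi>h unfolding A_def by auto
  then obtain \<psi> where \<psi>: "\<psi> \<in> ring_hom L K" "\<And>y. y \<in> A \<Longrightarrow> \<psi> y = \<phi> y"
  proof -
    have "\<exists>\<psi> \<in> ring_hom L K. \<forall>y\<in>A. \<psi> y = \<phi> y"
      using ext[rule_format, OF \<phi> \<open>\<phi> a \<noteq> _\<close>] unfolding eq by auto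
    then show ?thesis using that by blast
  qed
  interpret \<psi>: ring_hom_cring L K \<psi>
    using \<psi> by (intro ring_hom_cringI K.is_cring L.is_cring)
  have "x \<in> A" if x: "x \<in> carrier L" for x
  proof -
    define y where "y = x \<ominus>\<^bsub>L\<^esub> h (\<psi> x)"
    have y: "y \<in> carrier L" using x by (simp add: y_def)
    have "\<psi> (h (\<psi> x)) = \<psi> x" using x \<psi>(2)[of "h (\<psi> x)"] \<phi>h by (simp add: A_def)
    then have y0: "\<psi> y = \<zero>\<^bsub>K\<^esub>" using x by (simp add: y_def a_minus_def K.r_neg)
    have "y = \<zero>\<^bsub>L\<^esub>"
    proof (rule ccontr)
      assume "y \<noteq> \<zero>\<^bsub>L\<^esub>"
      then have "y \<in> Units L" using y L.field_Units by simp
      then have "\<psi> y \<otimes>\<^bsub>K\<^esub> \<psi> (inv\<^bsub>L\<^esub> y) = \<one>\<^bsub>K\<^esub>"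
        using \<psi>.hom_mult[OF y, of "inv\<^bsub>L\<^esub> y"] by simp
      then show False using y0 \<open>y \<in> Units L\<close> by simp
    qed
    then have "x = h (\<psi> x)" using x by (simp add: y_def)
    moreover have "\<psi> x \<in> carrier K" using x by simp
    ultimately show ?thesis unfolding A_def by (rule image_eqI)
  qed
  then show ?thesis using AL unfolding A_def by auto
qed

section \<open>Simple quotients by maximal left ideals\<close>

definition left_ideal :: "'a set \<Rightarrow> ('a, 'b) ring_scheme \<Rightarrow> bool" where
  "left_ideal I R \<longleftrightarrow> I \<subseteq> carrier R \<and> \<zero>\<^bsub>R\<^esub> \<in> I \<and> (\<forall>x\<in>I. \<forall>y\<in>I. x \<oplus>\<^bsub>R\<^esub> y \<in> I) \<and>
    (\<forall>a\<in>carrier R. \<forall>x\<in>I. a \<otimes>\<^bsub>R\<^esub> x \<in> I)"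

text \<open>Zorn's lemma: properness, expressed as \<open>\<one> \<notin> I\<close>, passes to
  unions of chains.\<close>

lemma (in ring) exists_maximal_left_ideal:
  assumes "left_ideal J R" "\<one> \<notin> J"
  obtains N where "left_ideal N R" "J \<subseteq> N" "\<one> \<notin> N"
    "\<And>I. left_ideal I R \<Longrightarrow> N \<subseteq> I \<Longrightarrow> \<one> \<notin> I \<Longrightarrow> I = N"
proof -
  define \<A> where "\<A> = {I. left_ideal I R \<and> J \<subseteq> I \<and> \<one> \<notin> I}"
  have "\<exists>M\<in>\<A>. \<forall>I\<in>\<A>. M \<subseteq> I \<longrightarrow> I = M"
  proof (rule subset_Zorn_nonempty)
    show "\<A> \<noteq> {}" using assms by (auto simp: \<A>_def)
    fix C assume "C \<noteq> {}" and C: "subset.chain \<A> C"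
    then have CA: "C \<subseteq> \<A>" and lin: "\<And>I I'. I \<in> C \<Longrightarrow> I' \<in> C \<Longrightarrow> I \<subseteq> I' \<or> I' \<subseteq> I"
      by (auto simp: subset_chain_def)
    obtain I\<^sub>0 where "I\<^sub>0 \<in> C" using \<open>C \<noteq> {}\<close> by blast
    have "x \<oplus> y \<in> \<Union>C" if xy: "x \<in> \<Union>C" "y \<in> \<Union>C" for x y
    proof -
      obtain I I' where "I \<in> C" "x \<in> I" "I' \<in> C" "y \<in> I'" using xy by blast
      then obtain I'' where "I'' \<in> C" "x \<in> I''" "y \<in> I''" using lin by blast
      moreover from this have "x \<oplus> y \<in> I''" using CA by (auto simp: \<A>_def left_ideal_def)
      ultimately show ?thesis by blast
    qed
    moreover have "a \<otimes> x \<in> \<Union>C" if ax: "a \<in> carrier R" "x \<in> \<Union>C" for a x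
    proof -
      obtain I where "I \<in> C" "x \<in> I" using ax by blast
      moreover from this have "a \<otimes> x \<in> I" using CA ax by (auto simp: \<A>_def left_ideal_def)
      ultimately show ?thesis by blast
    qed
    moreover have "\<Union>C \<subseteq> carrier R" "J \<subseteq> \<Union>C" "\<zero> \<in> \<Union>C" "\<one> \<notin> \<Union>C"
      using CA \<open>I\<^sub>0 \<in> C\<close> by (auto simp: \<A>_def left_ideal_def)
    ultimately show "\<Union>C \<in> \<A>"
      by (simp add: \<A>_def left_ideal_def)
  qed
  then obtain N where "N \<in> \<A>" "\<And>I. I \<in> \<A> \<Longrightarrow> N \<subseteq> I \<Longrightarrow> I = N" by blast
  then show ?thesis using that[of N] unfolding \<A>_def by blast
qed

text \<open>The fields \<open>mult\<close> and \<open>one\<close> of the record are irrelevant for a module.\<close>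

definition quot_module :: "('a, 'b) ring_scheme \<Rightarrow> 'a set \<Rightarrow> ('a, 'a set) module" where
  "quot_module R N = \<lparr>carrier = a_rcosets\<^bsub>R\<^esub> N, monoid.mult = undefined, one = undefined,
     ring.zero = N, add = set_add R, smult = (\<lambda>a A. \<Union>x\<in>A. N +>\<^bsub>R\<^esub> (a \<otimes>\<^bsub>R\<^esub> x))\<rparr>"

lemma (in ring) left_ideal_abelian_subgroup:
  assumes "left_ideal N R"
  shows "abelian_subgroup N R"
proof (rule abelian_subgroupI3)
  have "\<ominus> x \<in> N" if "x \<in> N" for x
  proof -
    have "(\<ominus> \<one>) \<otimes> x \<in> N" "x \<in> carrier R" using assms that by (auto simp: left_ideal_def)
    then show ?thesis by (simp add: l_minus)
  qed
  then show "additive_subgroup N R"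
    using assms by (intro additive_subgroup.intro add.subgroupI) (auto simp: left_ideal_def subset_iff simp flip: a_inv_def)
  show "abelian_group R" by (rule local.abelian_group_axioms)
qed

lemma (in abelian_subgroup) a_rcos_eq_iff:
  assumes "x \<in> carrier G" "y \<in> carrier G"
  shows "H +> x = H +> y \<longleftrightarrow> x \<ominus> y \<in> H"
proof
  assume "H +> x = H +> y"
  then show "x \<ominus> y \<in> H" using assms a_rcos_self[of x] a_rcos_module[of y x] by (simp add: a_minus_def)
next
  assume "x \<ominus> y \<in> H"
  then have "x \<in> H +> y" using assms a_rcos_module[of y x] by (simp add: a_minus_def)
  then show "H +> x = H +> y" using a_repr_independence[OF _ assms(2) a_subgroup] by simp
qed

lemma (in ring) quot_module:
  assumes N: "left_ideal N R"
  shows "carrier (quot_module R N) = {N +> x | x. x \<in> carrier R}"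
    "\<zero>\<^bsub>quot_module R N\<^esub> = N"
    "\<And>x y. x \<in> carrier R \<Longrightarrow> y \<in> carrier R \<Longrightarrow> (N +> x) \<oplus>\<^bsub>quot_module R N\<^esub> (N +> y) = N +> (x \<oplus> y)"
    "\<And>a x. a \<in> carrier R \<Longrightarrow> x \<in> carrier R \<Longrightarrow> a \<odot>\<^bsub>quot_module R N\<^esub> (N +> x) = N +> (a \<otimes> x)"
    "\<And>x y. x \<in> carrier R \<Longrightarrow> y \<in> carrier R \<Longrightarrow> N +> x = N +> y \<longleftrightarrow> x \<ominus> y \<in> N"
    "left_module R (quot_module R N)"
proof -
  interpret N: abelian_subgroup N R
    by (rule left_ideal_abelian_subgroup[OF N])
  show car: "carrier (quot_module R N) = {N +> x | x. x \<in> carrier R}"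
    unfolding quot_module_def A_RCOSETS_def' by auto
  show "\<zero>\<^bsub>quot_module R N\<^esub> = N" by (simp add: quot_module_def)
  have zero: "\<zero>\<^bsub>quot_module R N\<^esub> = N +> \<zero>"
    using N.a_rcos_const[OF N.zero_closed] by (simp add: quot_module_def)
  show add: "(N +> x) \<oplus>\<^bsub>quot_module R N\<^esub> (N +> y) = N +> (x \<oplus> y)" if "x \<in> carrier R" "y \<in> carrier R" for x y
    using that by (simp add: quot_module_def N.a_rcos_sum)
  show eq: "N +> x = N +> y \<longleftrightarrow> x \<ominus> y \<in> N" if "x \<in> carrier R" "y \<in> carrier R" for x y
    by (rule N.a_rcos_eq_iff[OF that])
  show act: "a \<odot>\<^bsub>quot_module R N\<^esub> (N +> x) = N +> (a \<otimes> x)" if ax: "a \<in> carrier R" "x \<in> carrier R" for a x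
  proof -
    \<comment> \<open>Changing the representative by \<open>n\<close> in \<open>N\<close> changes
      the product by \<open>a \<otimes> n\<close>, which stays in a left ideal. The union defining
      the action is therefore a union of equal cosets.\<close>
    have "N +> (a \<otimes> y) = N +> (a \<otimes> x)" if y: "y \<in> N +> x" for y
    proof -
      obtain n where n: "n \<in> N" "y = n \<oplus> x" using y by (auto simp: a_r_coset_def')
      have nR: "n \<in> carrier R" using n N.a_subset by auto
      have "a \<otimes> y \<ominus> a \<otimes> x = a \<otimes> n"
        using n nR ax by (simp add: r_distr a_minus_def a_assoc r_neg)
      then show ?thesis using n nR ax N eq[of "a \<otimes> y" "a \<otimes> x"] by (simp add: left_ideal_def)
    qed
    then have "(\<Union>y\<in>N +> x. N +> (a \<otimes> y)) = (\<Union>y\<in>N +> x. N +> (a \<otimes> x))" by (rule SUP_cong[OF refl])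
    moreover have "N +> x \<noteq> {}" using ax N.a_rcos_self by blast
    ultimately show ?thesis by (simp add: quot_module_def)
  qed
  show "left_module R (quot_module R N)"
  proof (intro left_module.intro left_module_axioms.intro)
    show "ring R" by (rule local.ring_axioms)
    let ?Q = "quot_module R N"
    have *: "\<exists>x. x \<in> carrier R \<and> A = N +> x" if "A \<in> carrier ?Q" for A using that car by blast
    show "abelian_group ?Q"
    proof (rule abelian_groupI)
      fix A B C assume "A \<in> carrier ?Q" "B \<in> carrier ?Q" "C \<in> carrier ?Q"
      then obtain x y z where x: "x \<in> carrier R" "A = N +> x" and y: "y \<in> carrier R" "B = N +> y"
        and z: "z \<in> carrier R" "C = N +> z" using * by metis
      show "A \<oplus>\<^bsub>?Q\<^esub> B \<oplus>\<^bsub>?Q\<^esub> C = A \<oplus>\<^bsub>?Q\<^esub> (B \<oplus>\<^bsub>?Q\<^esub> C)"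
        using x y z by (simp add: add a_assoc)
    next
      fix A B assume "A \<in> carrier ?Q" "B \<in> carrier ?Q"
      then obtain x y where x: "x \<in> carrier R" "A = N +> x" and y: "y \<in> carrier R" "B = N +> y"
        using * by metis
      show "A \<oplus>\<^bsub>?Q\<^esub> B \<in> carrier ?Q" using x y car add by auto
      show "A \<oplus>\<^bsub>?Q\<^esub> B = B \<oplus>\<^bsub>?Q\<^esub> A" using x y by (simp add: add a_comm)
    next
      show "\<zero>\<^bsub>?Q\<^esub> \<in> carrier ?Q" using zero car by auto
    next
      fix A assume "A \<in> carrier ?Q"
      then obtain x where x: "x \<in> carrier R" "A = N +> x" using * by metis
      show "\<zero>\<^bsub>?Q\<^esub> \<oplus>\<^bsub>?Q\<^esub> A = A" using x zero add[of \<zero> x] by simp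
      show "\<exists>B\<in>carrier ?Q. B \<oplus>\<^bsub>?Q\<^esub> A = \<zero>\<^bsub>?Q\<^esub>"
        using x zero add[of "\<ominus> x" x] car by (intro bexI[of _ "N +> (\<ominus> x)"]) (auto simp: l_neg)
    qed
    show "a \<odot>\<^bsub>?Q\<^esub> A \<in> carrier ?Q" if "a \<in> carrier R" "A \<in> carrier ?Q" for a A
      using that *[of A] act car by auto
    show "(a \<oplus> b) \<odot>\<^bsub>?Q\<^esub> A = a \<odot>\<^bsub>?Q\<^esub> A \<oplus>\<^bsub>?Q\<^esub> b \<odot>\<^bsub>?Q\<^esub> A"
      if "a \<in> carrier R" "b \<in> carrier R" "A \<in> carrier ?Q" for a b A
      using that *[of A] by (auto simp: act add l_distr)
    show "a \<odot>\<^bsub>?Q\<^esub> (A \<oplus>\<^bsub>?Q\<^esub> B) = a \<odot>\<^bsub>?Q\<^esub> A \<oplus>\<^bsub>?Q\<^esub> a \<odot>\<^bsub>?Q\<^esub> B"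
      if "a \<in> carrier R" "A \<in> carrier ?Q" "B \<in> carrier ?Q" for a A B
      using that *[of A] *[of B] by (auto simp: act add r_distr)
    show "(a \<otimes> b) \<odot>\<^bsub>?Q\<^esub> A = a \<odot>\<^bsub>?Q\<^esub> (b \<odot>\<^bsub>?Q\<^esub> A)"
      if "a \<in> carrier R" "b \<in> carrier R" "A \<in> carrier ?Q" for a b A
      using that *[of A] by (auto simp: act m_assoc)
    show "\<one> \<odot>\<^bsub>?Q\<^esub> A = A" if "A \<in> carrier ?Q" for A
      using that *[of A] by (auto simp: act)
  qed
qed

text \<open>A submodule pulls back to a left ideal above \<open>N\<close>. Either this contains
  \<open>\<one>\<close>, and the submodule is everything, or it equals \<open>N\<close>, and the
  submodule is zero.\<close>

lemma (in ring) quot_module_simple: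
  assumes N: "left_ideal N R" "\<one> \<notin> N"
    and max: "\<And>I. left_ideal I R \<Longrightarrow> N \<subseteq> I \<Longrightarrow> \<one> \<notin> I \<Longrightarrow> I = N"
  shows "simple_module R (quot_module R N)"
proof -
  let ?Q = "quot_module R N"
  note Q = quot_module[OF N(1)]
  have NR: "N \<subseteq> carrier R" "\<zero> \<in> N" using N by (auto simp: left_ideal_def)
  have N0: "N +> x = N \<longleftrightarrow> x \<in> N" if "x \<in> carrier R" for x
  proof -
    interpret N: abelian_subgroup N R by (rule left_ideal_abelian_subgroup[OF N(1)])
    show ?thesis using a_coset_join1[OF _ that N.a_subgroup] a_coset_join2[OF that N.a_subgroup] by blast
  qed
  have "N +> \<one> \<noteq> N" using N0[of \<one>] N(2) by simp
  moreover have "N +> \<one> \<in> carrier ?Q" by (subst Q(1)) auto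
  ultimately have ne: "carrier ?Q \<noteq> {\<zero>\<^bsub>?Q\<^esub>}" by (subst Q(2)) force
  have sub: "S = {\<zero>\<^bsub>?Q\<^esub>} \<or> S = carrier ?Q" if S: "submodule S R ?Q" for S
  proof -
    interpret S: submodule S R ?Q by (rule S)
    define I where "I = {x \<in> carrier R. N +> x \<in> S}"
    have SQ: "S \<subseteq> carrier ?Q" using S.subset by simp
    have "left_ideal I R"
      unfolding left_ideal_def
    proof (intro conjI ballI)
      show "I \<subseteq> carrier R" by (auto simp: I_def)
      show "\<zero> \<in> I" using N0[of \<zero>] NR S.one_closed Q(2) by (simp add: I_def)
      show "x \<oplus> y \<in> I" if "x \<in> I" "y \<in> I" for x y
        using that S.m_closed[of "N +> x" "N +> y"] Q(3)[of x y] by (simp add: I_def)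
      show "a \<otimes> x \<in> I" if "a \<in> carrier R" "x \<in> I" for a x
        using that S.smult_closed[of a "N +> x"] Q(4)[of a x] by (simp add: I_def)
    qed
    have NS: "N \<in> S" using S.one_closed Q(2) by simp
    have "N \<subseteq> I"
    proof
      fix x assume "x \<in> N"
      then have "x \<in> carrier R" "N +> x = N" using N0 NR by blast+
      then show "x \<in> I" using NS by (simp add: I_def)
    qed
    show ?thesis
    proof (cases "\<one> \<in> I")
      case True
      have "N +> x \<in> S" if "x \<in> carrier R" for x
        using S.smult_closed[of x "N +> \<one>"] Q(4)[of x \<one>] that True by (simp add: I_def)
      then have "carrier ?Q \<subseteq> S" by (subst Q(1)) auto
      then show ?thesis using SQ by blast
    next
      case False
      have "I = N" by (rule max[OF \<open>left_ideal I R\<close> \<open>N \<subseteq> I\<close> False])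
      have "A = N" if A: "A \<in> S" for A
      proof -
        have "A \<in> {N +> x | x. x \<in> carrier R}" using A SQ by (subst Q(1)[symmetric]) auto
        then obtain x where x: "x \<in> carrier R" "A = N +> x" by auto
        then have "x \<in> I" using A by (simp add: I_def)
        then show ?thesis using N0[OF x(1)] x(2) \<open>I = N\<close> by simp
      qed
      then have "S = {N}" using NS by blast
      then show ?thesis using Q(2) by simp
    qed
  qed
  show ?thesis unfolding simple_module_def using Q(6) ne sub by (intro conjI allI impI)
qed

section \<open>Lifting Koszul boundaries along a filtration\<close>

text \<open>The weight of the basis vector of the Koszul complex indexed by \<open>l\<close>.\<close>

fun koszul_weight :: "nat list \<Rightarrow> bool list \<Rightarrow> nat" where
  "koszul_weight (e # es) (b # l) = (if b then e else 0) + koszul_weight es l"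
| "koszul_weight _ _ = 0"

lemma koszul_weight_zero: "True \<notin> set l \<Longrightarrow> koszul_weight es l = 0"
  by (induction es l rule: koszul_weight.induct) auto

text \<open>The descent concerns only the ring filtration, so scalars are forgotten; of the
  condition on \<open>F 0\<close> there remains that it contains \<open>\<one>\<close>.\<close>

locale filtered_ring = ring U for U :: "('k, 'a, 'm) module_scheme" (structure) +
  fixes F :: "nat \<Rightarrow> 'a set"
  assumes F_subgroup: "additive_subgroup (F i) U"
    and F_mono: "F i \<subseteq> F (Suc i)"
    and F_one: "\<one> \<in> F 0"
    and F_mult: "\<lbrakk> x \<in> F i; y \<in> F j \<rbrakk> \<Longrightarrow> x \<otimes> y \<in> F (i + j)"
    and F_exhaustive: "carrier U = (\<Union>i. F i)"
begin

section \<open>Filtration steps, their cosets and the graded pieces\<close>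

abbreviation "pre \<equiv> filt_pred U F"
abbreviation "G \<equiv> gr U F"

lemma F_carrier: "x \<in> F i \<Longrightarrow> x \<in> carrier U"
  using F_exhaustive by blast

lemma F_closed:
  "\<zero> \<in> F i" "x \<in> F i \<Longrightarrow> y \<in> F i \<Longrightarrow> x \<oplus> y \<in> F i" "x \<in> F i \<Longrightarrow> \<ominus> x \<in> F i"
  "x \<in> F i \<Longrightarrow> y \<in> F i \<Longrightarrow> x \<ominus> y \<in> F i"
  using F_subgroup[of i] by (auto simp: a_minus_def additive_subgroup.zero_closed additive_subgroup.a_closed
      additive_subgroup.a_inv_closed)

lemma F_le: "i \<le> j \<Longrightarrow> F i \<subseteq> F j"
  using lift_Suc_mono_le[of F, OF F_mono] .

lemma pre_subgroup: "additive_subgroup (pre n) U"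
proof (cases n)
  case 0
  have "additive_subgroup {\<zero>} U"
    by (intro additive_subgroup.intro add.subgroupI) auto
  then show ?thesis using 0 by (simp add: filt_pred_def)
qed (simp add: filt_pred_def F_subgroup)

lemma pre_le: "pre n \<subseteq> F n"
  using F_mono F_closed(1) by (cases n) (auto simp: filt_pred_def)

text \<open>This makes products of classes well defined. Degree 0 is treated apart, because
  \<open>pre 0\<close> is the zero subgroup and not a step of the filtration.\<close>

lemma pre_mult:
  assumes "x \<in> F i" "y \<in> F j" "x \<in> pre i \<or> y \<in> pre j"
  shows "x \<otimes> y \<in> pre (i + j)"
proof -
  have *: "pre (Suc k) = F k" for k by (simp add: filt_pred_def)
  have "x \<in> carrier U" "y \<in> carrier U" using assms F_carrier by auto
  show ?thesis
    using assms(3)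
  proof
    assume x: "x \<in> pre i"
    show ?thesis
    proof (cases i)
      case 0
      then show ?thesis using x \<open>y \<in> carrier U\<close> additive_subgroup.zero_closed[OF pre_subgroup] by (simp add: filt_pred_def)
    next
      case (Suc k)
      then show ?thesis using F_mult[of x k y j] x assms(2) by (simp add: *)
    qed
  next
    assume y: "y \<in> pre j"
    show ?thesis
    proof (cases j)
      case 0
      then show ?thesis using y \<open>x \<in> carrier U\<close> additive_subgroup.zero_closed[OF pre_subgroup] by (simp add: filt_pred_def)
    next
      case (Suc k)
      then show ?thesis using F_mult[of x i y k] y assms(1) by (simp add: *)
    qed
  qed
qed

lemma pre_abelian_subgroup: "abelian_subgroup (pre n) U"
  by (rule abelian_subgroupI3[OF pre_subgroup]) (rule local.abelian_group_axioms)

lemma coset_eq_iff: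
  assumes "x \<in> carrier U" "y \<in> carrier U"
  shows "pre n +> x = pre n +> y \<longleftrightarrow> x \<ominus> y \<in> pre n"
  by (rule abelian_subgroup.a_rcos_eq_iff[OF pre_abelian_subgroup assms])

lemma coset_zero: "pre n +> \<zero> = pre n"
proof -
  interpret N: abelian_subgroup "pre n" U by (rule pre_abelian_subgroup)
  show ?thesis using N.a_rcos_const[OF N.zero_closed] .
qed

lemma coset_eq_pre: "x \<in> carrier U \<Longrightarrow> pre n +> x = pre n \<longleftrightarrow> x \<in> pre n"
  using coset_eq_iff[of x \<zero> n] by (simp add: coset_zero a_minus_def)

lemma coset_add:
  "x \<in> carrier U \<Longrightarrow> y \<in> carrier U \<Longrightarrow> (pre n +> x) <+> (pre n +> y) = pre n +> (x \<oplus> y)"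
proof -
  interpret N: abelian_subgroup "pre n" U by (rule pre_abelian_subgroup)
  show "x \<in> carrier U \<Longrightarrow> y \<in> carrier U \<Longrightarrow> ?thesis" by (rule N.a_rcos_sum)
qed

text \<open>Other representatives change the product by
  \<open>p \<otimes> b \<oplus> x \<otimes> q\<close> with \<open>p\<close> and \<open>q\<close> one
  step lower, and \<open>pre_mult\<close> applies to both terms.\<close>

lemma coset_mult:
  assumes "x \<in> F i" "y \<in> F j"
  shows "rcoset_mult U (pre (i + j)) (pre i +> x) (pre j +> y) = pre (i + j) +> (x \<otimes> y)"
proof -
  have "pre (i + j) +> (a \<otimes> b) = pre (i + j) +> (x \<otimes> y)" if a: "a \<in> pre i +> x" and b: "b \<in> pre j +> y" for a b
  proof -
    obtain p where p: "p \<in> pre i" "a = p \<oplus> x" using a by (auto simp: a_r_coset_def')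
    obtain q where q: "q \<in> pre j" "b = q \<oplus> y" using b by (auto simp: a_r_coset_def')
    have pF: "p \<in> F i" "q \<in> F j" using p q pre_le by auto
    have c: "p \<in> carrier U" "q \<in> carrier U" "x \<in> carrier U" "y \<in> carrier U" using pF assms F_carrier by auto
    have bF: "b \<in> F j" using q pF assms F_closed by auto
    have "a \<otimes> b \<ominus> x \<otimes> y = p \<otimes> b \<oplus> x \<otimes> q"
      using c p q by (simp add: l_distr r_distr a_minus_def a_assoc r_neg) (simp add: a_comm c)
    moreover have "p \<otimes> b \<in> pre (i + j)" "x \<otimes> q \<in> pre (i + j)"
      using pre_mult pF bF p q assms by auto
    ultimately have "a \<otimes> b \<ominus> x \<otimes> y \<in> pre (i + j)"
      using additive_subgroup.a_closed[OF pre_subgroup] by simp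
    then show ?thesis using c p q by (subst coset_eq_iff) auto
  qed
  moreover have "x \<in> pre i +> x" "y \<in> pre j +> y"
    using abelian_subgroup.a_rcos_self[OF pre_abelian_subgroup] F_carrier assms by auto
  ultimately have "(\<Union>a\<in>pre i +> x. \<Union>b\<in>pre j +> y. pre (i + j) +> (a \<otimes> b)) = pre (i + j) +> (x \<otimes> y)"
    by blast
  then show ?thesis by (simp add: rcoset_mult_def)
qed

lemma gr_piece_simps:
  "carrier (gr_piece U F n) = {pre n +> x | x. x \<in> F n}"
  "\<one>\<^bsub>gr_piece U F n\<^esub> = pre n"
  "A \<otimes>\<^bsub>gr_piece U F n\<^esub> B = A <+> B"
proof -
  show "carrier (gr_piece U F n) = {pre n +> x | x. x \<in> F n}"
    unfolding gr_piece_def A_FactGroup_def' A_RCOSETS_def' by (auto simp: a_r_coset_def')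
  show "\<one>\<^bsub>gr_piece U F n\<^esub> = pre n" by (simp add: gr_piece_def A_FactGroup_def')
  show "A \<otimes>\<^bsub>gr_piece U F n\<^esub> B = A <+> B" by (simp add: gr_piece_def A_FactGroup_def' set_add_def')
qed

lemma gr_piece_comm_group: "comm_group (gr_piece U F n)"
proof (rule comm_groupI)
  note s = gr_piece_simps
  let ?P = "gr_piece U F n"
  have ex: "\<exists>x. x \<in> F n \<and> A = pre n +> x" if "A \<in> carrier ?P" for A using that unfolding s(1) by blast
  have cl: "pre n +> x \<in> carrier ?P" if "x \<in> F n" for x using that unfolding s(1) by blast
  show "\<one>\<^bsub>?P\<^esub> \<in> carrier ?P" using cl[of \<zero>] F_closed(1) by (simp add: s(2) coset_zero)
  fix A B C assume "A \<in> carrier ?P"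
  then obtain x where x: "x \<in> F n" "A = pre n +> x" "x \<in> carrier U" using ex F_carrier by blast
  show "\<one>\<^bsub>?P\<^esub> \<otimes>\<^bsub>?P\<^esub> A = A"
    using coset_add[of \<zero> x n] x by (simp add: s(2,3) coset_zero)
  have "(pre n +> (\<ominus> x)) \<otimes>\<^bsub>?P\<^esub> A = \<one>\<^bsub>?P\<^esub>"
    using coset_add[of "\<ominus> x" x n] x by (simp add: s(2,3) coset_zero l_neg)
  then show "\<exists>B\<in>carrier ?P. B \<otimes>\<^bsub>?P\<^esub> A = \<one>\<^bsub>?P\<^esub>"
    using cl[of "\<ominus> x"] x(1) F_closed(3) by blast
  assume "B \<in> carrier ?P"
  then obtain y where y: "y \<in> F n" "B = pre n +> y" "y \<in> carrier U" using ex F_carrier by blast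
  show "A \<otimes>\<^bsub>?P\<^esub> B \<in> carrier ?P"
    using coset_add[of x y n] x y cl[of "x \<oplus> y"] F_closed(2) by (simp add: s(3))
  show "A \<otimes>\<^bsub>?P\<^esub> B = B \<otimes>\<^bsub>?P\<^esub> A"
    using x y by (simp add: s(3) coset_add a_comm)
  assume "C \<in> carrier ?P"
  then obtain z where z: "z \<in> F n" "C = pre n +> z" "z \<in> carrier U" using ex F_carrier by blast
  show "A \<otimes>\<^bsub>?P\<^esub> B \<otimes>\<^bsub>?P\<^esub> C = A \<otimes>\<^bsub>?P\<^esub> (B \<otimes>\<^bsub>?P\<^esub> C)"
    using x y z by (simp add: s(3) coset_add a_assoc)
qed

lemma gr_carrier:
  "x \<in> carrier G \<longleftrightarrow> (\<forall>n. \<exists>a\<in>F n. x n = pre n +> a) \<and> finite {n. x n \<noteq> pre n}"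
proof -
  have "carrier G = {x \<in> \<Pi>\<^sub>E i\<in>UNIV. carrier (gr_piece U F i). finite {i \<in> UNIV. x i \<noteq> \<one>\<^bsub>gr_piece U F i\<^esub>}}"
    using carrier_sum_group[of UNIV "gr_piece U F"] gr_piece_comm_group
    by (simp add: gr_def comm_group_def)
  then show ?thesis by (simp add: gr_piece_simps Bex_def PiE_iff) blast
qed

lemma gr_simps:
  "\<zero>\<^bsub>G\<^esub> = (\<lambda>n. pre n)"
  "(x \<oplus>\<^bsub>G\<^esub> y) n = x n <+> y n"
  "\<one>\<^bsub>G\<^esub> = (\<lambda>n. if n = 0 then pre 0 +> \<one> else pre n)"
  "(x \<otimes>\<^bsub>G\<^esub> y) n = finprod (gr_piece U F n) (\<lambda>i. rcoset_mult U (pre n) (x i) (y (n - i))) {..n}"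
  by (simp_all add: gr_def gr_piece_simps restrict_def)

text \<open>The class of \<open>x\<close> in a prescribed degree, which need not be the exact degree
  of \<open>x\<close>: for \<open>x\<close> in \<open>pre d\<close> the result is zero, in contrast
  to \<open>gr_symbol\<close>. Coordinates of chains come only with an upper bound on their
  degree.\<close>

definition homog :: "nat \<Rightarrow> 'a \<Rightarrow> nat \<Rightarrow> 'a set"
  where "homog d x n = (if n = d then pre n +> x else pre n)"

lemma homog_carrier: "x \<in> F d \<Longrightarrow> homog d x \<in> carrier G"
proof -
  assume "x \<in> F d"
  then have "\<exists>a\<in>F n. homog d x n = pre n +> a" for n
    using F_closed(1) coset_zero by (auto simp: homog_def)
  moreover have "{n. homog d x n \<noteq> pre n} \<subseteq> {d}" by (auto simp: homog_def)
  ultimately show ?thesis using finite_subset[of _ "{d}"] by (simp add: gr_carrier)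
qed

lemma homog_zero: "homog d \<zero> = \<zero>\<^bsub>G\<^esub>"
  by (rule ext) (simp add: homog_def coset_zero gr_simps(1))

text \<open>Only the term with index \<open>n - e\<close> of the convolution survives. The
  differential multiplies by homogeneous elements from the right, so its products have this
  shape.\<close>

lemma gr_mult_homog:
  assumes x: "x \<in> carrier G" and y: "y \<in> F e"
  shows "e \<le> n \<Longrightarrow> a \<in> F (n - e) \<Longrightarrow> x (n - e) = pre (n - e) +> a \<Longrightarrow> (x \<otimes>\<^bsub>G\<^esub> homog e y) n = pre n +> (a \<otimes> y)"
    and "\<not> e \<le> n \<Longrightarrow> (x \<otimes>\<^bsub>G\<^esub> homog e y) n = pre n"
proof -
  interpret P: comm_group "gr_piece U F n" by (rule gr_piece_comm_group)
  have 0: "rcoset_mult U (pre n) (x i) (homog e y (n - i)) = pre n" if "i \<le> n" "n - i \<noteq> e" for i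
  proof -
    obtain b where b: "b \<in> F i" "x i = pre i +> b" using x gr_carrier by blast
    have "rcoset_mult U (pre (i + (n - i))) (pre i +> b) (pre (n - i) +> \<zero>) = pre (i + (n - i)) +> (b \<otimes> \<zero>)"
      using b F_closed(1) by (intro coset_mult) auto
    then show ?thesis using b that F_carrier by (simp add: homog_def coset_zero)
  qed
  have prod: "(x \<otimes>\<^bsub>G\<^esub> homog e y) n = finprod (gr_piece U F n)
      (\<lambda>i. rcoset_mult U (pre n) (x i) (homog e y (n - i))) {..n}"
    by (rule gr_simps)
  show "(x \<otimes>\<^bsub>G\<^esub> homog e y) n = pre n" if "\<not> e \<le> n"
  proof -
    have "(x \<otimes>\<^bsub>G\<^esub> homog e y) n = finprod (gr_piece U F n) (\<lambda>i. \<one>\<^bsub>gr_piece U F n\<^esub>) {..n}"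
      unfolding prod using 0 that P.one_closed[unfolded gr_piece_simps(2)]
      by (intro P.finprod_cong') (auto simp: gr_piece_simps(2))
    also have "\<dots> = \<one>\<^bsub>gr_piece U F n\<^esub>" by simp
    finally show ?thesis by (simp add: gr_piece_simps(2))
  qed
  show "(x \<otimes>\<^bsub>G\<^esub> homog e y) n = pre n +> (a \<otimes> y)"
    if e: "e \<le> n" and a: "a \<in> F (n - e)" "x (n - e) = pre (n - e) +> a"
  proof -
    have "rcoset_mult U (pre ((n - e) + e)) (pre (n - e) +> a) (pre e +> y) = pre ((n - e) + e) +> (a \<otimes> y)"
      using a y by (intro coset_mult) auto
    then have *: "rcoset_mult U (pre n) (x (n - e)) (homog e y e) = pre n +> (a \<otimes> y)"
      using e a by (simp add: homog_def)
    have ay: "pre n +> (a \<otimes> y) \<in> carrier (gr_piece U F n)"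
      using F_mult[OF a(1) y] e by (auto simp: gr_piece_simps(1))
    have "(x \<otimes>\<^bsub>G\<^esub> homog e y) n = finprod (gr_piece U F n)
      (\<lambda>i. if n - e = i then pre n +> (a \<otimes> y) else \<one>\<^bsub>gr_piece U F n\<^esub>) {..n}"
      unfolding prod using 0 e * ay P.one_closed[unfolded gr_piece_simps(2)] by (intro P.finprod_cong') (auto simp: gr_piece_simps(2) split: if_splits)
    also have "\<dots> = pre n +> (a \<otimes> y)"
      using P.finprod_singleton[of "n - e" "{..n}" "\<lambda>_. pre n +> (a \<otimes> y)"] ay by auto
    finally show ?thesis .
  qed
qed

text \<open>
  The chain \<open>W\<close> over \<open>U\<close> has filtration degree \<open>d\<close>, and its symbol is the component of total degree
  \<open>d\<close> of the chain \<open>w\<close> over the associated graded algebra.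
\<close>

definition chain_lift :: "nat list \<Rightarrow> nat \<Rightarrow> (bool list \<Rightarrow> nat \<Rightarrow> 'a set) \<Rightarrow> (bool list \<Rightarrow> 'a) \<Rightarrow> bool"
  where "chain_lift es d w W \<longleftrightarrow> (\<forall>l. length l = length es \<longrightarrow>
    (if koszul_weight es l \<le> d then W l \<in> F (d - koszul_weight es l) \<and>
        w l (d - koszul_weight es l) = pre (d - koszul_weight es l) +> W l
     else W l = \<zero>))"

text \<open>Both differentials follow the same recursion. An index starting with \<open>True\<close>
  carries the additional weight \<open>e\<close>, so that half of the chain is lifted in total
  degree \<open>d - e\<close>; multiplication by \<open>g\<close>, which lies in \<open>F e\<close>,
  restores the missing degree.\<close>

lemma koszul_d_lift:
  assumes "ring G" "list_all2 (\<lambda>g e. g \<in> F e) gs es" "\<And>l. w l \<in> carrier G" "chain_lift es d w W"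
  shows "chain_lift es d (koszul_d G (map2 homog es gs) w) (koszul_d U gs W)"
  using assms(2-)
proof (induction gs es arbitrary: d w W rule: list_all2_induct)
  case Nil
  then show ?case using F_closed(1) by (auto simp: chain_lift_def gr_simps coset_zero)
next
  case (Cons g gs e es)
  interpret G: ring G by fact
  let ?hs = "map2 homog es gs"
  let ?w0 = "\<lambda>k. w (False # k)" and ?w1 = "\<lambda>k. w (True # k)"
  let ?W0 = "\<lambda>k. W (False # k)" and ?W1 = "\<lambda>k. W (True # k)"
  have gU: "set gs \<subseteq> carrier U" "g \<in> carrier U"
    using Cons.hyps F_carrier by (auto simp: list_all2_conv_all_nth set_conv_nth)
  have len: "length gs = length es" using Cons.hyps by (simp add: list_all2_lengthD)
  have hG: "set ?hs \<subseteq> carrier G"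
    using Cons.hyps homog_carrier by (auto simp: list_all2_conv_all_nth set_zip)
  have L1: "W l \<in> F (d - koszul_weight (e # es) l) \<and>
        w l (d - koszul_weight (e # es) l) = pre (d - koszul_weight (e # es) l) +> W l"
    if "length l = Suc (length es)" "koszul_weight (e # es) l \<le> d" for l
    using Cons.prems(2) that unfolding chain_lift_def by simp
  have L2: "W l = \<zero>" if "length l = Suc (length es)" "\<not> koszul_weight (e # es) l \<le> d" for l
    using Cons.prems(2) that unfolding chain_lift_def by simp
  have cl0: "chain_lift es d ?w0 ?W0"
    unfolding chain_lift_def
  proof (intro allI impI)
    fix k :: "bool list" assume k: "length k = length es"
    show "if koszul_weight es k \<le> d then ?W0 k \<in> F (d - koszul_weight es k) \<and>
        ?w0 k (d - koszul_weight es k) = pre (d - koszul_weight es k) +> ?W0 k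
     else ?W0 k = \<zero>"
      using L1[of "False # k"] L2[of "False # k"] k by simp
  qed
  have IH0: "chain_lift es d (koszul_d G ?hs ?w0) (koszul_d U gs ?W0)"
    by (rule Cons.IH[OF Cons.prems(1) cl0])
  \<comment> \<open>For \<open>e > d\<close> the difference is truncated and no longer a meaningful
    total degree; the coordinates of \<open>W\<close> concerned are then zero and are handled
    separately.\<close>
  have IH1: "chain_lift es (d - e) (koszul_d G ?hs ?w1) (koszul_d U gs ?W1)" if ed: "e \<le> d"
  proof -
    have cl1: "chain_lift es (d - e) ?w1 ?W1"
      unfolding chain_lift_def
    proof (intro allI impI)
      fix k :: "bool list" assume "length k = length es"
      moreover have "e + koszul_weight es k \<le> d \<longleftrightarrow> koszul_weight es k \<le> d - e" using ed by auto
      ultimately show "if koszul_weight es k \<le> d - e then ?W1 k \<in> F (d - e - koszul_weight es k) \<and>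
          ?w1 k (d - e - koszul_weight es k) = pre (d - e - koszul_weight es k) +> ?W1 k
       else ?W1 k = \<zero>"
        using L1[of "True # k"] L2[of "True # k"] by simp
    qed
    show ?thesis by (rule Cons.IH[OF Cons.prems(1) cl1])
  qed
  show ?case
    unfolding chain_lift_def
  proof (intro allI impI)
    fix l :: "bool list" assume "length l = length (e # es)"
    then obtain b k where l: "l = b # k" and k: "length k = length es" by (cases l) auto
    show "if koszul_weight (e # es) l \<le> d
      then koszul_d U (g # gs) W l \<in> F (d - koszul_weight (e # es) l) \<and>
        koszul_d G (map2 homog (e # es) (g # gs)) w l (d - koszul_weight (e # es) l)
          = pre (d - koszul_weight (e # es) l) +> koszul_d U (g # gs) W l
      else koszul_d U (g # gs) W l = \<zero>"
    proof (cases b)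
      case False
      define n where "n = d - koszul_weight es k"
      let ?D0 = "koszul_d U gs ?W0 k"
      show ?thesis
      proof (cases "koszul_weight es k \<le> d")
        case le: True
        have D0: "?D0 \<in> F n" "koszul_d G ?hs ?w0 k n = pre n +> ?D0"
          using IH0 k le unfolding chain_lift_def n_def by auto
        have 1: "W (True # k) \<otimes> g \<in> F n \<and> (w (True # k) \<otimes>\<^bsub>G\<^esub> homog e g) n = pre n +> (W (True # k) \<otimes> g)"
        proof (cases "e \<le> n")
          case True
          then have "W (True # k) \<in> F (n - e)" "w (True # k) (n - e) = pre (n - e) +> W (True # k)"
            using L1[of "True # k"] L2[of "True # k"] k le by (auto simp: n_def add.commute)
          then show ?thesis
            using gr_mult_homog(1)[OF Cons.prems(1) Cons.hyps(1) True] F_mult[of "W (True # k)" "n - e" g e] Cons.hyps(1) True by simp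
        next
          case False
          then have "W (True # k) = \<zero>" using L1[of "True # k"] L2[of "True # k"] k le by (auto simp: n_def)
          then show ?thesis
            using gr_mult_homog(2)[OF Cons.prems(1) Cons.hyps(1) False] gU F_closed(1) by (simp add: coset_zero)
        qed
        have "koszul_d U (g # gs) W l = ?D0 \<oplus> W (True # k) \<otimes> g" using l False by simp
        moreover have "koszul_d G (map2 homog (e # es) (g # gs)) w l n = pre n +> (?D0 \<oplus> W (True # k) \<otimes> g)"
          using l False D0 1 coset_add[of ?D0 "W (True # k) \<otimes> g" n] F_carrier by (auto simp: gr_simps(2))
        moreover have "koszul_weight (e # es) l = koszul_weight es k" using l False by simp
        ultimately show ?thesis using D0(1) 1 F_closed(2) le by (simp add: n_def)
      next
        case gt: False
        then have "W (True # k) = \<zero>" "?D0 = \<zero>"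
          using L1[of "True # k"] L2[of "True # k"] k IH0 unfolding chain_lift_def by auto
        then show ?thesis using l False gt gU by simp
      qed
    next
      case True
      let ?D1 = "koszul_d U gs ?W1 k"
      define n where "n = d - (e + koszul_weight es k)"
      have kd: "koszul_d U (g # gs) W l = \<ominus> ?D1" "koszul_weight (e # es) l = e + koszul_weight es k"
        "koszul_d G (map2 homog (e # es) (g # gs)) w l = \<ominus>\<^bsub>G\<^esub> koszul_d G ?hs ?w1 k"
        using l True by simp_all
      show ?thesis
      proof (cases "e + koszul_weight es k \<le> d")
        case le: True
        then have "d - e - koszul_weight es k = n" "e \<le> d" "koszul_weight es k \<le> d - e" by (auto simp: n_def)
        then have D1: "?D1 \<in> F n" "koszul_d G ?hs ?w1 k n = pre n +> ?D1"
          using IH1 k unfolding chain_lift_def by auto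
        let ?y = "koszul_d G ?hs ?w1 k"
        have y: "?y \<in> carrier G" using G.koszul_d_closed[OF hG] Cons.prems(1) by simp
        then have "\<ominus>\<^bsub>G\<^esub> ?y \<in> carrier G" by simp
        \<comment> \<open>Negation in the associated graded ring is not given coordinatewise, so a
          representative \<open>c\<close> of the negative is compared with \<open>?D1\<close>
          through the vanishing sum.\<close>
        then obtain c where c: "c \<in> F n" "(\<ominus>\<^bsub>G\<^esub> ?y) n = pre n +> c" unfolding gr_carrier by blast
        have "pre n +> (?D1 \<oplus> c) = (?y \<oplus>\<^bsub>G\<^esub> (\<ominus>\<^bsub>G\<^esub> ?y)) n"
          using D1 c F_carrier coset_add[of ?D1 c n] by (simp add: gr_simps(2))
        also have "\<dots> = pre n" using y by (simp add: G.r_neg gr_simps(1))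
        finally have "?D1 \<oplus> c \<in> pre n" using coset_eq_pre D1 c F_carrier by (metis a_closed)
        then have "c \<ominus> (\<ominus> ?D1) \<in> pre n"
          using D1 c F_carrier by (simp add: a_minus_def a_comm)
        then have "(\<ominus>\<^bsub>G\<^esub> ?y) n = pre n +> (\<ominus> ?D1)"
          using c D1 F_carrier by (subst c(2), subst coset_eq_iff) auto
        then show ?thesis using kd le D1 F_closed(3) by (simp add: n_def)
      next
        case gt: False
        have "?D1 = \<zero>"
        proof (cases "e \<le> d")
          case True
          then have "\<not> koszul_weight es k \<le> d - e" using gt by auto
          then show ?thesis using IH1[OF True] k unfolding chain_lift_def by auto
        next
          case False
          have "W (True # j) = \<zero>" if "length j = length gs" for j
            using L1[of "True # j"] L2[of "True # j"] that False len by auto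
          then show ?thesis using k len gU by (intro koszul_d_zero) auto
        qed
        then show ?thesis using kd gt by simp
      qed
    qed
  qed
qed

text \<open>
  The symbol of \<open>u\<close> is a cycle, hence a boundary; subtracting a lift of it from \<open>u\<close> lowers \<open>d\<close>. For
  \<open>d = 0\<close> the symbol would show that \<open>1\<close> lies in the ideal of the symbols.
\<close>

lemma koszul_descent:
  fixes gs :: "'a list" and es :: "nat list"
  defines "hs \<equiv> map2 homog es gs" and "t \<equiv> length gs"
  assumes G: "cring G" and lift: "list_all2 (\<lambda>g e. g \<in> F e) gs es"
    and comm: "\<And>g h. g \<in> set gs \<Longrightarrow> h \<in> set gs \<Longrightarrow> g \<otimes> h = h \<otimes> g"
    and proper: "Idl\<^bsub>G\<^esub> (set hs) \<noteq> carrier G"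
    and xs: "set xs \<subseteq> Idl\<^bsub>G\<^esub> (set hs)" "length xs = t" "regular_sequence G xs"
    and u: "\<And>l. u l \<in> carrier U"
      "\<And>l. length l = t \<Longrightarrow> True \<notin> set l \<Longrightarrow> u l = \<zero>"
      "\<And>l. length l = t \<Longrightarrow> koszul_weight es l \<le> d \<Longrightarrow> u l \<in> F (d - koszul_weight es l)"
      "\<And>l. length l = t \<Longrightarrow> \<not> koszul_weight es l \<le> d \<Longrightarrow> u l = \<zero>"
    and du: "\<And>l. length l = t \<Longrightarrow> koszul_d U gs u l = (if True \<in> set l then \<zero> else \<one>)"
  shows False
  using u du
proof (induction d arbitrary: u rule: less_induct)
  case (less d)
  interpret G: cring G by fact
  let ?wt = "koszul_weight es"
  have len: "length es = t" using lift by (simp add: t_def list_all2_lengthD)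
  have lenhs: "length hs = t" using len by (simp add: hs_def t_def)
  have gU: "set gs \<subseteq> carrier U"
    using lift F_carrier by (auto simp: list_all2_conv_all_nth set_conv_nth)
  have hG: "set hs \<subseteq> carrier G"
    using lift homog_carrier by (auto simp: list_all2_conv_all_nth set_zip hs_def)
  have one: "\<one> \<in> F n" for n using F_one F_le[of 0 n] by auto
  \<comment> \<open>Each coordinate of \<open>u\<close> is taken in the degree complementary to its
    weight, so \<open>z\<close> is homogeneous of total degree \<open>d\<close>.\<close>
  define z where "z l = (if length l = t \<and> ?wt l \<le> d then homog (d - ?wt l) (u l) else \<zero>\<^bsub>G\<^esub>)" for l
  have zG: "z l \<in> carrier G" for l
    using less.prems(3) homog_carrier by (auto simp: z_def)
  \<comment> \<open>In total degrees other than \<open>d\<close> the chain \<open>z\<close> has no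
    component and is lifted by zero. A lift in every total degree determines the differential of
    \<open>z\<close> completely.\<close>
  have zlift: "chain_lift es d' z (if d' = d then u else (\<lambda>_. \<zero>))" for d'
    unfolding chain_lift_def
  proof (intro allI impI)
    fix l :: "bool list" assume l: "length l = length es"
    have "z l (d' - ?wt l) = pre (d' - ?wt l)" if "?wt l \<le> d'" "d' \<noteq> d"
      using that by (auto simp: z_def homog_def gr_simps(1))
    moreover have "z l (d - ?wt l) = pre (d - ?wt l) +> u l" if "?wt l \<le> d"
      using that l len by (simp add: z_def homog_def)
    ultimately show "if ?wt l \<le> d' then (if d' = d then u else (\<lambda>_. \<zero>)) l \<in> F (d' - ?wt l) \<and>
        z l (d' - ?wt l) = pre (d' - ?wt l) +> (if d' = d then u else (\<lambda>_. \<zero>)) l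
      else (if d' = d then u else (\<lambda>_. \<zero>)) l = \<zero>"
      using less.prems(3,4) l len F_closed(1) by (auto simp: coset_zero)
  qed
  have dz: "koszul_d G hs z l n = (if n + ?wt l = d then pre n +> koszul_d U gs u l else pre n)"
    if l: "length l = t" for l n
  proof -
    have "chain_lift es (n + ?wt l) (koszul_d G hs z) (koszul_d U gs (if n + ?wt l = d then u else (\<lambda>_. \<zero>)))"
      unfolding hs_def using koszul_d_lift[OF G.ring_axioms lift zG zlift] .
    then have "koszul_d G hs z l n = pre n +> koszul_d U gs (if n + ?wt l = d then u else (\<lambda>_. \<zero>)) l"
      using l len unfolding chain_lift_def by auto
    moreover have "koszul_d U gs (\<lambda>_. \<zero>) l = \<zero>" using gU l by (intro koszul_d_zero) (auto simp: t_def)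
    ultimately show ?thesis by (simp add: coset_zero split: if_splits)
  qed
  show False
  proof (cases d)
    case 0
    define l where "l = replicate t False"
    have l: "length l = t" "True \<notin> set l" by (auto simp: l_def)
    have "koszul_d G hs z l n = \<one>\<^bsub>G\<^esub> n" for n
      using dz[OF l(1), of n] koszul_weight_zero[OF l(2), of es] less.prems(5)[OF l(1)] l(2) 0
      by (simp add: gr_simps(3))
    then have "koszul_d G hs z l = \<one>\<^bsub>G\<^esub>" by (rule ext)
    moreover have "ideal (Idl\<^bsub>G\<^esub> (set hs)) G" using G.genideal_ideal[OF hG] .
    moreover have "set hs \<subseteq> Idl\<^bsub>G\<^esub> (set hs)" using G.genideal_self[OF hG] .
    ultimately have "\<one>\<^bsub>G\<^esub> \<in> Idl\<^bsub>G\<^esub> (set hs)"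
      using G.koszul_d_gen_ideal[of "Idl\<^bsub>G\<^esub> (set hs)" hs z l] zG by simp
    then show False
      using ideal.one_imp_carrier[OF G.genideal_ideal[OF hG]] proper by blast
  next
    case (Suc d')
    have cyc: "koszul_d G hs z l = \<zero>\<^bsub>G\<^esub>" if l: "length l = t" for l
    proof
      fix n
      have "pre n +> koszul_d U gs u l = pre n" if n: "n + ?wt l = d"
      proof (cases "True \<in> set l")
        case True
        then show ?thesis using less.prems(5)[OF l] by (simp add: coset_zero)
      next
        case False
        \<comment> \<open>In positive degree the constant \<open>\<one>\<close> lies in the
          preceding filtration step and leaves no trace in the symbol.\<close>
        then have "n = Suc d'" using n Suc koszul_weight_zero[of l es] by simp
        then have "\<one> \<in> pre n" using one by (simp add: filt_pred_def)
        then show ?thesis using less.prems(5)[OF l] False coset_eq_pre[of \<one> n] by simp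
      qed
      then show "koszul_d G hs z l n = \<zero>\<^bsub>G\<^esub> n"
        using dz[OF l, of n] by (simp add: gr_simps(1))
    qed
    have supp: "z l = \<zero>\<^bsub>G\<^esub>" if l: "length l = t" "count_list l True = 0" for l
      using less.prems(2)[OF l(1)] l(2) by (auto simp: z_def homog_zero count_list_0_iff)
    have "\<exists>w. (\<forall>l. w l \<in> carrier G) \<and> (\<forall>l. length l = t \<longrightarrow> count_list l True \<le> 1 \<longrightarrow> w l = \<zero>\<^bsub>G\<^esub>)
      \<and> (\<forall>l. length l = t \<longrightarrow> z l = koszul_d G hs w l)"
      by (rule G.koszul_acyclic[OF hG xs(1) _ xs(3) zG, unfolded lenhs, OF xs(2) supp cyc]) blast+
    then obtain w where w: "\<And>l. w l \<in> carrier G"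
      "\<And>l. length l = t \<Longrightarrow> count_list l True \<le> 1 \<Longrightarrow> w l = \<zero>\<^bsub>G\<^esub>"
      "\<And>l. length l = t \<Longrightarrow> z l = koszul_d G hs w l"
      by blast
    have "\<exists>a. a \<in> F n \<and> w l n = pre n +> a" for l n using w(1)[of l] unfolding gr_carrier by blast
    moreover define r where "r l n = (SOME a. a \<in> F n \<and> w l n = pre n +> a)" for l n
    ultimately have r: "r l n \<in> F n" "w l n = pre n +> r l n" for l n
      using someI_ex[of "\<lambda>a. a \<in> F n \<and> w l n = pre n +> a"] by simp_all
    \<comment> \<open>Where \<open>w\<close> is known to vanish, exact zeros are chosen instead of
      arbitrary elements of \<open>pre\<close>: the support of \<open>W\<close> must start in
      exterior degree 2, so that \<open>u'\<close> acquires no coordinate in degree 0.\<close>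
    define W where "W l = (if length l = t \<and> ?wt l \<le> d \<and> \<not> count_list l True \<le> 1 then r l (d - ?wt l) else \<zero>)" for l
    have WU: "W l \<in> carrier U" for l using r(1) F_carrier by (auto simp: W_def)
    have W1: "W l = \<zero>" if "count_list l True \<le> 1" for l using that by (simp add: W_def)
    have cw: "chain_lift es d w W"
      unfolding chain_lift_def
    proof (intro allI impI)
      fix l :: "bool list" assume "length l = length es"
      then show "if ?wt l \<le> d then W l \<in> F (d - ?wt l) \<and> w l (d - ?wt l) = pre (d - ?wt l) +> W l else W l = \<zero>"
        using r(1)[of l "d - ?wt l"] r(2)[of l "d - ?wt l"] w(2)[of l] F_closed(1) len
        by (auto simp: W_def gr_simps(1) coset_zero)
    qed
    have DW: "chain_lift es d (koszul_d G hs w) (koszul_d U gs W)"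
      unfolding hs_def by (rule koszul_d_lift[OF G.ring_axioms lift _ cw]) (rule w(1))
    have DWU: "koszul_d U gs W l \<in> carrier U" for l using koszul_d_closed[OF gU WU] .
    define u' where "u' l = u l \<ominus> koszul_d U gs W l" for l
    \<comment> \<open>\<open>u\<close> and the boundary of \<open>W\<close> have the same class in
      degree \<open>d - ?wt l\<close>, so their difference drops by one filtration step.\<close>
    have key: "u' l \<in> pre (d - ?wt l)" if l: "length l = t" "?wt l \<le> d" for l
    proof -
      have "koszul_d G hs w l (d - ?wt l) = pre (d - ?wt l) +> u l"
      proof -
        have "z l (d - ?wt l) = pre (d - ?wt l) +> u l" using l by (simp add: z_def homog_def)
        then show ?thesis by (simp only: w(3)[OF l(1)])
      qed
      moreover have "koszul_d G hs w l (d - ?wt l) = pre (d - ?wt l) +> koszul_d U gs W l"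
        using DW l len unfolding chain_lift_def by auto
      ultimately have "pre (d - ?wt l) +> u l = pre (d - ?wt l) +> koszul_d U gs W l" by simp
      then show ?thesis unfolding u'_def using coset_eq_iff[OF less.prems(1) DWU] by blast
    qed
    show False
    proof (rule less.IH[of d' u'])
      show "d' < d" using Suc by simp
      show "u' l \<in> carrier U" for l using less.prems(1) DWU by (simp add: u'_def)
      show "u' l = \<zero>" if l: "length l = t" "True \<notin> set l" for l
      proof -
        have "koszul_d U gs W l = \<zero>"
          using gU l W1 by (intro koszul_d_supp[where m = 0]) (auto simp: t_def count_list_0_iff)
        then show ?thesis using less.prems(2)[OF l] by (simp add: u'_def a_minus_def)
      qed
      show "u' l \<in> F (d' - ?wt l)" if l: "length l = t" "?wt l \<le> d'" for l
        using key[of l] l Suc by (simp add: Suc_diff_le filt_pred_def)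
      show "u' l = \<zero>" if l: "length l = t" "\<not> ?wt l \<le> d'" for l
      proof (cases "?wt l \<le> d")
        case True
        \<comment> \<open>The weight is exactly \<open>d\<close> here, and as \<open>pre 0\<close>
          is zero the drop in filtration is already vanishing.\<close>
        then have "d - ?wt l = 0" using l Suc by simp
        then show ?thesis using key[OF l(1) True] by (simp add: filt_pred_def)
      next
        case False
        then have "koszul_d U gs W l = \<zero>" using DW l len unfolding chain_lift_def by auto
        then show ?thesis using less.prems(4)[OF l(1) False] by (simp add: u'_def a_minus_def)
      qed
      show "koszul_d U gs u' l = (if True \<in> set l then \<zero> else \<one>)" if l: "length l = t" for l
      proof -
        have "koszul_d U gs u' l = koszul_d U gs u l \<ominus> koszul_d U gs (koszul_d U gs W) l"
          unfolding u'_def by (rule koszul_d_diff[OF gU less.prems(1) DWU])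
        also have "koszul_d U gs (koszul_d U gs W) l = \<zero>"
          by (rule koszul_d_squared[OF gU WU comm])
        finally show ?thesis using less.prems(5)[OF l] by (simp add: a_minus_def)
      qed
    qed
  qed
qed

text \<open>A representation of \<open>\<one>\<close> becomes a chain by \<open>unit_chain\<close>,
  and any common bound for its finitely many coordinates starts the descent.\<close>

lemma one_notin_lin_comb:
  fixes gs :: "'a list" and es :: "nat list"
  defines "hs \<equiv> map2 homog es gs"
  assumes G: "cring G" and lift: "list_all2 (\<lambda>g e. g \<in> F e) gs es"
    and comm: "\<And>g h. g \<in> set gs \<Longrightarrow> h \<in> set gs \<Longrightarrow> g \<otimes> h = h \<otimes> g"
    and proper: "Idl\<^bsub>G\<^esub> (set hs) \<noteq> carrier G"
    and xs: "set xs \<subseteq> Idl\<^bsub>G\<^esub> (set hs)" "length xs = length gs" "regular_sequence G xs"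
    and us: "set us \<subseteq> carrier U" "length us = length gs"
  shows "lin_comb U us gs \<noteq> \<one>"
proof
  assume 1: "lin_comb U us gs = \<one>"
  let ?t = "length gs" and ?u = "unit_chain U us"
  have gU: "set gs \<subseteq> carrier U"
    using lift F_carrier by (auto simp: list_all2_conv_all_nth set_conv_nth)
  have "\<exists>j. ?u l \<in> F j" for l using unit_chain(1)[OF us(1)] F_exhaustive by auto
  then obtain j where j: "\<And>l. ?u l \<in> F (j l)" by metis
  let ?L = "{l :: bool list. length l = ?t}"
  have "finite {l. set l \<subseteq> (UNIV :: bool set) \<and> length l = ?t}" by (rule finite_lists_length_eq) simp
  then have fin: "finite ?L" by simp
  \<comment> \<open>A crude bound: the sum dominates filtration degree plus weight for each index,
    so no weight exceeds \<open>d\<close>.\<close>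
  define d where "d = (\<Sum>l\<in>?L. j l + koszul_weight es l)"
  have d: "j l + koszul_weight es l \<le> d" if "length l = ?t" for l
    unfolding d_def using fin that member_le_sum[of l ?L "\<lambda>l. j l + koszul_weight es l"] by simp
  show False
  proof (rule koszul_descent[OF G lift comm proper[unfolded hs_def] xs(1)[unfolded hs_def] xs(2,3)])
    show "?u l \<in> carrier U" for l using unit_chain(1)[OF us(1)] .
    show "?u l = \<zero>" if "True \<notin> set l" for l using unit_chain(2)[OF us(1) that] .
    show "?u l \<in> F (d - koszul_weight es l)" if "length l = ?t" for l
    proof -
      have "j l \<le> d - koszul_weight es l" using d[OF that] by simp
      then show ?thesis using j[of l] F_le by blast
    qed
    show "?u l = \<zero>" if "length l = ?t" "\<not> koszul_weight es l \<le> d" for l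
      using d[OF that(1)] that(2) by simp
    show "koszul_d U gs ?u l = (if True \<in> set l then \<zero> else \<one>)" if "length l = ?t" for l
      using koszul_d_unit_chain[OF gU us(1) us(2) that] 1 by simp
  qed
qed

end

section \<open>Characters and symbols\<close>

text \<open>A double centralizer argument: centralizers are subrings, so the generated ring
  centralizes \<open>S\<close>; then \<open>S\<close>, and with it the generated ring, lies in the
  centralizer of the generated ring.\<close>

lemma (in ring) generate_ring_commute:
  assumes S: "S \<subseteq> carrier R" and comm: "\<And>x y. x \<in> S \<Longrightarrow> y \<in> S \<Longrightarrow> x \<otimes> y = y \<otimes> x"
    and "x \<in> generate_ring R S" "y \<in> generate_ring R S"
  shows "x \<otimes> y = y \<otimes> x"
proof -
  have sub: "subring {y \<in> carrier R. \<forall>x\<in>T. x \<otimes> y = y \<otimes> x} R" if T: "T \<subseteq> carrier R" for T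
  proof (rule subringI)
    fix a b assume a: "a \<in> {y \<in> carrier R. \<forall>x\<in>T. x \<otimes> y = y \<otimes> x}" and b: "b \<in> {y \<in> carrier R. \<forall>x\<in>T. x \<otimes> y = y \<otimes> x}"
    have "x \<otimes> (a \<otimes> b) = a \<otimes> b \<otimes> x" if "x \<in> T" for x
    proof -
      have x: "x \<in> carrier R" using T that by auto
      have "x \<otimes> (a \<otimes> b) = (a \<otimes> x) \<otimes> b" using a b x that by (simp flip: m_assoc)
      also have "\<dots> = a \<otimes> b \<otimes> x" using a b x that by (simp add: m_assoc)
      finally show ?thesis .
    qed
    then show "a \<otimes> b \<in> {y \<in> carrier R. \<forall>x\<in>T. x \<otimes> y = y \<otimes> x}" using a b by simp
  qed (use T in \<open>auto simp: l_minus r_minus l_distr r_distr subset_iff\<close>)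
  have "generate_ring R S \<subseteq> {y \<in> carrier R. \<forall>x\<in>S. x \<otimes> y = y \<otimes> x}"
    using S comm by (intro generate_ring_min_subring1[OF S sub[OF S]]) auto
  then have "S \<subseteq> {y \<in> carrier R. \<forall>x\<in>generate_ring R S. x \<otimes> y = y \<otimes> x}"
    using S by fastforce
  then have "generate_ring R S \<subseteq> {y \<in> carrier R. \<forall>x\<in>generate_ring R S. x \<otimes> y = y \<otimes> x}"
    by (rule generate_ring_min_subring1[OF S sub[OF generate_ring_incl[OF S]]])
  then show ?thesis using assms(3,4) by blast
qed

lemma (in ring) left_ideal_lin_comb:
  assumes "set gs \<subseteq> carrier R"
  shows "left_ideal {lin_comb R us gs | us. set us \<subseteq> carrier R \<and> length us = length gs} R"
    "set gs \<subseteq> {lin_comb R us gs | us. set us \<subseteq> carrier R \<and> length us = length gs}"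
proof -
  define J where "J gs = {lin_comb R us gs | us. set us \<subseteq> carrier R \<and> length us = length gs}" for gs
  have J0: "J [] = {\<zero>}" by (auto simp: J_def)
  have JI: "a \<otimes> g \<oplus> s \<in> J (g # gs)" if as: "a \<in> carrier R" "s \<in> J gs" for a g s gs
  proof -
    obtain us where "set us \<subseteq> carrier R" "length us = length gs" "s = lin_comb R us gs"
      using as(2) by (auto simp: J_def)
    then show ?thesis unfolding J_def using as(1) by (intro CollectI exI[of _ "a # us"]) auto
  qed
  have JE: "\<exists>a s. a \<in> carrier R \<and> s \<in> J gs \<and> x = a \<otimes> g \<oplus> s" if x: "x \<in> J (g # gs)" for x g gs
  proof -
    obtain us where us: "set us \<subseteq> carrier R" "length us = Suc (length gs)" "x = lin_comb R us (g # gs)"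
      using x by (auto simp: J_def)
    then show ?thesis by (cases us) (auto simp: J_def)
  qed
  have "left_ideal (J gs) R \<and> set gs \<subseteq> J gs"
    using assms
  proof (induction gs)
    case Nil
    then show ?case by (simp add: J0 left_ideal_def)
  next
    case (Cons g gs)
    then have g: "g \<in> carrier R" and J: "J gs \<subseteq> carrier R" "\<zero> \<in> J gs" "\<And>x y. x \<in> J gs \<Longrightarrow> y \<in> J gs \<Longrightarrow> x \<oplus> y \<in> J gs"
      "\<And>a x. a \<in> carrier R \<Longrightarrow> x \<in> J gs \<Longrightarrow> a \<otimes> x \<in> J gs" and gs: "set gs \<subseteq> J gs" "set gs \<subseteq> carrier R"
      unfolding left_ideal_def by auto
    have "left_ideal (J (g # gs)) R"
      unfolding left_ideal_def
    proof (intro conjI ballI subsetI)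
      fix x assume "x \<in> J (g # gs)"
      then obtain a s where x: "a \<in> carrier R" "s \<in> J gs" "x = a \<otimes> g \<oplus> s" using JE by blast
      then show "x \<in> carrier R" using g J by auto
      {
        fix y assume "y \<in> J (g # gs)"
        then obtain b r where y: "b \<in> carrier R" "r \<in> J gs" "y = b \<otimes> g \<oplus> r" using JE by blast
        have c: "s \<in> carrier R" "r \<in> carrier R" using x y J by auto
        have "x \<oplus> y = (a \<oplus> b) \<otimes> g \<oplus> (s \<oplus> r)" using x y c g by (simp add: l_distr a_ac)
        then show "x \<oplus> y \<in> J (g # gs)" using JI[of "a \<oplus> b" "s \<oplus> r" gs g] x y J by simp
      next
        fix b assume b: "b \<in> carrier R"
        have c: "s \<in> carrier R" using x J by auto
        have "b \<otimes> x = (b \<otimes> a) \<otimes> g \<oplus> b \<otimes> s" using x b c g by (simp add: r_distr m_assoc)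
        then show "b \<otimes> x \<in> J (g # gs)" using JI[of "b \<otimes> a" "b \<otimes> s" gs g] x b J by simp
      }
    next
      show "\<zero> \<in> J (g # gs)" using JI[of \<zero> \<zero> gs g] g J(2) by simp
    qed
    moreover have "g \<in> J (g # gs)" using JI[of \<one> \<zero> gs g] g J(2) by simp
    moreover have "x \<in> J (g # gs)" if "x \<in> set gs" for x
    proof -
      have "x \<in> J gs" "x \<in> carrier R" using that gs by auto
      then show ?thesis using JI[of \<zero> x gs g] g by simp
    qed
    ultimately show ?case by auto
  qed
  then show "left_ideal {lin_comb R us gs | us. set us \<subseteq> carrier R \<and> length us = length gs} R"
    "set gs \<subseteq> {lin_comb R us gs | us. set us \<subseteq> carrier R \<and> length us = length gs}"
    by (simp_all add: J_def)
qed

section \<open>Scalars and maximal ideals of the subalgebra generated by commuting elements\<close>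

context assoc_algebra
begin

abbreviation scalar :: "'a \<Rightarrow> 'c" where "scalar c \<equiv> c \<odot>\<^bsub>U\<^esub> \<one>\<^bsub>U\<^esub>"

lemma scalar_ring_hom: "scalar \<in> ring_hom K U"
proof (rule ring_hom_memI)
  fix c d assume c: "c \<in> carrier K" "d \<in> carrier K"
  show "scalar (c \<otimes>\<^bsub>K\<^esub> d) = scalar c \<otimes>\<^bsub>U\<^esub> scalar d"
    using c by (simp add: smult_mult_left smult_assoc1)
  show "scalar (c \<oplus>\<^bsub>K\<^esub> d) = scalar c \<oplus>\<^bsub>U\<^esub> scalar d"
    using c by (simp add: smult_l_distr)
qed simp_all

lemma scalar_commute: "c \<in> carrier K \<Longrightarrow> x \<in> carrier U \<Longrightarrow> scalar c \<otimes>\<^bsub>U\<^esub> x = x \<otimes>\<^bsub>U\<^esub> scalar c"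
  by (simp add: smult_mult_left smult_mult_right)

context
  fixes S and \<mu> :: "'c set" and \<Gamma> :: "('a, 'c, 'd) module_scheme"
  assumes S: "S \<subseteq> carrier U" "\<forall>x\<in>S. \<forall>y\<in>S. x \<otimes>\<^bsub>U\<^esub> y = y \<otimes>\<^bsub>U\<^esub> x"
  defines "\<Gamma> \<equiv> generated_algebra K U S"
begin

lemma gen_simps:
  "carrier \<Gamma> = generate_ring U (scalars K U \<union> S)"
  "x \<otimes>\<^bsub>\<Gamma>\<^esub> y = x \<otimes>\<^bsub>U\<^esub> y" "x \<oplus>\<^bsub>\<Gamma>\<^esub> y = x \<oplus>\<^bsub>U\<^esub> y" "\<one>\<^bsub>\<Gamma>\<^esub> = \<one>\<^bsub>U\<^esub>" "\<zero>\<^bsub>\<Gamma>\<^esub> = \<zero>\<^bsub>U\<^esub>"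
  "c \<odot>\<^bsub>\<Gamma>\<^esub> x = c \<odot>\<^bsub>U\<^esub> x"
  by (simp_all add: \<Gamma>_def generated_algebra_def)

lemma gens_carrier: "scalars K U \<union> S \<subseteq> carrier U"
  using S by (auto simp: scalars_def)

lemma gen_subring: "subring (carrier \<Gamma>) U"
  unfolding gen_simps using U.generate_ring_is_subring[OF gens_carrier] .

lemma gen_mem: "c \<in> carrier K \<Longrightarrow> scalar c \<in> carrier \<Gamma>" "x \<in> S \<Longrightarrow> x \<in> carrier \<Gamma>"
  unfolding gen_simps by (auto intro!: generate_ring.incl simp: scalars_def)

lemma gen_cring: "cring \<Gamma>"
proof -
  have "x \<otimes>\<^bsub>U\<^esub> y = y \<otimes>\<^bsub>U\<^esub> x" if "x \<in> scalars K U \<union> S" "y \<in> scalars K U \<union> S" for x y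
  proof -
    have "x \<in> carrier U" "y \<in> carrier U" using that gens_carrier by auto
    then show ?thesis
      using that(1,2) S(2) scalar_commute[of _ y] scalar_commute[of _ x, symmetric]
      unfolding scalars_def by blast
  qed
  then have "subcring (carrier \<Gamma>) U"
    using U.generate_ring_commute[OF gens_carrier] gen_subring
    by (intro U.subcringI) (auto simp: gen_simps(1))
  moreover have "\<Gamma> = U\<lparr>carrier := carrier \<Gamma>\<rparr>" by (simp add: \<Gamma>_def generated_algebra_def)
  ultimately show ?thesis using U.subcring_iff[OF subringE(1)[OF gen_subring]] by metis
qed

text \<open>An additive inverse is defined by a description over the carrier, so passing to a
  smaller carrier calls for an argument.\<close>

lemma gen_minus:
  assumes "x \<in> carrier \<Gamma>"
  shows "\<ominus>\<^bsub>\<Gamma>\<^esub> x = \<ominus>\<^bsub>U\<^esub> x"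
proof -
  interpret C: cring \<Gamma> by (rule gen_cring)
  have "x \<in> carrier U" "\<ominus>\<^bsub>U\<^esub> x \<in> carrier \<Gamma>"
    using assms subringE(1,5)[OF gen_subring] by auto
  then show ?thesis using assms abelian_group.l_neg[OF ring.is_abelian_group[OF U.ring_axioms], of x] by (intro C.minus_equality) (simp_all add: gen_simps(3,5))
qed

text \<open>The weak Nullstellensatz: the residue field is generated as a ring by the images of
  \<open>K\<close> and of the finite set \<open>S\<close>, so by Zariski's lemma \<open>K\<close>
  maps onto it.\<close>

lemma gen_residue:
  assumes K: "algebraically_closed K" and "finite S" and \<mu>: "maximalideal \<mu> \<Gamma>"
    and x: "x \<in> carrier \<Gamma>"
  shows "\<exists>c\<in>carrier K. x \<ominus>\<^bsub>U\<^esub> scalar c \<in> \<mu>"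
proof -
  interpret C: cring \<Gamma> by (rule gen_cring)
  interpret \<mu>: maximalideal \<mu> \<Gamma> by fact
  let ?L = "\<Gamma> Quot \<mu>" and ?p = "a_r_coset \<Gamma> \<mu>"
  have fL: "field ?L" using \<mu>.quotient_is_field[OF C.is_cring] .
  then interpret L: field ?L .
  have p: "?p \<in> ring_hom \<Gamma> ?L" using \<mu>.rcos_ring_hom .
  interpret p: ring_hom_ring \<Gamma> ?L ?p
    by (intro ring_hom_ringI2 C.ring_axioms L.ring_axioms p)
  define h where "h c = ?p (scalar c)" for c
  have h: "h \<in> ring_hom K ?L"
  proof (rule ring_hom_memI)
    fix c d assume c: "c \<in> carrier K" "d \<in> carrier K"
    show "h c \<in> carrier ?L" using c gen_mem by (simp add: h_def)
    show "h (c \<otimes>\<^bsub>K\<^esub> d) = h c \<otimes>\<^bsub>?L\<^esub> h d"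
      using c gen_mem p.hom_mult[of "scalar c" "scalar d"] ring_hom_mult[OF scalar_ring_hom c] by (simp add: h_def gen_simps)
    show "h (c \<oplus>\<^bsub>K\<^esub> d) = h c \<oplus>\<^bsub>?L\<^esub> h d"
      using c gen_mem p.hom_add[of "scalar c" "scalar d"] ring_hom_add[OF scalar_ring_hom c] by (simp add: h_def gen_simps)
  next
    show "h \<one>\<^bsub>K\<^esub> = \<one>\<^bsub>?L\<^esub>" using p.hom_one by (simp add: h_def gen_simps)
  qed
  have "?p y \<in> generate_ring ?L (h ` carrier K \<union> ?p ` S)" if "y \<in> carrier \<Gamma>" for y
    using that unfolding gen_simps(1)
  proof (induction rule: generate_ring.induct)
    case one
    show ?case using generate_ring.one[of ?L] unfolding p.hom_one[symmetric] gen_simps .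
  next
    case (incl y)
    then have "?p y \<in> h ` carrier K \<union> ?p ` S" unfolding h_def scalars_def by blast
    then show ?case by (rule generate_ring.incl)
  next
    case (a_inv y)
    then have y: "y \<in> carrier \<Gamma>" by (simp add: gen_simps)
    show ?case using generate_ring.a_inv[OF a_inv.IH] unfolding p.hom_a_inv[OF y, symmetric] gen_minus[OF y] .
  next
    case (eng_add y z)
    then have y: "y \<in> carrier \<Gamma>" "z \<in> carrier \<Gamma>" by (simp_all add: gen_simps)
    show ?case using generate_ring.eng_add[OF eng_add.IH] unfolding p.hom_add[OF y, symmetric] gen_simps .
  next
    case (eng_mult y z)
    then have y: "y \<in> carrier \<Gamma>" "z \<in> carrier \<Gamma>" by (simp_all add: gen_simps)
    show ?case using generate_ring.eng_mult[OF eng_mult.IH] unfolding p.hom_mult[OF y, symmetric] gen_simps .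
  qed
  moreover have car: "carrier ?L = ?p ` carrier \<Gamma>"
    unfolding FactRing_def A_RCOSETS_def' image_def by auto
  ultimately have sub: "carrier ?L \<subseteq> generate_ring ?L (h ` carrier K \<union> ?p ` S)"
    by (simp only: car image_subset_iff) blast
  have gL: "h ` carrier K \<subseteq> carrier ?L" "?p ` S \<subseteq> carrier ?L"
    using ring_hom_closed[OF h] p.hom_closed[OF gen_mem(2)] by (simp_all only: image_subset_iff) blast+
  have "generate_ring ?L (h ` carrier K \<union> ?p ` S) = carrier ?L"
    using sub L.generate_ring_incl[OF Un_least[OF gL]] by (rule subset_antisym[rotated])
  then have "h ` carrier K = carrier ?L"
    by (rule zariski_lemma[OF K fL h finite_imageI[OF \<open>finite S\<close>] gL(2)])
  then have "?p x \<in> h ` carrier K" using p.hom_closed[OF x] by simp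
  then obtain c where c: "c \<in> carrier K" "?p x = ?p (scalar c)"
    unfolding h_def by (rule imageE)
  have "x \<in> ?p (scalar c)" using \<mu>.a_rcos_self[OF x] c(2) by simp
  then have "x \<ominus>\<^bsub>\<Gamma>\<^esub> scalar c \<in> \<mu>"
    using \<mu>.a_rcos_module_minus[OF C.ring_axioms gen_mem(1)[OF c(1)] x] by simp
  then have "x \<ominus>\<^bsub>U\<^esub> scalar c \<in> \<mu>"
    unfolding a_minus_def gen_simps gen_minus[OF gen_mem(1)[OF c(1)]] .
  then show ?thesis using c(1) by blast
qed

text \<open>A nonzero scalar is invertible and cannot lie in a proper ideal. This makes character
  values unique.\<close>

lemma gen_scalar_in_maximal:
  assumes K: "field K" and \<mu>: "maximalideal \<mu> \<Gamma>" and c: "c \<in> carrier K" "scalar c \<in> \<mu>"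
  shows "c = \<zero>\<^bsub>K\<^esub>"
proof (rule ccontr)
  interpret C: cring \<Gamma> by (rule gen_cring)
  interpret \<mu>: maximalideal \<mu> \<Gamma> by fact
  interpret Kf: field K by fact
  assume "c \<noteq> \<zero>\<^bsub>K\<^esub>"
  then have cu: "c \<in> Units K" using c Kf.field_Units by simp
  then have "scalar (inv\<^bsub>K\<^esub> c) \<otimes>\<^bsub>\<Gamma>\<^esub> scalar c = \<one>\<^bsub>\<Gamma>\<^esub>"
    using ring_hom_mult[OF scalar_ring_hom, of "inv\<^bsub>K\<^esub> c" c] c by (simp add: gen_simps)
  moreover have "scalar (inv\<^bsub>K\<^esub> c) \<in> carrier \<Gamma>" using cu by (intro gen_mem) simp
  ultimately have "\<one>\<^bsub>\<Gamma>\<^esub> \<in> \<mu>" using c(2) \<mu>.I_l_closed by metis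
  then show False using \<mu>.one_imp_carrier \<mu>.I_notcarr by blast
qed

end
end

lemma (in abelian_group) diff_diff_cancel:
  assumes "x \<in> carrier G" "a \<in> carrier G" "b \<in> carrier G"
  shows "(x \<ominus> a) \<oplus> \<ominus> (x \<ominus> b) = b \<ominus> a"
proof -
  have "(x \<ominus> a) \<oplus> \<ominus> (x \<ominus> b) = x \<oplus> (\<ominus> x \<oplus> (b \<ominus> a))"
    using assms by (simp add: a_minus_def minus_add a_ac)
  then show ?thesis using assms by (simp add: r_neg2)
qed

lemma (in cring) genideal_subset_ideal:
  assumes "ideal I R" "S \<subseteq> carrier R"
  shows "Idl S \<subseteq> I \<longleftrightarrow> S \<subseteq> I"
  using genideal_minimal[OF assms(1)] genideal_self[OF assms(2)] by blast

text \<open>A set and the ideal it generates have the same zero locus, so the codimension of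
  \<open>Idl S\<close> is the infimum of a family with the single value \<open>t\<close>, and the
  depth equals it.\<close>

lemma (in cring) equidimensional_regular_sequence:
  assumes CM: "cohen_macaulay R" and S: "S \<subseteq> carrier R"
    and dim: "equidimensional_of_codim R (zero_locus R S) t"
  shows "Idl S \<noteq> carrier R" "\<exists>xs. set xs \<subseteq> Idl S \<and> length xs = t \<and> regular_sequence R xs"
proof -
  have I: "ideal (Idl S) R" using genideal_ideal[OF S] .
  have "zero_locus R S \<noteq> {}" using dim unfolding equidimensional_of_codim_def by blast
  then obtain m where m: "maximalideal m R" "S \<subseteq> m"
    unfolding zero_locus_def Specm_def by blast
  have mi: "ideal m R" by (rule maximalideal.axioms(1)[OF m(1)])
  have "Idl S \<subseteq> m" by (rule genideal_minimal[OF mi m(2)])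
  moreover have "m \<subseteq> carrier R" by (rule additive_subgroup.a_subset[OF ideal.axioms(1)[OF mi]])
  moreover have "carrier R \<noteq> m" by (rule maximalideal.I_notcarr[OF m(1)])
  ultimately show ne: "Idl S \<noteq> carrier R" by blast
  have "zero_locus R (Idl S) = zero_locus R S"
  proof -
    have "Idl S \<subseteq> m \<longleftrightarrow> S \<subseteq> m" if "maximalideal m R" for m
      using genideal_subset_ideal[OF maximalideal.axioms(1)[OF that] S] .
    then show ?thesis unfolding zero_locus_def Specm_def by blast
  qed
  then have codim: "codim_ideal R (Idl S) =
      Inf (codim_irreducible R ` irreducible_components R (zero_locus R S))"
    by (simp add: codim_ideal_def)
  have "has_depth R (Idl S) (codim_ideal R (Idl S))"
    using CM I ne by (simp add: cohen_macaulay_def)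
  then obtain xs where xs: "maximal_regular_sequence_in R (Idl S) xs" "enat (length xs) = codim_ideal R (Idl S)"
    unfolding has_depth_def by blast
  \<comment> \<open>Components exist because an empty infimum would be \<infinity>, whereas the
    codimension is the length of a sequence; no decomposition into components has to be
    constructed.\<close>
  have "irreducible_components R (zero_locus R S) \<noteq> {}"
  proof
    assume "irreducible_components R (zero_locus R S) = {}"
    then have "codim_ideal R (Idl S) = \<infinity>" by (simp add: codim top_enat_def)
    then show False using xs(2) by simp
  qed
  then have "codim_irreducible R ` irreducible_components R (zero_locus R S) = {enat t}"
    using image_cong[OF refl, of "irreducible_components R (zero_locus R S)" "codim_irreducible R" "\<lambda>_. enat t"] dim
    unfolding equidimensional_of_codim_def by (simp only: image_constant_conv if_False)
  then have "length xs = t" using xs(2) by (simp add: codim)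
  then show "\<exists>xs. set xs \<subseteq> Idl S \<and> length xs = t \<and> regular_sequence R xs"
    using xs(1) unfolding maximal_regular_sequence_in_def by blast
qed

lemma (in filtered_algebra) filtered_ring: "filtered_ring U F"
proof (intro filtered_ring.intro filtered_ring_axioms.intro)
  show "ring U" by (rule U.ring_axioms)
  show "additive_subgroup (F i) U" for i
    using submodule.axioms(1)[OF F_subspace[of i]] by (intro additive_subgroup.intro)
  show "\<one>\<^bsub>U\<^esub> \<in> F 0"
    using bij_betw_apply[OF F_zero, of "\<one>\<^bsub>K\<^esub>"] by simp
  show "F i \<subseteq> F (Suc i)" for i by (rule F_mono)
  show "x \<otimes>\<^bsub>U\<^esub> y \<in> F (i + j)" if "x \<in> F i" "y \<in> F j" for x y i j by (rule F_mult[OF that])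
  show "carrier U = (\<Union>i. F i)" by (rule F_exhaustive)
qed

section \<open>Symbols after subtraction of scalars\<close>

context filtered_algebra
begin

interpretation V: filtered_ring U F by (rule filtered_ring)

text \<open>In positive degree the scalar lies in a lower filtration step. In degree 0 the element
  \<open>g\<close> is itself a scalar; if it were nonzero its symbol would be a unit in the proper
  ideal \<open>I\<close>. So \<open>g\<close> is zero, and \<open>res\<close> forces
  \<open>c\<close> to be zero as well.\<close>

lemma symbol_shift:
  assumes K: "field K" and G: "cring (gr U F)" and g: "g \<in> carrier U" and c: "c \<in> carrier K"
    and I: "ideal I (gr U F)" "I \<noteq> carrier (gr U F)" "gr_symbol U F g \<in> I"
    and res: "\<And>c'. c' \<in> carrier K \<Longrightarrow> g = scalar c' \<Longrightarrow> c' = c"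
  defines "e \<equiv> LEAST i. g \<in> F i"
  shows "g \<ominus>\<^bsub>U\<^esub> scalar c \<in> F e" "V.homog e (g \<ominus>\<^bsub>U\<^esub> scalar c) = gr_symbol U F g"
proof -
  interpret Kf: field K by fact
  interpret G: cring "gr U F" by fact
  have "\<exists>i. g \<in> F i" using g F_exhaustive by blast
  then have ge: "g \<in> F e" unfolding e_def by (rule LeastI_ex)
  have sF: "scalar c \<in> F n" if "c \<in> carrier K" for c n
    using bij_betw_apply[OF F_zero, of c] that V.F_le[of 0 n] by auto
  have sym: "gr_symbol U F g = V.homog e g"
    by (rule ext) (simp add: gr_symbol_def V.homog_def e_def)
  show "g \<ominus>\<^bsub>U\<^esub> scalar c \<in> F e" using V.F_closed(4)[OF ge sF[OF c]] .
  have "V.homog e (g \<ominus>\<^bsub>U\<^esub> scalar c) = V.homog e g"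
  proof (cases e)
    case 0
    then obtain c' where c': "c' \<in> carrier K" "g = scalar c'"
      using ge F_zero by (auto simp: bij_betw_def)
    have "c' = \<zero>\<^bsub>K\<^esub>"
    proof (rule ccontr)
      assume "c' \<noteq> \<zero>\<^bsub>K\<^esub>"
      then have cu: "c' \<in> Units K" using c' Kf.field_Units by simp
      define u where "u = scalar (inv\<^bsub>K\<^esub> c')"
      have u: "u \<in> F 0" using sF cu by (simp add: u_def)
      have ug: "u \<otimes>\<^bsub>U\<^esub> g = \<one>\<^bsub>U\<^esub>"
        using ring_hom_mult[OF scalar_ring_hom, of "inv\<^bsub>K\<^esub> c'" c'] cu c' by (simp add: u_def)
      have "(V.homog 0 u \<otimes>\<^bsub>gr U F\<^esub> V.homog 0 g) n = \<one>\<^bsub>gr U F\<^esub> n" for n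
      proof (cases "n = 0")
        case True
        then show ?thesis
          using V.gr_mult_homog(1)[OF V.homog_carrier[OF u] ge[unfolded 0], of n u] u ug by (simp add: V.homog_def V.gr_simps(3))
      next
        case False
        have "V.homog 0 u (n - 0) = filt_pred U F (n - 0) +>\<^bsub>U\<^esub> \<zero>\<^bsub>U\<^esub>"
          using False by (simp add: V.homog_def V.coset_zero)
        then show ?thesis
          using V.gr_mult_homog(1)[OF V.homog_carrier[OF u] ge[unfolded 0], of n "\<zero>\<^bsub>U\<^esub>"] False g V.F_closed(1)
          by (simp add: V.gr_simps(3) V.coset_zero)
      qed
      then have "V.homog 0 u \<otimes>\<^bsub>gr U F\<^esub> V.homog 0 g = \<one>\<^bsub>gr U F\<^esub>" by (rule ext)
      then have "\<one>\<^bsub>gr U F\<^esub> \<in> I"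
        using ideal.I_l_closed[OF I(1,3) V.homog_carrier[OF u]] sym 0 by simp
      then show False using ideal.one_imp_carrier[OF I(1)] I(2) by simp
    qed
    then have "c = \<zero>\<^bsub>K\<^esub>" using res[OF c'] by simp
    then show ?thesis using g by (simp add: a_minus_def)
  next
    case (Suc e')
    have "(g \<ominus>\<^bsub>U\<^esub> scalar c) \<ominus>\<^bsub>U\<^esub> g = \<ominus>\<^bsub>U\<^esub> scalar c"
      using g c by (simp add: a_minus_def M.a_ac M.r_neg2)
    moreover have "\<ominus>\<^bsub>U\<^esub> scalar c \<in> filt_pred U F e"
      using V.F_closed(3)[OF sF[OF c]] Suc by (simp add: filt_pred_def)
    ultimately have "filt_pred U F e +>\<^bsub>U\<^esub> (g \<ominus>\<^bsub>U\<^esub> scalar c) = filt_pred U F e +>\<^bsub>U\<^esub> g"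
      using V.coset_eq_iff[of "g \<ominus>\<^bsub>U\<^esub> scalar c" g e] g c by simp
    then show ?thesis by (intro ext) (simp add: V.homog_def)
  qed
  then show "V.homog e (g \<ominus>\<^bsub>U\<^esub> scalar c) = gr_symbol U F g" using sym by simp
qed

end

section \<open>The simple module lifting a given character\<close>

theorem corollary1:
  fixes K :: "'k ring" and U :: "('k, 'u) module" and F :: "nat \<Rightarrow> 'u set"
    and t :: nat and g :: "nat \<Rightarrow> 'u" and \<mu> :: "'u set"
  assumes "algebraically_closed K"
    and "\<forall>n::nat. n > 0 \<longrightarrow> [n] \<cdot>\<^bsub>K\<^esub> \<one>\<^bsub>K\<^esub> \<noteq> \<zero>\<^bsub>K\<^esub>"
    and "filtered_algebra K U F"
    and "affine_algebra K (gr U F)"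
    and "cohen_macaulay (gr U F)"
    and "\<forall>i\<in>{1..t}. g i \<in> carrier U"
    and "\<forall>i\<in>{1..t}. \<forall>j\<in>{1..t}. g i \<otimes>\<^bsub>U\<^esub> g j = g j \<otimes>\<^bsub>U\<^esub> g i"
    and "equidimensional_of_codim (gr U F)
           (zero_locus (gr U F) ((\<lambda>i. gr_symbol U F (g i)) ` {1..t})) t"
    and "\<mu> \<in> Specm (generated_algebra K U (g ` {1..t}))"
  shows "\<exists>(M :: ('u, 'u set) module) v.
           simple_module U M \<and> v \<in> carrier M \<and>
           carrier M = {u \<odot>\<^bsub>M\<^esub> v | u. u \<in> carrier U} \<and>
           (\<forall>\<gamma> \<in> carrier (generated_algebra K U (g ` {1..t})).
              \<gamma> \<odot>\<^bsub>M\<^esub> v =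
              (character_of K (generated_algebra K U (g ` {1..t})) \<mu> \<gamma> \<odot>\<^bsub>U\<^esub> \<one>\<^bsub>U\<^esub>) \<odot>\<^bsub>M\<^esub> v)"
proof -
  define \<Gamma> where "\<Gamma> = generated_algebra K U (g ` {1..t})"
  interpret K: algebraically_closed K by (rule assms(1))
  interpret U: ring U
    using assms(3) by (simp add: filtered_algebra_def assoc_algebra_def)
  interpret A: filtered_algebra K U F by (rule assms(3))
  interpret V: filtered_ring U F by (rule A.filtered_ring)
  interpret G: cring "gr U F"
    using assms(4) unfolding affine_algebra_def algebra_def by blast
  let ?s = "\<lambda>c. c \<odot>\<^bsub>U\<^esub> \<one>\<^bsub>U\<^esub>"
  have S: "g ` {1..t} \<subseteq> carrier U" "\<forall>x\<in>g ` {1..t}. \<forall>y\<in>g ` {1..t}. x \<otimes>\<^bsub>U\<^esub> y = y \<otimes>\<^bsub>U\<^esub> x"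
    using assms(6,7) by blast+
  have \<mu>: "maximalideal \<mu> \<Gamma>" using assms(9) by (simp add: Specm_def \<Gamma>_def)
  note gen_simps = A.gen_simps[OF S, folded \<Gamma>_def]
  note gen_mem = A.gen_mem[OF S, folded \<Gamma>_def]
  note gen_minus = A.gen_minus[OF S, folded \<Gamma>_def]
  interpret \<Gamma>: cring \<Gamma> unfolding \<Gamma>_def by (rule A.gen_cring[OF S])
  interpret \<mu>: maximalideal \<mu> \<Gamma> by (rule \<mu>)
  have \<Gamma>U: "carrier \<Gamma> \<subseteq> carrier U"
    using A.gen_subring[OF S, folded \<Gamma>_def] by (rule subringE(1))
  have \<mu>U: "\<mu> \<subseteq> carrier U" using \<mu>.a_subset \<Gamma>U by blast
  have res: "\<exists>c\<in>carrier K. x \<ominus>\<^bsub>U\<^esub> ?s c \<in> \<mu>" if "x \<in> carrier \<Gamma>" for x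
    using A.gen_residue[OF S assms(1) finite_imageI[OF finite_atLeastAtMost] \<mu>[unfolded \<Gamma>_def], folded \<Gamma>_def, OF that] .
  have sU: "?s d \<in> carrier U" if "d \<in> carrier K" for d using that by simp
  \<comment> \<open>Two scalars congruent to the same element differ by a scalar lying in
    \<open>\<mu>\<close>, which must be zero.\<close>
  have uniq: "c = d" if c: "c \<in> carrier K" "d \<in> carrier K" and x: "x \<in> carrier U"
    and m: "x \<ominus>\<^bsub>U\<^esub> ?s c \<in> \<mu>" "x \<ominus>\<^bsub>U\<^esub> ?s d \<in> \<mu>" for c d x
  proof -
    have q: "x \<ominus>\<^bsub>U\<^esub> ?s d \<in> carrier \<Gamma>" using m(2) \<mu>.a_subset by blast
    have "(x \<ominus>\<^bsub>U\<^esub> ?s c) \<oplus>\<^bsub>\<Gamma>\<^esub> \<ominus>\<^bsub>\<Gamma>\<^esub> (x \<ominus>\<^bsub>U\<^esub> ?s d) \<in> \<mu>"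
      by (rule \<mu>.a_closed[OF m(1) \<mu>.a_inv_closed[OF m(2)]])
    then have "(x \<ominus>\<^bsub>U\<^esub> ?s c) \<oplus>\<^bsub>U\<^esub> \<ominus>\<^bsub>U\<^esub> (x \<ominus>\<^bsub>U\<^esub> ?s d) \<in> \<mu>"
      unfolding gen_simps(3) gen_minus[OF q] .
    also have "(x \<ominus>\<^bsub>U\<^esub> ?s c) \<oplus>\<^bsub>U\<^esub> \<ominus>\<^bsub>U\<^esub> (x \<ominus>\<^bsub>U\<^esub> ?s d) = ?s d \<ominus>\<^bsub>U\<^esub> ?s c"
      by (rule U.diff_diff_cancel[OF x sU[OF c(1)] sU[OF c(2)]])
    also have "\<dots> = ?s (d \<ominus>\<^bsub>K\<^esub> c)"
      using c by (simp add: a_minus_def A.smult_l_distr A.smult_l_minus)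
    finally have "d \<ominus>\<^bsub>K\<^esub> c = \<zero>\<^bsub>K\<^esub>"
      by (rule A.gen_scalar_in_maximal[OF S K.field_axioms \<mu>[unfolded \<Gamma>_def] K.minus_closed[OF c(2,1)]])
    then show ?thesis using c by simp
  qed
  have "\<forall>i\<in>{1..t}. \<exists>c. c \<in> carrier K \<and> g i \<ominus>\<^bsub>U\<^esub> ?s c \<in> \<mu>"
    using res[OF gen_mem(2)] by blast
  then obtain c where "\<forall>i\<in>{1..t}. c i \<in> carrier K \<and> g i \<ominus>\<^bsub>U\<^esub> ?s (c i) \<in> \<mu>"
    by (rule bchoice[THEN exE])
  then have c: "\<And>i. i \<in> {1..t} \<Longrightarrow> c i \<in> carrier K" "\<And>i. i \<in> {1..t} \<Longrightarrow> g i \<ominus>\<^bsub>U\<^esub> ?s (c i) \<in> \<mu>"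
    by blast+
  define S' where "S' = (\<lambda>i. gr_symbol U F (g i)) ` {1..t}"
  define e where "e i = (LEAST n. g i \<in> F n)" for i
  define g' where "g' i = g i \<ominus>\<^bsub>U\<^esub> ?s (c i)" for i
  define gs where "gs = map g' [1..<Suc t]"
  define es where "es = map e [1..<Suc t]"
  have set_upt: "set [1..<Suc t] = {1..t}" by auto
  have g'U: "g' i \<in> carrier U" if "i \<in> {1..t}" for i using \<mu>U c(2)[OF that] unfolding g'_def by blast
  have sym: "gr_symbol U F (g i) = V.homog (e i) (g i)" for i
    by (rule ext) (simp add: gr_symbol_def V.homog_def e_def)
  have "g i \<in> F (e i)" if i: "i \<in> {1..t}" for i
  proof -
    have "g i \<in> (\<Union>n. F n)" using assms(6) i V.F_exhaustive by simp
    then have "\<exists>n. g i \<in> F n" by blast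
    then show ?thesis unfolding e_def by (rule LeastI_ex[of "\<lambda>n. g i \<in> F n"])
  qed
  then have S'G: "S' \<subseteq> carrier (gr U F)"
    unfolding S'_def sym using V.homog_carrier by blast
  note reg = G.equidimensional_regular_sequence[OF assms(5) S'G assms(8)[folded S'_def]]
  obtain xs where xs: "set xs \<subseteq> Idl\<^bsub>gr U F\<^esub> S'" "length xs = t" "regular_sequence (gr U F) xs"
    using reg(2) by blast
  have shift: "g' i \<in> F (e i)" "V.homog (e i) (g' i) = gr_symbol U F (g i)" if i: "i \<in> {1..t}" for i
  proof -
    have "gr_symbol U F (g i) \<in> S'" using i unfolding S'_def by blast
    then have gI: "gr_symbol U F (g i) \<in> Idl\<^bsub>gr U F\<^esub> S'" using G.genideal_self[OF S'G] by blast
    have giU: "g i \<in> carrier U" using assms(6) i by blast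
    \<comment> \<open>If \<open>g i\<close> is itself a scalar, the zero difference lies in
      \<open>\<mu>\<close>, and uniqueness identifies that scalar with \<open>c i\<close>.\<close>
    have cc: "c' = c i" if c': "c' \<in> carrier K" "g i = ?s c'" for c'
    proof -
      have "g i \<ominus>\<^bsub>U\<^esub> ?s c' = \<zero>\<^bsub>\<Gamma>\<^esub>" using c' by (simp add: a_minus_def U.r_neg gen_simps(5))
      then have "g i \<ominus>\<^bsub>U\<^esub> ?s c' \<in> \<mu>" using \<mu>.zero_closed by simp
      then show ?thesis by (rule uniq[OF c'(1) c(1)[OF i] giU _ c(2)[OF i]])
    qed
    note sh = A.symbol_shift[OF K.field_axioms G.is_cring giU c(1)[OF i] G.genideal_ideal[OF S'G] reg(1) gI]
    show "g' i \<in> F (e i)" unfolding g'_def e_def by (rule sh(1)) (rule cc)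
    show "V.homog (e i) (g' i) = gr_symbol U F (g i)" unfolding g'_def e_def by (rule sh(2)) (rule cc)
  qed
  have lift: "list_all2 (\<lambda>g e. g \<in> F e) gs es"
    using shift(1) by (simp add: gs_def es_def list_all2_conv_all_nth del: upt_Suc)
  have hs: "set (map2 V.homog es gs) = S'"
  proof -
    have "map2 V.homog es gs = map (\<lambda>i. V.homog (e i) (g' i)) [1..<Suc t]"
      by (simp add: gs_def es_def map2_map_map)
    then have "set (map2 V.homog es gs) = (\<lambda>i. V.homog (e i) (g' i)) ` {1..t}" by (simp only: set_map set_upt)
    then show ?thesis using shift(2) by (simp add: S'_def)
  qed
  have gsU: "set gs \<subseteq> carrier U" unfolding gs_def set_map set_upt using g'U by blast
  have gs\<Gamma>: "set gs \<subseteq> carrier \<Gamma>" unfolding gs_def set_map set_upt g'_def using c(2) \<mu>.a_subset by blast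
  have comm: "x \<otimes>\<^bsub>U\<^esub> y = y \<otimes>\<^bsub>U\<^esub> x" if "x \<in> set gs" "y \<in> set gs" for x y
  proof -
    have "x \<otimes>\<^bsub>\<Gamma>\<^esub> y = y \<otimes>\<^bsub>\<Gamma>\<^esub> x" using that gs\<Gamma> by (intro \<Gamma>.m_comm) auto
    then show ?thesis unfolding gen_simps(2) .
  qed
  define J where "J = {lin_comb U us gs | us. set us \<subseteq> carrier U \<and> length us = length gs}"
  have J: "left_ideal J U" "set gs \<subseteq> J" unfolding J_def by (rule U.left_ideal_lin_comb[OF gsU])+
  have oneJ: "\<one>\<^bsub>U\<^esub> \<notin> J"
  proof
    assume "\<one>\<^bsub>U\<^esub> \<in> J"
    then obtain us where us: "set us \<subseteq> carrier U" "length us = length gs" "lin_comb U us gs = \<one>\<^bsub>U\<^esub>"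
      unfolding J_def by force
    have lgs: "length xs = length gs" using xs(2) by (simp add: gs_def)
    have "lin_comb U us gs \<noteq> \<one>\<^bsub>U\<^esub>"
    proof (rule V.one_notin_lin_comb[OF G.is_cring lift])
      show "x \<otimes>\<^bsub>U\<^esub> y = y \<otimes>\<^bsub>U\<^esub> x" if "x \<in> set gs" "y \<in> set gs" for x y by (rule comm[OF that])
      show "Idl\<^bsub>gr U F\<^esub> (set (map2 V.homog es gs)) \<noteq> carrier (gr U F)" unfolding hs by (rule reg(1))
      show "set xs \<subseteq> Idl\<^bsub>gr U F\<^esub> (set (map2 V.homog es gs))" unfolding hs by (rule xs(1))
    qed (fact lgs xs(3) us(1) us(2))+
    then show False using us(3) by blast
  qed
  have "\<exists>N. left_ideal N U \<and> J \<subseteq> N \<and> \<one>\<^bsub>U\<^esub> \<notin> N \<and> (\<forall>I. left_ideal I U \<longrightarrow> N \<subseteq> I \<longrightarrow> \<one>\<^bsub>U\<^esub> \<notin> I \<longrightarrow> I = N)"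
    by (rule U.exists_maximal_left_ideal[OF J(1) oneJ]) blast
  then obtain N where N: "left_ideal N U" "J \<subseteq> N" "\<one>\<^bsub>U\<^esub> \<notin> N"
    "\<And>I. left_ideal I U \<Longrightarrow> N \<subseteq> I \<Longrightarrow> \<one>\<^bsub>U\<^esub> \<notin> I \<Longrightarrow> I = N"
    by blast
  note Q = U.quot_module[OF N(1)]
  \<comment> \<open>Instead of showing that the shifted generators generate \<open>\<mu>\<close>,
    scalars are compared modulo \<open>\<mu>\<close> and \<open>N\<close> simultaneously. The
    elements congruent to a scalar modulo \<open>M\<close> include the generators and are closed
    under the ring operations; modulo \<open>\<mu>\<close> that scalar is the character value,
    modulo \<open>N\<close> it describes the action.\<close>
  define M where "M = \<mu> \<inter> N"
  have NL: "\<zero>\<^bsub>U\<^esub> \<in> N" "\<And>x y. x \<in> N \<Longrightarrow> y \<in> N \<Longrightarrow> x \<oplus>\<^bsub>U\<^esub> y \<in> N"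
    "\<And>a x. a \<in> carrier U \<Longrightarrow> x \<in> N \<Longrightarrow> a \<otimes>\<^bsub>U\<^esub> x \<in> N"
    using N(1) unfolding left_ideal_def by blast+
  have M: "\<zero>\<^bsub>U\<^esub> \<in> M" "\<And>x y. x \<in> M \<Longrightarrow> y \<in> M \<Longrightarrow> x \<oplus>\<^bsub>U\<^esub> y \<in> M"
    "\<And>a x. a \<in> carrier \<Gamma> \<Longrightarrow> x \<in> M \<Longrightarrow> a \<otimes>\<^bsub>U\<^esub> x \<in> M"
  proof -
    show "\<zero>\<^bsub>U\<^esub> \<in> M" unfolding M_def using \<mu>.zero_closed[unfolded gen_simps(5)] NL(1) by blast
    show "x \<oplus>\<^bsub>U\<^esub> y \<in> M" if "x \<in> M" "y \<in> M" for x y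
      using that NL(2)[of x y] \<mu>.a_closed[of x y, unfolded gen_simps(3)] unfolding M_def by blast
    show "a \<otimes>\<^bsub>U\<^esub> x \<in> M" if "a \<in> carrier \<Gamma>" "x \<in> M" for a x
      using that NL(3)[of a x] \<mu>.I_l_closed[of x a, unfolded gen_simps(2)] \<Gamma>U unfolding M_def by blast
  qed
  have MU: "M \<subseteq> carrier U" using \<mu>U by (auto simp: M_def)
  have "\<exists>d\<in>carrier K. x \<ominus>\<^bsub>U\<^esub> ?s d \<in> M" if "x \<in> carrier \<Gamma>" for x
    using that unfolding gen_simps(1)
  proof (induction rule: generate_ring.induct)
    case one
    show ?case using M(1) by (intro bexI[of _ "\<one>\<^bsub>K\<^esub>"]) (simp_all add: a_minus_def U.r_neg)
  next
    case (incl x)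
    show ?case
    proof (cases "x \<in> scalars K U")
      case True
      then obtain d where "d \<in> carrier K" "x = ?s d" unfolding scalars_def by blast
      then show ?thesis using M(1) by (intro bexI[of _ d]) (simp_all add: a_minus_def U.r_neg)
    next
      case False
      then obtain i where i: "i \<in> {1..t}" "x = g i" using incl by blast
      have "g' i \<in> set gs" unfolding gs_def set_map set_upt using i(1) by blast
      then have "g' i \<in> N" using J(2) N(2) by blast
      then have "g' i \<in> M" using c(2)[OF i(1)] unfolding M_def g'_def by blast
      then show ?thesis using c(1)[OF i(1)] i(2) unfolding g'_def by blast
    qed
  next
    case (a_inv x)
    then obtain d where d: "d \<in> carrier K" "x \<ominus>\<^bsub>U\<^esub> ?s d \<in> M" by blast
    have x: "x \<in> carrier U" using a_inv.hyps \<Gamma>U unfolding gen_simps(1) by blast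
    have "\<ominus>\<^bsub>U\<^esub> \<one>\<^bsub>U\<^esub> \<in> carrier \<Gamma>" using gen_minus[of "\<one>\<^bsub>U\<^esub>"] \<Gamma>.a_inv_closed[of "\<one>\<^bsub>U\<^esub>"] \<Gamma>.one_closed by (simp add: gen_simps(4))
    then have "(\<ominus>\<^bsub>U\<^esub> \<one>\<^bsub>U\<^esub>) \<otimes>\<^bsub>U\<^esub> (x \<ominus>\<^bsub>U\<^esub> ?s d) \<in> M" using M(3) d(2) by blast
    also have "(\<ominus>\<^bsub>U\<^esub> \<one>\<^bsub>U\<^esub>) \<otimes>\<^bsub>U\<^esub> (x \<ominus>\<^bsub>U\<^esub> ?s d) = \<ominus>\<^bsub>U\<^esub> x \<ominus>\<^bsub>U\<^esub> ?s (\<ominus>\<^bsub>K\<^esub> d)"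
      using x d(1) by (simp add: U.l_minus a_minus_def U.minus_add A.smult_l_minus)
    finally show ?case using d(1) by (intro bexI[of _ "\<ominus>\<^bsub>K\<^esub> d"]) simp_all
  next
    case (eng_add x y)
    then obtain d e where d: "d \<in> carrier K" "x \<ominus>\<^bsub>U\<^esub> ?s d \<in> M" and e: "e \<in> carrier K" "y \<ominus>\<^bsub>U\<^esub> ?s e \<in> M" by blast
    have x: "x \<in> carrier U" "y \<in> carrier U" using eng_add.hyps \<Gamma>U unfolding gen_simps(1) by blast+
    have "(x \<ominus>\<^bsub>U\<^esub> ?s d) \<oplus>\<^bsub>U\<^esub> (y \<ominus>\<^bsub>U\<^esub> ?s e) = (x \<oplus>\<^bsub>U\<^esub> y) \<ominus>\<^bsub>U\<^esub> ?s (d \<oplus>\<^bsub>K\<^esub> e)"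
      using x d(1) e(1) by (simp add: a_minus_def U.minus_add A.smult_l_distr U.a_ac)
    then show ?case using M(2)[OF d(2) e(2)] d(1) e(1) by (intro bexI[of _ "d \<oplus>\<^bsub>K\<^esub> e"]) simp_all
  next
    case (eng_mult x y)
    then obtain d e where d: "d \<in> carrier K" "x \<ominus>\<^bsub>U\<^esub> ?s d \<in> M" and e: "e \<in> carrier K" "y \<ominus>\<^bsub>U\<^esub> ?s e \<in> M" by blast
    have x: "x \<in> carrier U" "y \<in> carrier U" and x\<Gamma>: "x \<in> carrier \<Gamma>"
      using eng_mult.hyps \<Gamma>U unfolding gen_simps(1) by blast+
    \<comment> \<open>\<open>M\<close> is closed under multiplication from the left, so both
      correction terms have their factor from \<open>M\<close> on the right; this requires
      \<open>q\<close>, here a scalar, to commute with \<open>x\<close>.\<close>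
    have *: "x \<otimes>\<^bsub>U\<^esub> (y \<ominus>\<^bsub>U\<^esub> q) \<oplus>\<^bsub>U\<^esub> q \<otimes>\<^bsub>U\<^esub> (x \<ominus>\<^bsub>U\<^esub> p) = x \<otimes>\<^bsub>U\<^esub> y \<ominus>\<^bsub>U\<^esub> q \<otimes>\<^bsub>U\<^esub> p"
      if pq: "p \<in> carrier U" "q \<in> carrier U" "q \<otimes>\<^bsub>U\<^esub> x = x \<otimes>\<^bsub>U\<^esub> q" for p q
    proof -
      have "x \<otimes>\<^bsub>U\<^esub> (y \<ominus>\<^bsub>U\<^esub> q) \<oplus>\<^bsub>U\<^esub> q \<otimes>\<^bsub>U\<^esub> (x \<ominus>\<^bsub>U\<^esub> p)
        = x \<otimes>\<^bsub>U\<^esub> y \<oplus>\<^bsub>U\<^esub> (\<ominus>\<^bsub>U\<^esub> (x \<otimes>\<^bsub>U\<^esub> q) \<oplus>\<^bsub>U\<^esub> x \<otimes>\<^bsub>U\<^esub> q) \<oplus>\<^bsub>U\<^esub> \<ominus>\<^bsub>U\<^esub> (q \<otimes>\<^bsub>U\<^esub> p)"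
        using pq x by (simp add: a_minus_def U.r_distr U.r_minus U.a_assoc)
      then show ?thesis using pq x by (simp add: U.l_neg a_minus_def)
    qed
    have "x \<otimes>\<^bsub>U\<^esub> (y \<ominus>\<^bsub>U\<^esub> ?s e) \<oplus>\<^bsub>U\<^esub> ?s e \<otimes>\<^bsub>U\<^esub> (x \<ominus>\<^bsub>U\<^esub> ?s d) = x \<otimes>\<^bsub>U\<^esub> y \<ominus>\<^bsub>U\<^esub> ?s (e \<otimes>\<^bsub>K\<^esub> d)"
      using *[OF sU[OF d(1)] sU[OF e(1)] A.scalar_commute[OF e(1) x(1)]] ring_hom_mult[OF A.scalar_ring_hom e(1) d(1)] by simp
    moreover have "x \<otimes>\<^bsub>U\<^esub> (y \<ominus>\<^bsub>U\<^esub> ?s e) \<oplus>\<^bsub>U\<^esub> ?s e \<otimes>\<^bsub>U\<^esub> (x \<ominus>\<^bsub>U\<^esub> ?s d) \<in> M"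
      by (rule M(2)[OF M(3)[OF x\<Gamma> e(2)] M(3)[OF gen_mem(1)[OF e(1)] d(2)]])
    ultimately show ?case using d(1) e(1) by (intro bexI[of _ "e \<otimes>\<^bsub>K\<^esub> d"]) simp_all
  qed
  then have resN: "\<exists>d\<in>carrier K. x \<ominus>\<^bsub>U\<^esub> ?s d \<in> \<mu> \<and> x \<ominus>\<^bsub>U\<^esub> ?s d \<in> N" if "x \<in> carrier \<Gamma>" for x
    using that unfolding M_def by blast
  \<comment> \<open>The scalar from \<open>resN\<close> is congruent to \<open>x\<close> modulo
    \<open>\<mu>\<close>, so it is the character value by \<open>uniq\<close>, and its congruence
    modulo \<open>N\<close> carries over.\<close>
  have char: "character_of K \<Gamma> \<mu> x \<in> carrier K \<and> x \<ominus>\<^bsub>U\<^esub> ?s (character_of K \<Gamma> \<mu> x) \<in> N" if x: "x \<in> carrier \<Gamma>" for x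
  proof -
    obtain d where d: "d \<in> carrier K" "x \<ominus>\<^bsub>U\<^esub> ?s d \<in> \<mu>" "x \<ominus>\<^bsub>U\<^esub> ?s d \<in> N"
      using resN[OF x] by blast
    have minus: "x \<ominus>\<^bsub>\<Gamma>\<^esub> ?s d = x \<ominus>\<^bsub>U\<^esub> ?s d" if "d \<in> carrier K" for d
      unfolding a_minus_def gen_minus[OF gen_mem(1)[OF that]] gen_simps(3) ..
    have "character_of K \<Gamma> \<mu> x = d"
      unfolding character_of_def
    proof (rule the_equality)
      show "d \<in> carrier K \<and> x \<ominus>\<^bsub>\<Gamma>\<^esub> d \<odot>\<^bsub>\<Gamma>\<^esub> \<one>\<^bsub>\<Gamma>\<^esub> \<in> \<mu>" using d minus[OF d(1)] unfolding gen_simps(4,6) by simp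
      fix d' assume "d' \<in> carrier K \<and> x \<ominus>\<^bsub>\<Gamma>\<^esub> d' \<odot>\<^bsub>\<Gamma>\<^esub> \<one>\<^bsub>\<Gamma>\<^esub> \<in> \<mu>"
      then have "d' \<in> carrier K" "x \<ominus>\<^bsub>U\<^esub> ?s d' \<in> \<mu>" using minus[of d'] unfolding gen_simps(4,6) by simp_all
      then show "d' = d" using uniq[OF _ d(1) _ _ d(2)] x \<Gamma>U by blast
    qed
    then show ?thesis using d by simp
  qed
  let ?M = "quot_module U N" and ?v = "N +>\<^bsub>U\<^esub> \<one>\<^bsub>U\<^esub>"
  have act: "u \<odot>\<^bsub>?M\<^esub> ?v = N +>\<^bsub>U\<^esub> u" if "u \<in> carrier U" for u
    using Q(4)[of u "\<one>\<^bsub>U\<^esub>"] that by simp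
  have "simple_module U ?M" by (rule U.quot_module_simple[OF N(1,3,4)])
  moreover have "?v \<in> carrier ?M" unfolding Q(1) using U.one_closed by blast
  moreover have "carrier ?M = {u \<odot>\<^bsub>?M\<^esub> ?v | u. u \<in> carrier U}" unfolding Q(1) using act by metis
  moreover have "x \<odot>\<^bsub>?M\<^esub> ?v = ?s (character_of K \<Gamma> \<mu> x) \<odot>\<^bsub>?M\<^esub> ?v" if x: "x \<in> carrier \<Gamma>" for x
  proof -
    have xU: "x \<in> carrier U" using x \<Gamma>U by blast
    have cU: "?s (character_of K \<Gamma> \<mu> x) \<in> carrier U" using char[OF x] sU by blast
    show ?thesis unfolding act[OF xU] act[OF cU] using Q(5)[OF xU cU] char[OF x] by blast
  qed
  ultimately show ?thesis unfolding \<Gamma>_def by blast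
qed

end
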